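(* Let $p=6$, let $\mathcal G$ be a compact connected metric graph and write $\mu_1=\mu_1(\mathcal G,6)$. Let $\mu_{\mathbb R^+}=\frac{\pi\sqrt3}{4}$ and $\mu_{\mathbb R}=\frac{\pi\sqrt3}{2}$. (i) If $\mathcal G$ has a terminal edge, then for every $\mu\in(\mu_{\mathbb R^+},\mu_1)$ there exists a solution $u\in H^2_K(\mathcal G)$, for some $\lambda\in\mathbb R$, of $u''+|u|^{4}u-\lambda u=0$ with $\|u\|_2^2=\mu$ which is orbitally stable, namely $u=\kappa_\mu:=\sqrt{\mu/|\mathcal G|}$. (ii) If $\mathcal G$ admits a cycle covering, then for every $\mu\in(\mu_{\mathbb R},\mu_1)$ there exists a solution $u\in H^2_K(\mathcal G)$, for some $\lambda\in\mathbb R$, of $u''+|u|^{4}u-\lambda u=0$ with $\|u\|_2^2=\mu$ which is orbitally stable, namely $u=\kappa_\mu$.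
   Context: A compact metric graph $\mathcal G$ is formed by finitely many edges (bounded intervals $I_e=[0,\ell_e]$, $0<\ell_e<\infty$) with some endpoints glued together at vertices; self-loops and multiple edges are allowed. All graphs are connected. $|\mathcal G|=\sum_e\ell_e$ is the total length. Integrals and $L^p(\mathcal G)$ norms $\|\cdot\|_p$ are defined edge by edge with Lebesgue measure. $H^1(\mathcal G)$ is the space of continuous $u:\mathcal G\to\mathbb C$ whose restriction $u_e$ to each edge is in $H^1(I_e)$, with norm $\|u\|_{H^1}=\|u'\|_2+\|u\|_2$. $H^2_K(\mathcal G)$ is the space of $u\in H^1(\mathcal G)$ with $u_e\in H^2(I_e)$ for all $e$ satisfying the Kirchhoff condition at each vertex: the sum of outgoing derivatives along all edges incident at the vertex is $0$. For $\mu>0$, $H^1_\mu(\mathcal G)=\{u\in H^1(\mathcal G):\|u\|_2^2=\mu\}$. A terminal edge is an edge ending at a vertex of degree 1. $\mathcal G$ admits a cycle covering if it can be covered by cycles, a cycle being a closed path (loop) without edge repetitions; i.e. every edge belongs to some cycle. Let $E(u)=\frac12\|u'\|_2^2-\frac16\|u\|_6^6$. $\mu_1(\mathcal G,6)>0$ denotes the threshold mass for local minimality of the constants: $\kappa_\mu$ is a local minimizer (in the $H^1$ topology) of $E$ in $H^1_\mu(\mathcal G)$ for $\mu<\mu_1(\mathcal G,6)$, and is not for $\mu>\mu_1(\mathcal G,6)$. In the paper it is defined explicitly by $\mu_1(\mathcal G,6)=|\mathcal G|\left(\lambda_2(\mathcal G)/4\right)^{1/2}$, where $\lambda_2(\mathcal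 G)=\inf\{\int_{\mathcal G}|\varphi'|^2dx/\int_{\mathcal G}|\varphi|^2dx:\ \varphi\in H^1(\mathcal G)\setminus\{0\},\ \int_{\mathcal G}\varphi\,dx=0\}$. The NLS equation is $i\partial_t v=-v''-|v|^{4}v$ on $\mathcal G$ (with Kirchhoff conditions), solved with initial data in $H^1(\mathcal G)$. A stationary solution $u$ is orbitally stable if for every $\varepsilon>0$ there is $\delta>0$ such that, whenever $v_0\in H^1(\mathcal G)$ satisfies $\inf_{\theta\in\mathbb R}\|v_0-e^{i\theta}u\|_{H^1}<\delta$, the solution $v$ of the NLS equation with initial datum $v_0$ satisfies $\sup_t\inf_{\theta\in\mathbb R}\|v(t)-e^{i\theta}u\|_{H^1}<\varepsilon$, with $t\ge0$ ranging over its interval of existence. *)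

theory Defs
  imports "HOL-Analysis.Analysis" "Graph_Theory.Digraph_Component"
begin

section \<open>Compact metric graphs\<close>

text \<open>
  A metric graph is a finite multi-digraph \<open>G\<close> together with edge lengths \<open>l\<close>. The edge \<open>e\<close> is the
  interval \<open>[0, l e]\<close>, whose endpoint \<open>0\<close> is glued to \<open>tail G e\<close> and whose endpoint \<open>l e\<close> is glued to
  \<open>head G e\<close>; the orientation only serves as a choice of coordinate. Loops and parallel edges are
  allowed. \<open>Digraph_Component.connected\<close> is connectedness of the underlying undirected graph.
\<close>

definition compact_metric_graph :: "('v, 'e) pre_digraph \<Rightarrow> ('e \<Rightarrow> real) \<Rightarrow> bool" where
  "compact_metric_graph G l \<longleftrightarrow>
     fin_digraph G \<and> arcs G \<noteq> {} \<and> Digraph_Component.connected G \<and> (\<forall>e\<in>arcs G. 0 < l e)"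

definition total_length :: "('v, 'e) pre_digraph \<Rightarrow> ('e \<Rightarrow> real) \<Rightarrow> real" where
  "total_length G l = (\<Sum>e\<in>arcs G. l e)"

text \<open>The undirected degree; a loop contributes 2.\<close>

definition vdegree :: "('v, 'e) pre_digraph \<Rightarrow> 'v \<Rightarrow> nat" where
  "vdegree G v = in_degree G v + out_degree G v"

definition has_terminal_edge :: "('v, 'e) pre_digraph \<Rightarrow> bool" where
  "has_terminal_edge G \<longleftrightarrow> (\<exists>e\<in>arcs G. \<exists>v\<in>{tail G e, head G e}. vdegree G v = 1)"

text \<open>
  Each edge with its two directions of travel: \<open>(e, True)\<close> runs from tail to head, \<open>(e, False)\<close> from
  head to tail. Directed walks here are the undirected walks of \<open>G\<close>.
\<close>

definition bidirected :: "('v, 'e) pre_digraph \<Rightarrow> ('v, 'e \<times> bool) pre_digraph" where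
  "bidirected G = \<lparr> verts = verts G, arcs = arcs G \<times> UNIV,
     tail = (\<lambda>(e, b). if b then tail G e else head G e),
     head = (\<lambda>(e, b). if b then head G e else tail G e) \<rparr>"

definition graph_cycle :: "('v, 'e) pre_digraph \<Rightarrow> ('e \<times> bool) list \<Rightarrow> bool" where
  "graph_cycle G p \<longleftrightarrow>
     p \<noteq> [] \<and> (\<exists>v. pre_digraph.awalk (bidirected G) v p v) \<and> distinct (map fst p)"

definition has_cycle_covering :: "('v, 'e) pre_digraph \<Rightarrow> bool" where
  "has_cycle_covering G \<longleftrightarrow> (\<forall>e\<in>arcs G. \<exists>p. graph_cycle G p \<and> e \<in> fst ` set p)"


section \<open>Sobolev spaces on an interval\<close>

definition L2_interval :: "real \<Rightarrow> (real \<Rightarrow> complex) \<Rightarrow> bool" where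
  "L2_interval a f \<longleftrightarrow>
     f \<in> borel_measurable (lebesgue_on {0..a}) \<and> integrable (lebesgue_on {0..a}) (\<lambda>x. (cmod (f x))\<^sup>2)"

definition test_function :: "real \<Rightarrow> (real \<Rightarrow> real) \<Rightarrow> bool" where
  "test_function a \<phi> \<longleftrightarrow>
     \<phi> C1_differentiable_on UNIV \<and>
     compact (closure {x. \<phi> x \<noteq> 0}) \<and> closure {x. \<phi> x \<noteq> 0} \<subseteq> {0<..<a}"

definition weak_deriv :: "real \<Rightarrow> (real \<Rightarrow> complex) \<Rightarrow> (real \<Rightarrow> complex) \<Rightarrow> bool" where
  "weak_deriv a f g \<longleftrightarrow>
     (\<forall>\<phi>. test_function a \<phi> \<longrightarrow>
        (LINT x|lebesgue_on {0..a}. deriv \<phi> x *\<^sub>R f x) =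
        - (LINT x|lebesgue_on {0..a}. \<phi> x *\<^sub>R g x))"

definition H1_interval :: "real \<Rightarrow> (real \<Rightarrow> complex) \<Rightarrow> bool" where
  "H1_interval a f \<longleftrightarrow> L2_interval a f \<and> (\<exists>g. L2_interval a g \<and> weak_deriv a f g)"

text \<open>A representative of the weak derivative, unique up to null sets of \<open>[0, a]\<close>.\<close>

definition wderiv :: "real \<Rightarrow> (real \<Rightarrow> complex) \<Rightarrow> real \<Rightarrow> complex" where
  "wderiv a f = (SOME g. L2_interval a g \<and> weak_deriv a f g)"

definition H2_interval :: "real \<Rightarrow> (real \<Rightarrow> complex) \<Rightarrow> bool" where
  "H2_interval a f \<longleftrightarrow> H1_interval a f \<and> H1_interval a (wderiv a f)"


section \<open>Functions on a metric graph\<close>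

text \<open>
  A function on the graph is a family \<open>u\<close> with \<open>u e\<close> its restriction to the edge \<open>e\<close>. Only the values
  \<open>u e x\<close> with \<open>e \<in> arcs G\<close> and \<open>0 \<le> x \<le> l e\<close> are relevant.
\<close>

type_synonym 'e gfun = "'e \<Rightarrow> real \<Rightarrow> complex"

definition gintegral ::
  "('v, 'e) pre_digraph \<Rightarrow> ('e \<Rightarrow> real) \<Rightarrow> ('e \<Rightarrow> real \<Rightarrow> 'b::{banach, second_countable_topology}) \<Rightarrow> 'b"
where
  "gintegral G l f = (\<Sum>e\<in>arcs G. LINT x|lebesgue_on {0..l e}. f e x)"

definition Lp_norm :: "('v, 'e) pre_digraph \<Rightarrow> ('e \<Rightarrow> real) \<Rightarrow> nat \<Rightarrow> 'e gfun \<Rightarrow> real" where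
  "Lp_norm G l p u = root p (gintegral G l (\<lambda>e x. (cmod (u e x)) ^ p))"

definition gderiv :: "('e \<Rightarrow> real) \<Rightarrow> 'e gfun \<Rightarrow> 'e gfun" where
  "gderiv l u = (\<lambda>e. wderiv (l e) (u e))"

definition continuous_on_graph :: "('v, 'e) pre_digraph \<Rightarrow> ('e \<Rightarrow> real) \<Rightarrow> 'e gfun \<Rightarrow> bool" where
  "continuous_on_graph G l u \<longleftrightarrow>
     (\<forall>e\<in>arcs G. continuous_on {0..l e} (u e)) \<and>
     (\<exists>U :: 'v \<Rightarrow> complex. \<forall>e\<in>arcs G. u e 0 = U (tail G e) \<and> u e (l e) = U (head G e))"

definition H1_graph :: "('v, 'e) pre_digraph \<Rightarrow> ('e \<Rightarrow> real) \<Rightarrow> 'e gfun set" where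
  "H1_graph G l = {u. continuous_on_graph G l u \<and> (\<forall>e\<in>arcs G. H1_interval (l e) (u e))}"

definition H1_norm :: "('v, 'e) pre_digraph \<Rightarrow> ('e \<Rightarrow> real) \<Rightarrow> 'e gfun \<Rightarrow> real" where
  "H1_norm G l u = Lp_norm G l 2 (gderiv l u) + Lp_norm G l 2 u"

text \<open>
  A continuous function in \<open>H\<^sup>2\<close> of an interval is continuously differentiable up to the endpoints, so
  the outgoing derivatives are one-sided classical derivatives. A loop contributes to both sums.
\<close>

definition kirchhoff :: "('v, 'e) pre_digraph \<Rightarrow> ('e \<Rightarrow> real) \<Rightarrow> 'e gfun \<Rightarrow> bool" where
  "kirchhoff G l u \<longleftrightarrow>
     (\<forall>v\<in>verts G.
        (\<Sum>e\<in>out_arcs G v. vector_derivative (u e) (at 0 within {0..l e})) +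
        (\<Sum>e\<in>in_arcs G v. - vector_derivative (u e) (at (l e) within {0..l e})) = 0)"

definition H2K_graph :: "('v, 'e) pre_digraph \<Rightarrow> ('e \<Rightarrow> real) \<Rightarrow> 'e gfun set" where
  "H2K_graph G l =
     {u \<in> H1_graph G l. (\<forall>e\<in>arcs G. H2_interval (l e) (u e)) \<and> kirchhoff G l u}"

definition lambda2 :: "('v, 'e) pre_digraph \<Rightarrow> ('e \<Rightarrow> real) \<Rightarrow> real" where
  "lambda2 G l = Inf
     {gintegral G l (\<lambda>e x. (cmod (gderiv l \<phi> e x))\<^sup>2) / gintegral G l (\<lambda>e x. (cmod (\<phi> e x))\<^sup>2) | \<phi>.
        \<phi> \<in> H1_graph G l \<and> (\<exists>e\<in>arcs G. \<exists>x\<in>{0..l e}. \<phi> e x \<noteq> 0) \<and> gintegral G l \<phi> = 0}"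

text \<open>The threshold mass \<open>\<mu>\<^sub>1(G, 6)\<close>.\<close>

definition mu1_6 :: "('v, 'e) pre_digraph \<Rightarrow> ('e \<Rightarrow> real) \<Rightarrow> real" where
  "mu1_6 G l = total_length G l * sqrt (lambda2 G l / 4)"


section \<open>The quintic NLS equation\<close>

text \<open>\<open>u'' + |u|\<^sup>4 u - \<lambda> u = 0\<close> almost everywhere on each edge.\<close>

definition stationary_eq :: "('v, 'e) pre_digraph \<Rightarrow> ('e \<Rightarrow> real) \<Rightarrow> real \<Rightarrow> 'e gfun \<Rightarrow> bool" where
  "stationary_eq G l lam u \<longleftrightarrow>
     (\<forall>e\<in>arcs G. AE x in lebesgue_on {0..l e}.
        gderiv l (gderiv l u) e x + of_real ((cmod (u e x)) ^ 4) * u e x - of_real lam * u e x = 0)"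

definition ginner :: "('v, 'e) pre_digraph \<Rightarrow> ('e \<Rightarrow> real) \<Rightarrow> 'e gfun \<Rightarrow> 'e gfun \<Rightarrow> complex" where
  "ginner G l u w = gintegral G l (\<lambda>e x. u e x * cnj (w e x))"

text \<open>
  Strong \<open>H\<^sup>1\<close> solutions of \<open>i v\<^sub>t = - v'' - |v|\<^sup>4 v\<close> on \<open>[0, T)\<close>, \<open>0 < T \<le> \<infinity>\<close>: curves in \<open>C([0, T), H\<^sup>1)\<close>
  satisfying the equation in the dual of \<open>H\<^sup>1\<close>, where \<open>- v''\<close> acts by \<open>\<phi> \<mapsto> \<langle>v', \<phi>'\<rangle>\<close>. Testing with all
  \<open>\<phi> \<in> H\<^sup>1\<close>, including those not vanishing at the vertices, is the weak form of the Kirchhoff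
  conditions. Since the right-hand side is continuous in \<open>t\<close> with values in the dual, the pointwise
  derivatives below amount to \<open>v \<in> C\<^sup>1([0, T), (H\<^sup>1)\<^sup>*)\<close>.
\<close>

definition time_interval :: "ereal \<Rightarrow> real set" where
  "time_interval T = {t. 0 \<le> t \<and> ereal t < T}"

definition nls_solution ::
  "('v, 'e) pre_digraph \<Rightarrow> ('e \<Rightarrow> real) \<Rightarrow> ereal \<Rightarrow> 'e gfun \<Rightarrow> (real \<Rightarrow> 'e gfun) \<Rightarrow> bool"
where
  "nls_solution G l T v0 v \<longleftrightarrow>
     (\<forall>t\<in>time_interval T. v t \<in> H1_graph G l) \<and>
     (\<forall>e\<in>arcs G. \<forall>x\<in>{0..l e}. v 0 e x = v0 e x) \<and>
     (\<forall>t\<in>time_interval T.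
        ((\<lambda>s. H1_norm G l (\<lambda>e x. v s e x - v t e x)) \<longlongrightarrow> 0) (at t within time_interval T)) \<and>
     (\<forall>\<phi>\<in>H1_graph G l. \<forall>t\<in>time_interval T. \<exists>d.
        ((\<lambda>s. ginner G l (v s) \<phi>) has_vector_derivative d) (at t within time_interval T) \<and>
        \<i> * d = ginner G l (gderiv l (v t)) (gderiv l \<phi>)
                - ginner G l (\<lambda>e x. of_real ((cmod (v t e x)) ^ 4) * v t e x) \<phi>)"

definition orbit_dist ::
  "('v, 'e) pre_digraph \<Rightarrow> ('e \<Rightarrow> real) \<Rightarrow> 'e gfun \<Rightarrow> 'e gfun \<Rightarrow> real"
where
  "orbit_dist G l w u = (INF \<theta>::real. H1_norm G l (\<lambda>e x. w e x - cis \<theta> * u e x))"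

text \<open>
  The Cauchy problem is locally well posed in \<open>H\<^sup>1\<close>, so quantifying over all solutions on all intervals
  \<open>[0, T)\<close> is the same as taking the maximal one. The supremum is taken in the extended reals as it is
  not known a priori to be finite.
\<close>

definition orbitally_stable :: "('v, 'e) pre_digraph \<Rightarrow> ('e \<Rightarrow> real) \<Rightarrow> 'e gfun \<Rightarrow> bool" where
  "orbitally_stable G l u \<longleftrightarrow>
     (\<forall>\<epsilon>>0. \<exists>\<delta>>0. \<forall>v0\<in>H1_graph G l. orbit_dist G l v0 u < \<delta> \<longrightarrow>
        (\<forall>T v. 0 < T \<and> nls_solution G l T v0 v \<longrightarrow>
           (SUP t\<in>time_interval T. ereal (orbit_dist G l (v t) u)) < ereal \<epsilon>))"

definition kappa :: "('v, 'e) pre_digraph \<Rightarrow> ('e \<Rightarrow> real) \<Rightarrow> real \<Rightarrow> 'e gfun" where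
  "kappa G l \<mu> = (\<lambda>e x. of_real (sqrt (\<mu> / total_length G l)))"

definition mu_halfline :: real where
  "mu_halfline = pi * sqrt 3 / 4"

definition mu_line :: real where
  "mu_line = pi * sqrt 3 / 2"

end

theory Submission
  imports Defs
begin

text \<open>
  Both parts are instances of one statement: for \<open>0 < \<mu> < \<mu>\<^sub>1\<close> the constant \<open>c = sqrt (\<mu> / L)\<close>, with \<open>L\<close> the
  total length, is orbitally stable; the lower bounds on \<open>\<mu>\<close> are positive. The condition \<open>\<mu> < \<mu>\<^sub>1\<close> reads
  \<open>4 c\<^sup>4 < \<lambda>\<^sub>2\<close>. The proof is Lyapunov's method for the conserved mass and energy.

  Conservation has to be derived from the weak formulation, in which a solution is only continuous in
  \<open>H\<^sup>1\<close>, so that \<open>v\<^sub>t\<close> lies in the dual of \<open>H\<^sup>1\<close> and may not be paired with \<open>v''\<close>. Testing the equation with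
  \<open>v(s) - v(t)\<close> gives \<open>\<parallel>v(s) - v(t)\<parallel>\<^sub>2\<^sup>2 \<le> K \<bar>s - t\<bar> \<parallel>v(s) - v(t)\<parallel>\<close> with the \<open>H\<^sup>1\<close> norm on the right
  (\<open>sqn_increment_bound\<close>), and with it the mass is differentiable with derivative zero. For the energy,
  consider the correlation \<open>Im \<langle>v(t + h), v(t)\<rangle>\<close>. Its \<open>t\<close>-derivative contains no \<open>v'\<close>, because the two
  kinetic terms cancel; by an algebraic identity for the quintic nonlinearity it equals four times the
  increment of \<open>\<parallel>v\<parallel>\<^sub>6\<^sup>6 / 6\<close> up to an error \<open>o(h)\<close> uniform in \<open>t\<close>. Divided by \<open>h\<close>, the correlation tends to
  \<open>\<parallel>v\<parallel>\<^sub>6\<^sup>6 - \<parallel>v'\<parallel>\<^sub>2\<^sup>2\<close>, and the two statements combine to \<open>E(v(b)) = E(v(0))\<close> (\<open>energy_conservation\<close>).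

  For coercivity, write \<open>u = k + z\<close> where \<open>\<bar>k\<bar> = c\<close> and the phase of \<open>k\<close> minimises the distance of \<open>u\<close> to the
  orbit. With \<open>q = \<bar>u\<bar>\<^sup>2 - c\<^sup>2\<close> the energy is exactly
  \<open>E(u) = E(c) - c\<^sup>4 (\<integral>q) / 2 + \<parallel>z'\<parallel>\<^sub>2\<^sup>2 / 2 - c\<^sup>2 (\<integral>q\<^sup>2) / 2 - (\<integral>q\<^sup>3) / 6\<close>, where \<open>\<integral>q\<close> is the excess mass. As \<open>\<integral>q\<^sup>2\<close> is at
  most \<open>4 c\<^sup>2 \<parallel>z\<parallel>\<^sub>2\<^sup>2\<close> plus cubic terms, and the mean of \<open>z\<close> is controlled by the excess mass and
  \<open>\<parallel>z\<parallel>\<^sub>2\<^sup>2\<close>, the Poincare inequality with constant \<open>\<lambda>\<^sub>2 > 4 c\<^sup>4\<close> bounds the squared distance by a conserved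
  quantity (\<open>excess_coercive\<close>). Continuity in time then keeps the solution near the orbit.
\<close>

section \<open>Weak derivatives on an interval\<close>

lemma has_field_derivative_mult_abs:
  fixes x :: real
  shows "((\<lambda>x. x * \<bar>x\<bar>) has_field_derivative 2 * \<bar>x\<bar>) (at x)"
proof (cases "x = 0")
  case True
  have "((\<lambda>h::real. \<bar>h\<bar>) \<longlongrightarrow> 0) (at 0)"
    using tendsto_rabs_zero[OF tendsto_ident_at[of "0::real" UNIV]] by simp
  then have "((\<lambda>h::real. h * \<bar>h\<bar> / h) \<longlongrightarrow> 0) (at 0)"
    by (rule Lim_transform_eventually) (auto simp: eventually_at_filter)
  then show ?thesis using True by (simp add: DERIV_def)
next
  case False
  have "((\<lambda>x. x * \<bar>x\<bar>) has_field_derivative 2 * x) (at x)" if "x > 0"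
    by (rule has_field_derivative_transform_within_open[of "\<lambda>x. x * x" _ _ "{0<..}"])
      (use that in \<open>auto intro!: derivative_eq_intros\<close>)
  moreover have "((\<lambda>x. x * \<bar>x\<bar>) has_field_derivative 2 * (- x)) (at x)" if "x < 0"
    by (rule has_field_derivative_transform_within_open[of "\<lambda>x. - (x * x)" _ _ "{..<0}"])
      (use that in \<open>auto intro!: derivative_eq_intros\<close>)
  ultimately show ?thesis using False by (cases "x > 0") auto
qed

text \<open>
  A continuously differentiable step: \<open>0\<close> on the negative axis, \<open>1\<close> to the right of \<open>1\<close>, and a quadratic
  spline in between. Expressing the spline through \<open>s * \<bar>s\<bar>\<close> avoids case distinctions at the knots.
\<close>
definition smooth_step :: "real \<Rightarrow> real" where
  "smooth_step s = 1/2 + s * \<bar>s\<bar> - 2 * ((s - 1/2) * \<bar>s - 1/2\<bar>) + (s - 1) * \<bar>s - 1\<bar>"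

text \<open>The derivative of the step: the tent function of integral \<open>1\<close> supported on \<open>[0, 1]\<close>.\<close>
definition tent :: "real \<Rightarrow> real" where
  "tent s = 2 * \<bar>s\<bar> - 4 * \<bar>s - 1/2\<bar> + 2 * \<bar>s - 1\<bar>"

lemma smooth_step_deriv: "(smooth_step has_field_derivative tent s) (at s)"
proof -
  have *: "((\<lambda>s. (s - a) * \<bar>s - a\<bar>) has_field_derivative 2 * \<bar>s - a\<bar>) (at s)" for a :: real
    using DERIV_chain2[where f="\<lambda>x. x * \<bar>x\<bar>" and g="\<lambda>s. s - a" and Db=1 and x=s,
        OF has_field_derivative_mult_abs]
    by (simp add: DERIV_diff[OF DERIV_ident DERIV_const, simplified])
  show ?thesis
    unfolding smooth_step_def tent_def
    by (rule derivative_eq_intros has_field_derivative_mult_abs * refl)+ simp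
qed

lemma tent_nonneg: "0 \<le> tent s" by (auto simp: tent_def abs_if)
lemma tent_eq_0: "s \<le> 0 \<or> 1 \<le> s \<Longrightarrow> tent s = 0" by (auto simp: tent_def abs_if)
lemma smooth_step_eq_0: "s \<le> 0 \<Longrightarrow> smooth_step s = 0"
  by (simp add: smooth_step_def abs_if) algebra
lemma smooth_step_eq_1: "1 \<le> s \<Longrightarrow> smooth_step s = 1"
  by (simp add: smooth_step_def abs_if) algebra

lemma smooth_step_mono: "s \<le> t \<Longrightarrow> smooth_step s \<le> smooth_step t"
  by (rule DERIV_nonneg_imp_nondecreasing[of s t smooth_step]) (use smooth_step_deriv tent_nonneg in auto)

lemma smooth_step_range: "0 \<le> smooth_step s" "smooth_step s \<le> 1"
  using smooth_step_mono[of "min s 0" s] smooth_step_mono[of s "max s 1"]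
    smooth_step_eq_0[of "min s 0"] smooth_step_eq_1[of "max s 1"] by auto

lemma continuous_on_tent [continuous_intros]: "continuous_on S f \<Longrightarrow> continuous_on S (\<lambda>x. tent (f x))"
  unfolding tent_def by (intro continuous_intros)

lemma continuous_on_smooth_step [continuous_intros]:
  "continuous_on S f \<Longrightarrow> continuous_on S (\<lambda>x. smooth_step (f x))"
  unfolding smooth_step_def by (intro continuous_intros)

text \<open>A test function that tends to the indicator of \<open>(c, d]\<close> as \<open>h\<close> decreases to \<open>0\<close>.\<close>
definition cutoff :: "real \<Rightarrow> real \<Rightarrow> real \<Rightarrow> real \<Rightarrow> real" where
  "cutoff c d h x = smooth_step ((x - c) / h) - smooth_step ((x - d) / h)"

lemma scaled_step_deriv:
  assumes "h > 0"
  shows "((\<lambda>x. smooth_step ((x - c) / h)) has_field_derivative tent ((x - c) / h) / h) (at x)"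
proof -
  have "((\<lambda>x. (x - c) / h) has_field_derivative 1 / h) (at x)"
    using DERIV_cdivide[OF DERIV_diff[OF DERIV_ident DERIV_const]] by simp
  from DERIV_chain2[OF smooth_step_deriv this] show ?thesis by simp
qed

lemma cutoff_deriv:
  assumes "h > 0"
  shows "(cutoff c d h has_field_derivative tent ((x - c) / h) / h - tent ((x - d) / h) / h) (at x)"
  unfolding cutoff_def[abs_def] by (intro DERIV_diff scaled_step_deriv assms)

lemma test_function_cutoff:
  assumes "0 < c" "c < d" "0 < h" "d + h < a"
  shows "test_function a (cutoff c d h)"
proof -
  have sub: "{x. cutoff c d h x \<noteq> 0} \<subseteq> {c..d + h}"
  proof safe
    fix x assume *: "cutoff c d h x \<noteq> 0"
    show "x \<in> {c..d + h}"
    proof (rule ccontr)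
      assume "x \<notin> {c..d + h}"
      then consider "x < c" | "x > d + h" by fastforce
      then show False
      proof cases
        case 1 then show False using * assms by (simp add: cutoff_def smooth_step_eq_0 divide_le_0_iff)
      next
        case 2 then show False using * assms by (simp add: cutoff_def smooth_step_eq_1)
      qed
    qed
  qed
  then have cl: "closure {x. cutoff c d h x \<noteq> 0} \<subseteq> {c..d + h}"
    by (rule closure_minimal) simp
  have "compact (closure {x. cutoff c d h x \<noteq> 0})" using cl
    by (auto simp: compact_eq_bounded_closed intro: bounded_subset[OF bounded_closed_interval])
  moreover have "cutoff c d h C1_differentiable_on UNIV"
    unfolding C1_differentiable_on_def
    by (rule exI[of _ "\<lambda>x. tent ((x - c) / h) / h - tent ((x - d) / h) / h"])
      (use assms in \<open>auto intro!: continuous_intros cutoff_deriv[unfolded has_real_derivative_iff_has_vector_derivative]\<close>)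
  ultimately show ?thesis
    using cl assms by (auto simp: test_function_def)
qed

lemma tendsto_scaled_step:
  assumes h: "h \<longlonglongrightarrow> 0" "\<And>n. h n > (0::real)"
  shows "(\<lambda>n. smooth_step ((x - c) / h n)) \<longlonglongrightarrow> indicator {c<..} x"
proof (cases "x \<le> c")
  case True
  then have "smooth_step ((x - c) / h n) = 0" for n
    using h(2)[of n] by (intro smooth_step_eq_0) (simp add: divide_le_0_iff)
  then show ?thesis using True by simp
next
  case False
  then have "eventually (\<lambda>n. h n < x - c) sequentially"
    using h(1) by (intro order_tendstoD(2)[of h 0]) auto
  then have "eventually (\<lambda>n. 1 = smooth_step ((x - c) / h n)) sequentially"
    by eventually_elim (use h(2) in \<open>auto simp: smooth_step_eq_1\<close>)
  then show ?thesis using False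
    using Lim_transform_eventually[OF tendsto_const[of 1]] by fastforce
qed

lemma integrable_continuous_lebesgue_on:
  fixes f :: "real \<Rightarrow> 'a::euclidean_space"
  assumes "continuous_on {0..a} f"
  shows "integrable (lebesgue_on {0..a}) f"
  by (rule continuous_imp_integrable[of 0 a, unfolded cbox_interval]) (use assms in auto)

text \<open>The rescaled tents are an approximation of the Dirac measure at \<open>c\<close>.\<close>
lemma tendsto_integral_tent:
  fixes f :: "real \<Rightarrow> 'a::euclidean_space"
  assumes f: "continuous_on {0..a} f" and c: "0 < c" "c < a"
    and h: "h \<longlonglongrightarrow> 0" "\<And>n. h n > (0::real)" "\<And>n. c + h n < a"
  shows "(\<lambda>n. LINT x|lebesgue_on {0..a}. (tent ((x - c) / h n) / h n) *\<^sub>R f x) \<longlonglongrightarrow> f c"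
proof (rule LIMSEQ_I)
  fix r :: real assume "r > 0"
  then obtain \<eta> where \<eta>: "\<eta> > 0" "\<And>x. x \<in> {0..a} \<Longrightarrow> dist x c < \<eta> \<Longrightarrow> dist (f x) (f c) < r / 2"
    using f c unfolding continuous_on_iff by (metis atLeastAtMost_iff half_gt_zero less_eq_real_def)
  obtain N where N: "\<And>n. n \<ge> N \<Longrightarrow> h n < \<eta>"
    using order_tendstoD(2)[OF h(1) \<eta>(1)] by (auto simp: eventually_sequentially)
  show "\<exists>no. \<forall>n\<ge>no. norm ((LINT x|lebesgue_on {0..a}. (tent ((x - c) / h n) / h n) *\<^sub>R f x) - f c) < r"
  proof (intro exI allI impI)
    fix n assume n: "N \<le> n"
    let ?k = "\<lambda>x. tent ((x - c) / h n) / h n"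
    have hn: "h n > 0" "c + h n < a" "h n < \<eta>" using h N[OF n] by auto
    have kc: "continuous_on {0..a} ?k" using hn by (auto intro!: continuous_intros)
    have ki: "integrable (lebesgue_on {0..a}) ?k"
      by (rule integrable_continuous_lebesgue_on[OF kc])
    have "(?k has_integral (smooth_step ((a - c) / h n) - smooth_step ((0 - c) / h n))) {0..a}"
      using c by (intro fundamental_theorem_of_calculus)
        (auto intro!: has_vector_derivative_at_within
           scaled_step_deriv[OF hn(1), unfolded has_real_derivative_iff_has_vector_derivative])
    moreover have "smooth_step ((a - c) / h n) = 1"
      by (rule smooth_step_eq_1) (use hn in \<open>simp add: field_simps\<close>)
    moreover have "smooth_step ((0 - c) / h n) = 0"
      by (rule smooth_step_eq_0) (use hn c in \<open>simp add: divide_le_0_iff\<close>)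
    ultimately have "(?k has_integral 1) {0..a}" by simp
    then have "integral {0..a} ?k = 1" by (rule integral_unique)
    then have k1: "(LINT x|lebesgue_on {0..a}. ?k x) = 1"
      using lebesgue_integral_eq_integral[OF ki] by simp
    have kf: "integrable (lebesgue_on {0..a}) (\<lambda>x. ?k x *\<^sub>R f x)"
      by (intro integrable_continuous_lebesgue_on continuous_intros kc f)
    have kf2: "integrable (lebesgue_on {0..a}) (\<lambda>x. ?k x *\<^sub>R (f x - f c))"
      by (intro integrable_continuous_lebesgue_on continuous_intros kc f)
    have "(LINT x|lebesgue_on {0..a}. ?k x *\<^sub>R f x) - f c
        = (LINT x|lebesgue_on {0..a}. ?k x *\<^sub>R f x) - (LINT x|lebesgue_on {0..a}. ?k x *\<^sub>R f c)"
      using k1 ki by simp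
    also have "\<dots> = (LINT x|lebesgue_on {0..a}. ?k x *\<^sub>R (f x - f c))"
      using kf ki by (subst Bochner_Integration.integral_diff[symmetric]) (auto simp: scaleR_diff_right)
    also have "norm \<dots> \<le> (LINT x|lebesgue_on {0..a}. ?k x * (r / 2))"
    proof (rule Bochner_Integration.integral_norm_bound_integral[OF kf2])
      show "integrable (lebesgue_on {0..a}) (\<lambda>x. ?k x * (r / 2))" by (rule integrable_mult_left) (rule ki)
      fix x assume "x \<in> space (lebesgue_on {0..a})"
      then have x: "x \<in> {0..a}" by simp
      have k0: "?k x \<ge> 0" using hn tent_nonneg by simp
      show "norm (?k x *\<^sub>R (f x - f c)) \<le> ?k x * (r / 2)"
      proof (cases "?k x = 0")
        case False
        then have "0 < (x - c) / h n" "(x - c) / h n < 1"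
          using tent_eq_0[of "(x - c) / h n"] by (force simp: not_le)+
        then have "dist x c < \<eta>" using hn by (auto simp: dist_real_def zero_less_divide_iff field_simps)
        then have "norm (f x - f c) \<le> r / 2" using \<eta>(2)[OF x] by (simp add: dist_norm)
        then show ?thesis using k0 by (simp only: norm_scaleR abs_of_nonneg mult_left_mono)
      next
        case True
        then show ?thesis by (simp only: norm_scaleR)
      qed
    qed
    also have "\<dots> = r / 2" using k1 by simp
    finally show "norm ((LINT x|lebesgue_on {0..a}. ?k x *\<^sub>R f x) - f c) < r"
      using \<open>r > 0\<close> by simp
  qed
qed

text \<open>
  Testing with cut-offs of \<open>(c, d]\<close> turns the definition of the weak derivative into the fundamental
  theorem of calculus. With \<open>f = 0\<close> it yields uniqueness of the weak derivative.
\<close>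
lemma weak_deriv_FTC:
  assumes wd: "weak_deriv a f g" and f: "continuous_on {0..a} f"
    and g: "integrable (lebesgue_on {0..a}) g" and cd: "0 < c" "c < d" "d < a"
  shows "f d - f c = (LINT x|lebesgue_on {0..a}. indicat_real {c<..d} x *\<^sub>R g x)"
proof -
  define h where "h n = (a - d) * inverse (real (Suc (Suc n)))" for n
  have hpos: "h n > 0" for n using cd by (simp add: h_def)
  have hlim: "h \<longlonglongrightarrow> 0"
    unfolding h_def
    by (rule tendsto_mult_right_zero) (rule LIMSEQ_Suc[OF LIMSEQ_inverse_real_of_nat])
  have hd: "d + h n < a" for n
  proof -
    have "h n \<le> (a - d) * inverse 2"
      unfolding h_def using cd by (intro mult_left_mono le_imp_inverse_le) auto
    then show ?thesis using cd by (simp add: field_simps)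
  qed
  have hc: "c + h n < a" for n using hd[of n] cd by simp
  let ?k = "\<lambda>c n x. tent ((x - c) / h n) / h n"
  have ki: "integrable (lebesgue_on {0..a}) (\<lambda>x. ?k c n x *\<^sub>R f x)" for n c
    using hpos[of n] by (intro integrable_continuous_lebesgue_on) (auto intro!: continuous_intros f)
  have deriv_cutoff: "deriv (cutoff c d (h n)) x = ?k c n x - ?k d n x" for n x
    by (rule DERIV_imp_deriv, rule cutoff_deriv) (rule hpos)
  have L: "(\<lambda>n. (LINT x|lebesgue_on {0..a}. ?k c n x *\<^sub>R f x) - (LINT x|lebesgue_on {0..a}. ?k d n x *\<^sub>R f x))
      \<longlonglongrightarrow> f c - f d"
    by (intro tendsto_diff tendsto_integral_tent f hlim hpos hc hd) (use cd in auto)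
  have eq: "(LINT x|lebesgue_on {0..a}. ?k c n x *\<^sub>R f x) - (LINT x|lebesgue_on {0..a}. ?k d n x *\<^sub>R f x)
     = - (LINT x|lebesgue_on {0..a}. cutoff c d (h n) x *\<^sub>R g x)" for n
  proof -
    have "(LINT x|lebesgue_on {0..a}. deriv (cutoff c d (h n)) x *\<^sub>R f x) =
        - (LINT x|lebesgue_on {0..a}. cutoff c d (h n) x *\<^sub>R g x)"
      using wd test_function_cutoff[OF cd(1,2) hpos hd] unfolding weak_deriv_def by blast
    then show ?thesis
      unfolding deriv_cutoff scaleR_diff_left
      by (subst Bochner_Integration.integral_diff[symmetric, OF ki ki])
  qed
  have R: "(\<lambda>n. LINT x|lebesgue_on {0..a}. cutoff c d (h n) x *\<^sub>R g x)
      \<longlonglongrightarrow> (LINT x|lebesgue_on {0..a}. indicat_real {c<..d} x *\<^sub>R g x)"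
  proof (rule integral_dominated_convergence[where w="\<lambda>x. norm (g x)"])
    have [measurable]: "g \<in> borel_measurable (lebesgue_on {0..a})" using g by auto
    show "(\<lambda>x. indicat_real {c<..d} x *\<^sub>R g x) \<in> borel_measurable (lebesgue_on {0..a})"
      by (intro borel_measurable_scaleR borel_measurable_indicator)
        (use cd in \<open>auto simp: sets_restrict_space_iff\<close>)
    show "(\<lambda>x. cutoff c d (h n) x *\<^sub>R g x) \<in> borel_measurable (lebesgue_on {0..a})" for n
    proof (intro borel_measurable_scaleR)
      show "cutoff c d (h n) \<in> borel_measurable (lebesgue_on {0..a})"
        using hpos[of n] unfolding cutoff_def[abs_def]
        by (intro continuous_imp_measurable_on_sets_lebesgue) (auto intro!: continuous_intros)
    qed simp
    show "integrable (lebesgue_on {0..a}) (\<lambda>x. norm (g x))" using g by simp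
    show "AE x in lebesgue_on {0..a}. (\<lambda>n. cutoff c d (h n) x *\<^sub>R g x) \<longlonglongrightarrow> indicat_real {c<..d} x *\<^sub>R g x"
    proof (intro AE_I2 tendsto_scaleR tendsto_const)
      fix x
      have "(\<lambda>n. cutoff c d (h n) x) \<longlonglongrightarrow> indicator {c<..} x - indicator {d<..} x"
        unfolding cutoff_def by (intro tendsto_diff tendsto_scaled_step hlim hpos)
      also have "indicator {c<..} x - indicator {d<..} x = indicat_real {c<..d} x"
        using cd by (auto simp: indicator_def)
      finally show "(\<lambda>n. cutoff c d (h n) x) \<longlonglongrightarrow> indicat_real {c<..d} x" .
    qed
    show "AE x in lebesgue_on {0..a}. norm (cutoff c d (h n) x *\<^sub>R g x) \<le> norm (g x)" for n
    proof (intro AE_I2)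
      fix x
      have "\<bar>cutoff c d (h n) x\<bar> \<le> 1"
        using smooth_step_range[of "(x - c) / h n"] smooth_step_range[of "(x - d) / h n"]
        by (auto simp: cutoff_def)
      then show "norm (cutoff c d (h n) x *\<^sub>R g x) \<le> norm (g x)"
        by (simp add: mult_left_le_one_le)
    qed
  qed
  have "f c - f d = - (LINT x|lebesgue_on {0..a}. indicat_real {c<..d} x *\<^sub>R g x)"
    using LIMSEQ_unique[OF L[unfolded eq] tendsto_minus[OF R]] .
  then show ?thesis by (metis minus_diff_eq neg_equal_iff_equal)
qed

lemma integrable_indicator_scaleR_lebesgue_on:
  fixes g :: "real \<Rightarrow> 'a::euclidean_space"
  assumes "integrable (lebesgue_on {0..a}) g" "A \<in> sets lebesgue"
  shows "integrable (lebesgue_on {0..a}) (\<lambda>x. indicat_real A x *\<^sub>R g x)"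
proof -
  have "integrable (lebesgue_on {0..a}) (\<lambda>x. indicat_real (A \<inter> {0..a}) x *\<^sub>R g x)"
    using assms by (intro integrable_mult_indicator) (auto simp: sets_restrict_space)
  then show ?thesis
    by (rule Bochner_Integration.integrable_cong[OF refl, THEN iffD1, rotated]) (auto simp: indicator_def)
qed

lemma LIMSEQ_indicator_UN_atMost:
  "(\<lambda>n. indicat_real (\<Union>i\<le>n. f i) x) \<longlonglongrightarrow> indicat_real (\<Union>i. f i) x"
  using LIMSEQ_Suc[OF LIMSEQ_indicator_UN[of f x]] by (simp only: lessThan_Suc_atMost)

text \<open>
  The sets over which \<open>g\<close> integrates to zero form a Dynkin system; it contains the compact intervals,
  hence all Borel sets, hence up to null sets all Lebesgue sets.
\<close>
lemma AE_lebesgue_on_zero_if_interval_integrals_zero: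
  fixes g :: "real \<Rightarrow> complex"
  assumes g: "integrable (lebesgue_on {0..a}) g"
    and z: "\<And>c d. 0 < c \<Longrightarrow> c < d \<Longrightarrow> d < a \<Longrightarrow> (LINT x|lebesgue_on {0..a}. indicat_real {c<..d} x *\<^sub>R g x) = 0"
  shows "AE x in lebesgue_on {0..a}. g x = 0"
proof -
  let ?I = "\<lambda>A. LINT x|lebesgue_on {0..a}. indicat_real A x *\<^sub>R g x"
  have int: "integrable (lebesgue_on {0..a}) (\<lambda>x. indicat_real A x *\<^sub>R g x)" if "A \<in> sets lebesgue" for A
    by (rule integrable_indicator_scaleR_lebesgue_on[OF g that])
  have pt: "{x} \<in> null_sets (lebesgue_on {0..a})" if "x \<in> {0..a}" for x
    using that by (auto simp: null_sets_restrict_space)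
  have ae_ne: "AE x in lebesgue_on {0..a}. x \<noteq> t" for t
  proof (cases "t \<in> {0..a}")
    case True then show ?thesis using AE_not_in[OF pt] by simp
  next
    case False then show ?thesis by (intro AE_I2) auto
  qed
  have closed: "?I {c..d} = 0" if cd: "c \<le> d" for c d
  proof -
    \<comment> \<open>exhaust the part of \<open>[c, d]\<close> in \<open>[0, a]\<close> by half-open intervals compactly inside \<open>(0, a)\<close>\<close>
    define c' where "c' n = max c 0 + inverse (real (Suc n))" for n
    define d' where "d' n = min d a - inverse (real (Suc n))" for n
    have c': "c' \<longlonglongrightarrow> max c 0"
      using tendsto_add[OF tendsto_const LIMSEQ_inverse_real_of_nat, of "max c 0"]
      by (simp add: c'_def[abs_def])
    have d': "d' \<longlonglongrightarrow> min d a"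
      using tendsto_diff[OF tendsto_const LIMSEQ_inverse_real_of_nat, of "min d a"]
      by (simp add: d'_def[abs_def])
    have pos: "inverse (real (Suc n)) > 0" for n by simp
    have z': "?I {c' n<..d' n} = 0" for n
    proof (cases "c' n < d' n")
      case True
      moreover have "0 < c' n" "d' n < a"
        using pos[of n] unfolding c'_def d'_def by linarith+
      ultimately show ?thesis by (intro z)
    qed simp
    have "(\<lambda>n. ?I {c' n<..d' n}) \<longlonglongrightarrow> ?I {c..d}"
    proof (rule integral_dominated_convergence[where w="\<lambda>x. norm (g x)"])
      show "integrable (lebesgue_on {0..a}) (\<lambda>x. norm (g x))" using g by simp
      show "(\<lambda>x. indicat_real {c..d} x *\<^sub>R g x) \<in> borel_measurable (lebesgue_on {0..a})"
        by (rule borel_measurable_integrable[OF int]) simp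
      show "(\<lambda>x. indicat_real {c' n<..d' n} x *\<^sub>R g x) \<in> borel_measurable (lebesgue_on {0..a})" for n
        by (rule borel_measurable_integrable[OF int]) simp
      show "AE x in lebesgue_on {0..a}. norm (indicat_real {c' n<..d' n} x *\<^sub>R g x) \<le> norm (g x)" for n
        by (auto simp: indicator_def)
      have "AE x in lebesgue_on {0..a}. x \<noteq> max c 0 \<and> x \<noteq> min d a"
        using ae_ne[of "max c 0"] ae_ne[of "min d a"] by eventually_elim auto
      moreover have "AE x in lebesgue_on {0..a}. x \<in> {0..a}"
        by (intro AE_I2) auto
      ultimately show "AE x in lebesgue_on {0..a}. (\<lambda>n. indicat_real {c' n<..d' n} x *\<^sub>R g x)
           \<longlonglongrightarrow> indicat_real {c..d} x *\<^sub>R g x"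
      proof eventually_elim
        case (elim x)
        have "(\<lambda>n. indicat_real {c' n<..d' n} x) \<longlonglongrightarrow> indicat_real {c..d} x"
        proof (cases "x \<in> {c..d}")
          case True
          then have "max c 0 < x" "x < min d a" using elim by auto
          then have "eventually (\<lambda>n. c' n < x \<and> x < d' n) sequentially"
            using order_tendstoD(2)[OF c'] order_tendstoD(1)[OF d'] by (intro eventually_conj) auto
          then have "eventually (\<lambda>n. 1 = indicat_real {c' n<..d' n} x) sequentially"
            by eventually_elim (auto simp: indicator_def)
          then show ?thesis
            using True Lim_transform_eventually[OF tendsto_const[of 1]] by fastforce
        next
          case False
          moreover have "c \<le> c' n \<and> d' n \<le> d" for n
            using pos[of n] unfolding c'_def d'_def by linarith
          ultimately have "indicat_real {c' n<..d' n} x = 0" for n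
            by (smt (verit) atLeastAtMost_iff greaterThanAtMost_iff indicator_simps(2))
          then show ?thesis using False by simp
        qed
        then show ?case by (intro tendsto_scaleR tendsto_const)
      qed
    qed
    then have "(\<lambda>n. 0) \<longlonglongrightarrow> ?I {c..d}" unfolding z' .
    from LIMSEQ_unique[OF this tendsto_const] show ?thesis .
  qed
  have cut: "?I (A \<inter> {0..a}) = ?I A" for A
    by (rule Bochner_Integration.integral_cong) (auto simp: indicator_def)
  have all: "?I UNIV = 0"
    using closed[of 0 a] cut[of UNIV] by (cases "0 \<le> a") (auto simp: indicator_def)
  have borel: "?I A = 0" if "A \<in> sets borel" for A
    using that
  proof (induction rule: borel_set_induct)
    case (interval c d) then show ?case by (rule closed)
  next
    case (compl A)
    have A: "A \<in> sets lebesgue" using compl by simp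
    have "?I (-A) = (LINT x|lebesgue_on {0..a}. indicat_real UNIV x *\<^sub>R g x - indicat_real A x *\<^sub>R g x)"
      by (intro Bochner_Integration.integral_cong) (auto simp: indicator_def)
    also have "\<dots> = ?I UNIV - ?I A"
      by (intro Bochner_Integration.integral_diff int A) simp
    finally have "?I (-A) = ?I UNIV - ?I A" .
    then show ?case using compl all by simp
  next
    case (union f)
    have U: "(\<Union>i. f i) \<in> sets lebesgue" using union by auto
    have "(\<lambda>n. ?I (\<Union>i\<le>n. f i)) \<longlonglongrightarrow> ?I (\<Union>i. f i)"
    proof (rule integral_dominated_convergence[where w="\<lambda>x. norm (g x)"])
      show "integrable (lebesgue_on {0..a}) (\<lambda>x. norm (g x))" using g by simp
      show "(\<lambda>x. indicat_real (\<Union>i. f i) x *\<^sub>R g x) \<in> borel_measurable (lebesgue_on {0..a})"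
        by (rule borel_measurable_integrable[OF int[OF U]])
      show "(\<lambda>x. indicat_real (\<Union>i\<le>n. f i) x *\<^sub>R g x) \<in> borel_measurable (lebesgue_on {0..a})" for n
        by (rule borel_measurable_integrable[OF int]) (use union in auto)
      show "AE x in lebesgue_on {0..a}. norm (indicat_real (\<Union>i\<le>n. f i) x *\<^sub>R g x) \<le> norm (g x)" for n
        by (auto simp: indicator_def)
      show "AE x in lebesgue_on {0..a}. (\<lambda>n. indicat_real (\<Union>i\<le>n. f i) x *\<^sub>R g x)
           \<longlonglongrightarrow> indicat_real (\<Union>i. f i) x *\<^sub>R g x"
        by (intro AE_I2 tendsto_scaleR tendsto_const LIMSEQ_indicator_UN_atMost)
    qed
    moreover have "?I (\<Union>i\<le>n. f i) = 0" for n
    proof -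
      have "indicat_real (\<Union>i\<le>n. f i) x = (\<Sum>i\<le>n. indicat_real (f i) x)" for x
        using union(1) by (intro indicator_UN_disjoint) (auto intro: disjoint_family_on_mono)
      then have "?I (\<Union>i\<le>n. f i) = (LINT x|lebesgue_on {0..a}. (\<Sum>i\<le>n. indicat_real (f i) x *\<^sub>R g x))"
        by (simp add: scaleR_sum_left)
      also have "\<dots> = (\<Sum>i\<le>n. ?I (f i))"
        using union(2) by (intro Bochner_Integration.integral_sum int) auto
      finally show ?thesis using union(3) by simp
    qed
    ultimately have "(\<lambda>n. 0) \<longlonglongrightarrow> ?I (\<Union>i. f i)" by simp
    from LIMSEQ_unique[OF this tendsto_const] show ?case .
  qed simp
  have meas: "?I A = 0" if A: "A \<in> sets lebesgue" for A
  proof -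
    obtain S N N' where SN: "A = S \<union> N" "N \<subseteq> N'" "N' \<in> null_sets lborel" "S \<in> sets lborel"
      using A by (auto elim!: sets_completionE)
    have N': "N' \<in> null_sets lebesgue" using SN by (simp add: null_sets_completionI)
    have "AE x in lebesgue. x \<notin> N'" by (rule AE_not_in[OF N'])
    then have "AE x in lebesgue. x \<in> {0..a} \<longrightarrow> x \<notin> N'"
      by eventually_elim simp
    then have ae: "AE x in lebesgue_on {0..a}. x \<notin> N'"
      by (subst AE_restrict_space_iff) auto
    have "AE x in lebesgue_on {0..a}. indicat_real A x *\<^sub>R g x = indicat_real S x *\<^sub>R g x"
      using ae by eventually_elim (use SN in \<open>auto simp: indicator_def\<close>)
    moreover have "S \<in> sets lebesgue" using SN by simp
    ultimately have "?I A = ?I S"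
      by (intro integral_cong_AE borel_measurable_integrable[OF int] A)
    then show ?thesis using borel[of S] SN by simp
  qed
  interpret finite_measure "lebesgue_on {0..a}"
    by (rule finite_measure_lebesgue_on) simp
  show ?thesis
  proof (rule density_zero[OF g])
    fix A assume "A \<in> sets (lebesgue_on {0..a})"
    then show "set_lebesgue_integral (lebesgue_on {0..a}) A g = 0"
      by (auto simp: set_lebesgue_integral_def sets_restrict_space intro!: meas)
  qed
qed

lemma L2_interval_integrable:
  assumes "L2_interval a f" "L2_interval a g"
  shows "integrable (lebesgue_on {0..a}) (\<lambda>x. f x * cnj (g x))"
proof (rule Bochner_Integration.integrable_bound[where f="\<lambda>x. (cmod (f x))\<^sup>2 + (cmod (g x))\<^sup>2"])
  have [measurable]: "f \<in> borel_measurable (lebesgue_on {0..a})" "g \<in> borel_measurable (lebesgue_on {0..a})"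
    using assms by (auto simp: L2_interval_def)
  show "integrable (lebesgue_on {0..a}) (\<lambda>x. (cmod (f x))\<^sup>2 + (cmod (g x))\<^sup>2)"
    using assms by (auto simp: L2_interval_def)
  have [measurable]: "cnj \<in> borel_measurable borel"
    by (intro borel_measurable_continuous_onI continuous_intros)
  show "(\<lambda>x. f x * cnj (g x)) \<in> borel_measurable (lebesgue_on {0..a})"
    by measurable
  show "AE x in lebesgue_on {0..a}. norm (f x * cnj (g x)) \<le> norm ((cmod (f x))\<^sup>2 + (cmod (g x))\<^sup>2)"
  proof (intro AE_I2)
    fix x
    have "2 * (cmod (f x) * cmod (g x)) \<le> (cmod (f x))\<^sup>2 + (cmod (g x))\<^sup>2"
      using sum_squares_bound[of "cmod (f x)" "cmod (g x)"] by simp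
    moreover have "0 \<le> cmod (f x) * cmod (g x)" by simp
    ultimately have "cmod (f x) * cmod (g x) \<le> (cmod (f x))\<^sup>2 + (cmod (g x))\<^sup>2"
      by linarith
    then show "norm (f x * cnj (g x)) \<le> norm ((cmod (f x))\<^sup>2 + (cmod (g x))\<^sup>2)"
      unfolding norm_mult complex_mod_cnj by simp
  qed
qed

lemma L2_interval_const: "L2_interval a (\<lambda>_. c)"
  by (simp add: L2_interval_def finite_measure.integrable_const[OF finite_measure_lebesgue_on])

lemma L2_interval_continuous: "continuous_on {0..a} f \<Longrightarrow> L2_interval a f"
  by (auto simp: L2_interval_def intro!: continuous_imp_measurable_on_sets_lebesgue
      integrable_continuous_lebesgue_on continuous_intros)

lemma L2_interval_lincomb:
  assumes "L2_interval a f" "L2_interval a g"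
  shows "L2_interval a (\<lambda>x. c * f x + d * g x)"
proof -
  have [measurable]: "f \<in> borel_measurable (lebesgue_on {0..a})" "g \<in> borel_measurable (lebesgue_on {0..a})"
    using assms by (auto simp: L2_interval_def)
  have "integrable (lebesgue_on {0..a}) (\<lambda>x. (cmod (c * f x + d * g x))\<^sup>2)"
  proof (rule Bochner_Integration.integrable_bound)
    show "integrable (lebesgue_on {0..a}) (\<lambda>x. 2 * (cmod c)\<^sup>2 * (cmod (f x))\<^sup>2 + 2 * (cmod d)\<^sup>2 * (cmod (g x))\<^sup>2)"
      using assms by (auto simp: L2_interval_def)
    show "AE x in lebesgue_on {0..a}. norm ((cmod (c * f x + d * g x))\<^sup>2) \<le>
        norm (2 * (cmod c)\<^sup>2 * (cmod (f x))\<^sup>2 + 2 * (cmod d)\<^sup>2 * (cmod (g x))\<^sup>2)"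
    proof (intro AE_I2)
      fix x
      have "(cmod (c * f x + d * g x))\<^sup>2 \<le> (cmod (c * f x) + cmod (d * g x))\<^sup>2"
        by (intro power_mono norm_triangle_ineq) auto
      also have "\<dots> \<le> 2 * (cmod (c * f x))\<^sup>2 + 2 * (cmod (d * g x))\<^sup>2"
        using sum_squares_bound[of "cmod (c * f x)" "cmod (d * g x)"] by (simp add: power2_sum)
      finally show "norm ((cmod (c * f x + d * g x))\<^sup>2) \<le>
        norm (2 * (cmod c)\<^sup>2 * (cmod (f x))\<^sup>2 + 2 * (cmod d)\<^sup>2 * (cmod (g x))\<^sup>2)"
        by (simp add: norm_mult power_mult_distrib)
    qed
  qed measurable
  then show ?thesis unfolding L2_interval_def by simp
qed

lemma L2_interval_imp_integrable:
  "L2_interval a f \<Longrightarrow> integrable (lebesgue_on {0..a}) f"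
  using L2_interval_integrable[OF _ L2_interval_const[of a 1], of f] by simp

lemma test_function_L2:
  assumes "test_function a \<phi>"
  shows "L2_interval a (\<lambda>x. of_real (\<phi> x))" "L2_interval a (\<lambda>x. of_real (deriv \<phi> x))"
proof -
  obtain D where D: "\<And>x. (\<phi> has_vector_derivative D x) (at x)" "continuous_on UNIV D"
    using assms by (auto simp: test_function_def C1_differentiable_on_def)
  have "deriv \<phi> = D"
    using D(1) by (intro ext DERIV_imp_deriv) (simp add: has_real_derivative_iff_has_vector_derivative)
  moreover have "continuous_on UNIV \<phi>"
    using D(1) by (auto intro!: continuous_at_imp_continuous_on vector_derivative_works has_vector_derivative_continuous)
  ultimately show "L2_interval a (\<lambda>x. of_real (\<phi> x))" "L2_interval a (\<lambda>x. of_real (deriv \<phi> x))"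
    using D(2) by (auto intro!: L2_interval_continuous continuous_intros elim: continuous_on_subset)
qed

lemma test_function_integrable:
  assumes "test_function a \<phi>" "L2_interval a f"
  shows "integrable (lebesgue_on {0..a}) (\<lambda>x. \<phi> x *\<^sub>R f x)"
    "integrable (lebesgue_on {0..a}) (\<lambda>x. deriv \<phi> x *\<^sub>R f x)"
  using L2_interval_integrable[OF assms(2) test_function_L2(1)[OF assms(1)]]
    L2_interval_integrable[OF assms(2) test_function_L2(2)[OF assms(1)]]
  by (simp_all add: scaleR_conv_of_real mult.commute)

lemma weak_deriv_lincomb:
  assumes "weak_deriv a f f'" "weak_deriv a g g'"
    and L2: "L2_interval a f" "L2_interval a g" "L2_interval a f'" "L2_interval a g'"
  shows "weak_deriv a (\<lambda>x. c * f x + d * g x) (\<lambda>x. c * f' x + d * g' x)"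
  unfolding weak_deriv_def
proof (intro allI impI)
  fix \<phi> assume \<phi>: "test_function a \<phi>"
  have *: "(LINT x|lebesgue_on {0..a}. \<psi> x *\<^sub>R (c * f x + d * g x)) =
     c * (LINT x|lebesgue_on {0..a}. \<psi> x *\<^sub>R f x) + d * (LINT x|lebesgue_on {0..a}. \<psi> x *\<^sub>R g x)"
    if "integrable (lebesgue_on {0..a}) (\<lambda>x. \<psi> x *\<^sub>R f x)"
       "integrable (lebesgue_on {0..a}) (\<lambda>x. \<psi> x *\<^sub>R g x)" for f g :: "real \<Rightarrow> complex" and \<psi> :: "real \<Rightarrow> real"
  proof -
    have "\<psi> x *\<^sub>R (c * f x + d * g x) = c * (\<psi> x *\<^sub>R f x) + d * (\<psi> x *\<^sub>R g x)" for x
      by (simp add: scaleR_conv_of_real algebra_simps)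
    moreover have "(LINT x|lebesgue_on {0..a}. c * (\<psi> x *\<^sub>R f x) + d * (\<psi> x *\<^sub>R g x)) =
     c * (LINT x|lebesgue_on {0..a}. \<psi> x *\<^sub>R f x) + d * (LINT x|lebesgue_on {0..a}. \<psi> x *\<^sub>R g x)"
      by (simp only: Bochner_Integration.integral_add integrable_mult_right that integral_mult_right_zero)
    ultimately show ?thesis by simp
  qed
  show "(LINT x|lebesgue_on {0..a}. deriv \<phi> x *\<^sub>R (c * f x + d * g x)) =
     - (LINT x|lebesgue_on {0..a}. \<phi> x *\<^sub>R (c * f' x + d * g' x))"
    using assms(1,2)[unfolded weak_deriv_def, rule_format, OF \<phi>]
    by (simp add: * test_function_integrable[OF \<phi>] L2)
qed

lemma weak_deriv_unique:
  assumes "weak_deriv a f g" "weak_deriv a f h" "L2_interval a f" "L2_interval a g" "L2_interval a h"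
  shows "AE x in lebesgue_on {0..a}. g x = h x"
proof -
  let ?g = "\<lambda>x. 1 * g x + (-1) * h x"
  have "weak_deriv a (\<lambda>x. 1 * f x + (-1) * f x) ?g"
    by (intro weak_deriv_lincomb assms)
  then have wd: "weak_deriv a (\<lambda>x. 0) ?g" by simp
  have i: "integrable (lebesgue_on {0..a}) ?g"
    by (intro L2_interval_imp_integrable L2_interval_lincomb assms)
  have "AE x in lebesgue_on {0..a}. ?g x = 0"
    using weak_deriv_FTC[OF wd _ i] by (intro AE_lebesgue_on_zero_if_interval_integrals_zero i) simp
  then show ?thesis by simp
qed

lemma wderiv_works:
  assumes "H1_interval a f"
  shows "L2_interval a (wderiv a f)" "weak_deriv a f (wderiv a f)"
  using someI_ex[of "\<lambda>g. L2_interval a g \<and> weak_deriv a f g"] assms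
  by (auto simp: H1_interval_def wderiv_def)

lemma wderiv_unique:
  assumes "L2_interval a f" "L2_interval a g" "weak_deriv a f g"
  shows "AE x in lebesgue_on {0..a}. wderiv a f x = g x"
  using wderiv_works[of a f] assms
  by (intro weak_deriv_unique[of a f]) (auto simp: H1_interval_def)

lemma H1_interval_lincomb:
  assumes "H1_interval a f" "H1_interval a g"
  shows "H1_interval a (\<lambda>x. c * f x + d * g x)"
    "AE x in lebesgue_on {0..a}. wderiv a (\<lambda>x. c * f x + d * g x) x = c * wderiv a f x + d * wderiv a g x"
proof -
  have L2: "L2_interval a f" "L2_interval a g" using assms by (auto simp: H1_interval_def)
  have 1: "L2_interval a (\<lambda>x. c * f x + d * g x)" "L2_interval a (\<lambda>x. c * wderiv a f x + d * wderiv a g x)"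
    using assms by (auto intro!: L2_interval_lincomb L2 wderiv_works)
  have 2: "weak_deriv a (\<lambda>x. c * f x + d * g x) (\<lambda>x. c * wderiv a f x + d * wderiv a g x)"
    using assms by (auto intro!: weak_deriv_lincomb L2 wderiv_works)
  show "H1_interval a (\<lambda>x. c * f x + d * g x)" using 1 2 by (auto simp: H1_interval_def)
  show "AE x in lebesgue_on {0..a}. wderiv a (\<lambda>x. c * f x + d * g x) x = c * wderiv a f x + d * wderiv a g x"
    using 1 2 by (intro wderiv_unique) auto
qed

lemma weak_deriv_const:
  "weak_deriv a (\<lambda>_. c) (\<lambda>_. 0)"
  unfolding weak_deriv_def
proof (intro allI impI)
  fix \<phi> assume \<phi>: "test_function a \<phi>"
  obtain D where D: "\<And>x. (\<phi> has_vector_derivative D x) (at x)" "continuous_on UNIV D"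
    using \<phi> by (auto simp: test_function_def C1_differentiable_on_def)
  have dD: "deriv \<phi> = D"
    using D(1) by (intro ext DERIV_imp_deriv) (simp add: has_real_derivative_iff_has_vector_derivative)
  have supp: "closure {x. \<phi> x \<noteq> 0} \<subseteq> {0<..<a}" using \<phi> by (simp add: test_function_def)
  have z: "\<phi> 0 = 0" "\<phi> a = 0"
    using supp closure_subset[of "{x. \<phi> x \<noteq> 0}"] by force+
  have Di: "integrable (lebesgue_on {0..a}) D"
    by (rule integrable_continuous_lebesgue_on) (rule continuous_on_subset[OF D(2)], simp)
  have "(LINT x|lebesgue_on {0..a}. D x) = 0"
  proof (cases "0 \<le> a")
    case True
    have "(D has_integral (\<phi> a - \<phi> 0)) {0..a}"
      using True D(1) by (intro fundamental_theorem_of_calculus) (auto intro: has_vector_derivative_at_within)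
    then show ?thesis using lebesgue_integral_eq_integral[OF Di] z by (simp add: integral_unique)
  qed simp
  then have "(LINT x|lebesgue_on {0..a}. D x *\<^sub>R c) = 0" using Di by simp
  then show "(LINT x|lebesgue_on {0..a}. deriv \<phi> x *\<^sub>R c) = - (LINT x|lebesgue_on {0..a}. \<phi> x *\<^sub>R 0)"
    by (simp add: dD)
qed

lemma H1_interval_const: "H1_interval a (\<lambda>_. c)"
  unfolding H1_interval_def using L2_interval_const weak_deriv_const by blast

lemma wderiv_const: "AE x in lebesgue_on {0..a}. wderiv a (\<lambda>_. c) x = 0"
  by (intro wderiv_unique L2_interval_const weak_deriv_const)

lemma weak_deriv_cong_AE:
  assumes "AE x in lebesgue_on {0..a}. f x = f' x" "L2_interval a f" "L2_interval a f'"
    "weak_deriv a f' g"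
  shows "weak_deriv a f g"
  unfolding weak_deriv_def
proof (intro allI impI)
  fix \<phi> assume \<phi>: "test_function a \<phi>"
  have "(LINT x|lebesgue_on {0..a}. deriv \<phi> x *\<^sub>R f x) = (LINT x|lebesgue_on {0..a}. deriv \<phi> x *\<^sub>R f' x)"
    by (intro integral_cong_AE borel_measurable_integrable test_function_integrable \<phi> assms(2,3))
      (use assms(1) in \<open>auto elim!: eventually_mono\<close>)
  then show "(LINT x|lebesgue_on {0..a}. deriv \<phi> x *\<^sub>R f x) = - (LINT x|lebesgue_on {0..a}. \<phi> x *\<^sub>R g x)"
    using assms(4)[unfolded weak_deriv_def] \<phi> by auto
qed

lemma wderiv_cong:
  assumes "\<And>x. x \<in> {0..a} \<Longrightarrow> f x = g x"
  shows "wderiv a f = wderiv a g"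
proof -
  have "(LINT x|lebesgue_on {0..a}. \<psi> x *\<^sub>R f x) = (LINT x|lebesgue_on {0..a}. \<psi> x *\<^sub>R g x)" for \<psi> :: "real \<Rightarrow> real"
    using assms by (intro Bochner_Integration.integral_cong) auto
  then have "weak_deriv a f = weak_deriv a g"
    by (intro ext) (simp add: weak_deriv_def)
  then show ?thesis by (simp add: wderiv_def)
qed

text \<open>
  \<^const>\<open>wderiv\<close> of a constant is an unspecified representative of zero, so the second derivative also
  vanishes only almost everywhere.
\<close>
lemma wderiv_wderiv_const:
  "H2_interval a (\<lambda>_. k)" "AE x in lebesgue_on {0..a}. wderiv a (wderiv a (\<lambda>_. k)) x = 0"
proof -
  have L2: "L2_interval a (wderiv a (\<lambda>_. k))" by (rule wderiv_works) (rule H1_interval_const)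
  have wd: "weak_deriv a (wderiv a (\<lambda>_. k)) (\<lambda>_. 0)"
    by (rule weak_deriv_cong_AE[OF wderiv_const L2 L2_interval_const weak_deriv_const])
  show "H2_interval a (\<lambda>_. k)"
    unfolding H2_interval_def H1_interval_def[of a "wderiv a (\<lambda>_. k)"]
    using H1_interval_const L2 L2_interval_const wd by blast
  show "AE x in lebesgue_on {0..a}. wderiv a (wderiv a (\<lambda>_. k)) x = 0"
    by (rule wderiv_unique[OF L2 L2_interval_const wd])
qed

section \<open>Function spaces on a metric graph\<close>

lemma square_le_if_quadratic_nonneg:
  fixes A B N :: real
  assumes "\<And>t. 0 \<le> A * t\<^sup>2 - 2 * N * t + B"
  shows "N\<^sup>2 \<le> A * B"
proof (cases "A = 0")
  case True
  have "N = 0"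
  proof (rule ccontr)
    assume "N \<noteq> 0"
    then show False using assms[of "(B + 1) / (2 * N)"] True by simp
  qed
  then show ?thesis using True by simp
next
  case False
  have "A > 0"
  proof (rule ccontr)
    assume "\<not> A > 0"
    then have A: "A < 0" using False by simp
    have "0 \<le> A * t\<^sup>2 + B" for t
      using assms[of t] assms[of "-t"] by simp
    from this[of "sqrt ((\<bar>B\<bar> + 1) / - A)"] have "0 \<le> A * ((\<bar>B\<bar> + 1) / - A) + B"
      using A by (subst (asm) real_sqrt_pow2) (auto simp: divide_nonneg_neg)
    then show False using A by simp
  qed
  then show ?thesis using assms[of "N / A"] by (simp add: power2_eq_square field_simps)
qed

text \<open>A nonempty finite family of edges of positive length, glued at the vertices of \<open>G\<close>.\<close>
locale metric_graph =
  fixes G :: "('v, 'e) pre_digraph" and l :: "'e \<Rightarrow> real"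
  assumes finite_edges: "finite (arcs G)" and edges_nonempty: "arcs G \<noteq> {}"
    and length_pos: "e \<in> arcs G \<Longrightarrow> 0 < l e"
begin

text \<open>Integrability on each edge; \<^const>\<open>gintegral\<close> is additive on such families.\<close>
definition gintegrable :: "('e \<Rightarrow> real \<Rightarrow> 'b::{banach, second_countable_topology}) \<Rightarrow> bool" where
  "gintegrable f \<longleftrightarrow> (\<forall>e\<in>arcs G. integrable (lebesgue_on {0..l e}) (f e))"

text \<open>Square integrability on each edge.\<close>
definition gL2 :: "'e gfun \<Rightarrow> bool" where
  "gL2 u \<longleftrightarrow> (\<forall>e\<in>arcs G. L2_interval (l e) (u e))"

text \<open>The squared \<open>L\<^sup>2\<close> norm.\<close>
definition sqn :: "'e gfun \<Rightarrow> real" where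
  "sqn u = gintegral G l (\<lambda>e x. (cmod (u e x))\<^sup>2)"

text \<open>The \<open>L\<^sup>2\<close> norm and inner product, the space \<open>H\<^sup>1\<close> with its norm, and the weak derivative.\<close>
abbreviation nrm :: "'e gfun \<Rightarrow> real" where "nrm u \<equiv> Lp_norm G l 2 u"
abbreviation ip :: "'e gfun \<Rightarrow> 'e gfun \<Rightarrow> complex" where "ip \<equiv> ginner G l"
abbreviation H1 :: "'e gfun set" where "H1 \<equiv> H1_graph G l"
abbreviation h1n :: "'e gfun \<Rightarrow> real" where "h1n \<equiv> H1_norm G l"
abbreviation D :: "'e gfun \<Rightarrow> 'e gfun" where "D \<equiv> gderiv l"

lemma gintegrable_add: "gintegrable f \<Longrightarrow> gintegrable g \<Longrightarrow> gintegrable (\<lambda>e x. f e x + g e x)"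
  by (simp add: gintegrable_def)

lemma gintegrable_diff: "gintegrable f \<Longrightarrow> gintegrable g \<Longrightarrow> gintegrable (\<lambda>e x. f e x - g e x)"
  by (simp add: gintegrable_def)

lemma gintegrable_mult_right:
  fixes f :: "'e \<Rightarrow> real \<Rightarrow> 'b::{real_normed_field, banach, second_countable_topology}"
  shows "gintegrable f \<Longrightarrow> gintegrable (\<lambda>e x. c * f e x)"
  by (simp add: gintegrable_def)

lemma gintegrable_continuous:
  fixes f :: "'e \<Rightarrow> real \<Rightarrow> 'b::euclidean_space"
  assumes "\<And>e. e \<in> arcs G \<Longrightarrow> continuous_on {0..l e} (f e)"
  shows "gintegrable f"
  using assms by (auto simp: gintegrable_def intro: integrable_continuous_lebesgue_on)

lemma gintegral_add:
  "gintegrable f \<Longrightarrow> gintegrable g \<Longrightarrow>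
    gintegral G l (\<lambda>e x. f e x + g e x) = gintegral G l f + gintegral G l g"
  by (simp add: gintegrable_def gintegral_def sum.distrib)

lemma gintegral_diff:
  "gintegrable f \<Longrightarrow> gintegrable g \<Longrightarrow>
    gintegral G l (\<lambda>e x. f e x - g e x) = gintegral G l f - gintegral G l g"
  by (simp add: gintegrable_def gintegral_def sum_subtractf)

lemma gintegral_mult_right:
  fixes f :: "'e \<Rightarrow> real \<Rightarrow> 'b::{real_normed_field, banach, second_countable_topology}"
  shows "gintegral G l (\<lambda>e x. c * f e x) = c * gintegral G l f"
  by (simp add: gintegral_def sum_distrib_left)

lemma gintegral_cong:
  "(\<And>e x. e \<in> arcs G \<Longrightarrow> x \<in> {0..l e} \<Longrightarrow> f e x = g e x) \<Longrightarrow> gintegral G l f = gintegral G l g"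
  unfolding gintegral_def by (intro sum.cong refl Bochner_Integration.integral_cong) auto

lemma gintegral_mono:
  fixes f g :: "'e \<Rightarrow> real \<Rightarrow> real"
  assumes "gintegrable f" "gintegrable g"
    "\<And>e x. e \<in> arcs G \<Longrightarrow> x \<in> {0..l e} \<Longrightarrow> f e x \<le> g e x"
  shows "gintegral G l f \<le> gintegral G l g"
  unfolding gintegral_def
  using assms by (intro sum_mono integral_mono) (auto simp: gintegrable_def)

lemma gintegral_nonneg:
  fixes f :: "'e \<Rightarrow> real \<Rightarrow> real"
  assumes "\<And>e x. e \<in> arcs G \<Longrightarrow> x \<in> {0..l e} \<Longrightarrow> 0 \<le> f e x"
  shows "0 \<le> gintegral G l f"
  unfolding gintegral_def using assms by (intro sum_nonneg Bochner_Integration.integral_nonneg) auto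

lemma gintegral_norm_le:
  fixes f :: "'e \<Rightarrow> real \<Rightarrow> 'b::{banach, second_countable_topology}"
  shows "norm (gintegral G l f) \<le> gintegral G l (\<lambda>e x. norm (f e x))"
  unfolding gintegral_def by (intro order_trans[OF norm_sum] sum_mono integral_norm_bound)

lemma gintegral_cong_AE:
  assumes "\<And>e. e \<in> arcs G \<Longrightarrow> AE x in lebesgue_on {0..l e}. f e x = g e x"
    "gintegrable f" "gintegrable g"
  shows "gintegral G l f = gintegral G l g"
  unfolding gintegral_def using assms
  by (intro sum.cong refl integral_cong_AE) (auto simp: gintegrable_def)

lemma gintegral_Re: "gintegrable f \<Longrightarrow> gintegral G l (\<lambda>e x. Re (f e x)) = Re (gintegral G l f)"
  by (simp add: gintegrable_def gintegral_def)

lemma gintegral_of_real: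
  "gintegral G l (\<lambda>e x. complex_of_real (f e x)) = complex_of_real (gintegral G l f)"
  by (simp add: gintegral_def)

lemma gintegral_const_real: "gintegral G l (\<lambda>e x. c::real) = c * total_length G l"
proof -
  have "(LINT x|lebesgue_on {0..l e}. c) = c * l e" if "e \<in> arcs G" for e
    using length_pos[OF that] by (simp add: measure_restrict_space)
  then show ?thesis unfolding gintegral_def total_length_def sum_distrib_left by (rule sum.cong[OF refl])
qed

lemma gintegral_const: "gintegral G l (\<lambda>e x. c::complex) = c * total_length G l"
proof -
  have "(LINT x|lebesgue_on {0..l e}. c) = c * l e" if "e \<in> arcs G" for e
    using length_pos[OF that] by (simp add: measure_restrict_space scaleR_conv_of_real)
  then show ?thesis
    unfolding gintegral_def total_length_def of_real_sum sum_distrib_left by (rule sum.cong[OF refl])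
qed

lemma total_length_pos: "0 < total_length G l"
  unfolding total_length_def using finite_edges edges_nonempty length_pos by (intro sum_pos) auto

lemma gL2_lincomb: "gL2 u \<Longrightarrow> gL2 w \<Longrightarrow> gL2 (\<lambda>e x. c * u e x + d * w e x)"
  by (auto simp: gL2_def intro: L2_interval_lincomb)

lemma gL2_const: "gL2 (\<lambda>e x. c)" by (simp add: gL2_def L2_interval_const)

lemma gL2_continuous: "(\<And>e. e \<in> arcs G \<Longrightarrow> continuous_on {0..l e} (u e)) \<Longrightarrow> gL2 u"
  by (simp add: gL2_def L2_interval_continuous)

lemma gintegrable_ip: "gL2 u \<Longrightarrow> gL2 w \<Longrightarrow> gintegrable (\<lambda>e x. u e x * cnj (w e x))"
  by (auto simp: gL2_def gintegrable_def intro: L2_interval_integrable)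

lemma gintegrable_gL2: "gL2 u \<Longrightarrow> gintegrable u"
  by (auto simp: gL2_def gintegrable_def intro: L2_interval_imp_integrable)

lemma gintegrable_sq: "gL2 u \<Longrightarrow> gintegrable (\<lambda>e x. (cmod (u e x))\<^sup>2)"
  by (auto simp: gL2_def gintegrable_def L2_interval_def)

lemma gintegrable_norm_mult: "gL2 u \<Longrightarrow> gL2 w \<Longrightarrow> gintegrable (\<lambda>e x. cmod (u e x) * cmod (w e x))"
  using gintegrable_ip[of u w] integrable_norm by (fastforce simp: gintegrable_def norm_mult)

lemma sqn_nonneg: "0 \<le> sqn u" unfolding sqn_def by (intro gintegral_nonneg) simp

lemma nrm_eq: "nrm u = sqrt (sqn u)"
  by (simp add: Lp_norm_def sqn_def sqrt_def)

lemma nrm_nonneg: "0 \<le> nrm u" by (simp add: nrm_eq sqn_nonneg)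

lemma nrm_sq: "(nrm u)\<^sup>2 = sqn u" by (simp add: nrm_eq sqn_nonneg)

lemma ip_self: "ip u u = of_real (sqn u)"
  unfolding ginner_def sqn_def gintegral_of_real[symmetric]
  by (intro gintegral_cong) (rule complex_norm_square[symmetric])

lemma ip_cnj: "ip w u = cnj (ip u w)"
proof -
  have "ip w u = gintegral G l (\<lambda>e x. cnj (u e x * cnj (w e x)))"
    unfolding ginner_def by (intro gintegral_cong) simp
  also have "\<dots> = cnj (ip u w)"
    unfolding ginner_def gintegral_def cnj_sum by (intro sum.cong refl Bochner_Integration.integral_cnj)
  finally show ?thesis .
qed

lemma ip_lincomb_left:
  assumes "gL2 u" "gL2 w" "gL2 z"
  shows "ip (\<lambda>e x. c * u e x + d * w e x) z = c * ip u z + d * ip w z"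
proof -
  have "ip (\<lambda>e x. c * u e x + d * w e x) z =
    gintegral G l (\<lambda>e x. c * (u e x * cnj (z e x)) + d * (w e x * cnj (z e x)))"
    unfolding ginner_def by (intro gintegral_cong) (simp add: algebra_simps)
  then show ?thesis
    unfolding ginner_def
    by (simp only: gintegral_add gintegral_mult_right gintegrable_mult_right gintegrable_ip assms)
qed

lemma ip_diff_left:
  assumes "gL2 u" "gL2 w" "gL2 z"
  shows "ip (\<lambda>e x. u e x - w e x) z = ip u z - ip w z"
  using ip_lincomb_left[OF assms, of 1 "-1"] by simp

lemma ip_diff_right:
  assumes "gL2 u" "gL2 w" "gL2 z"
  shows "ip z (\<lambda>e x. u e x - w e x) = ip z u - ip z w"
  using ip_diff_left[OF assms] by (simp add: ip_cnj[of z])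

lemma integral_norm_mult_le:
  assumes "gL2 u" "gL2 w"
  shows "gintegral G l (\<lambda>e x. cmod (u e x) * cmod (w e x)) \<le> nrm u * nrm w"
proof -
  let ?N = "gintegral G l (\<lambda>e x. cmod (u e x) * cmod (w e x))"
  have "?N\<^sup>2 \<le> sqn u * sqn w"
  proof (rule square_le_if_quadratic_nonneg)
    fix t :: real
    have i: "gintegrable (\<lambda>e x. t\<^sup>2 * (cmod (u e x))\<^sup>2)" "gintegrable (\<lambda>e x. (2 * t) * (cmod (u e x) * cmod (w e x)))"
      "gintegrable (\<lambda>e x. (cmod (w e x))\<^sup>2)"
      by (intro gintegrable_mult_right gintegrable_sq gintegrable_norm_mult assms)+
    have "0 \<le> gintegral G l (\<lambda>e x. t\<^sup>2 * (cmod (u e x))\<^sup>2 - (2 * t) * (cmod (u e x) * cmod (w e x)) + (cmod (w e x))\<^sup>2)"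
    proof (rule gintegral_nonneg)
      fix e x
      have "0 \<le> (t * cmod (u e x) - cmod (w e x))\<^sup>2" by simp
      then show "0 \<le> t\<^sup>2 * (cmod (u e x))\<^sup>2 - (2 * t) * (cmod (u e x) * cmod (w e x)) + (cmod (w e x))\<^sup>2"
        by (simp add: power2_diff power_mult_distrib algebra_simps)
    qed
    also have "\<dots> = t\<^sup>2 * sqn u - 2 * t * ?N + sqn w"
      using i by (simp only: gintegral_add gintegral_diff gintegrable_diff gintegral_mult_right sqn_def)
    finally show "0 \<le> sqn u * t\<^sup>2 - 2 * ?N * t + sqn w" by (simp add: mult_ac)
  qed
  then have "?N\<^sup>2 \<le> (nrm u * nrm w)\<^sup>2" by (simp add: power_mult_distrib nrm_sq)
  then show ?thesis by (rule power2_le_imp_le) (simp add: nrm_nonneg)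
qed

lemma ip_norm_le:
  assumes "gL2 u" "gL2 w"
  shows "cmod (ip u w) \<le> nrm u * nrm w"
  using gintegral_norm_le[of "\<lambda>e x. u e x * cnj (w e x)"] integral_norm_mult_le[OF assms]
  by (simp add: ginner_def norm_mult)

lemma sqn_lincomb:
  assumes "gL2 u" "gL2 w"
  shows "sqn (\<lambda>e x. c * u e x + d * w e x) =
    (cmod c)\<^sup>2 * sqn u + (cmod d)\<^sup>2 * sqn w + 2 * Re (c * cnj d * ip u w)"
proof -
  let ?z = "\<lambda>e x. c * u e x + d * w e x"
  have z: "gL2 ?z" by (intro gL2_lincomb assms)
  have uz: "ip u ?z = cnj c * ip u u + cnj d * ip u w"
    using ip_lincomb_left[OF assms assms(1), of c d] ip_cnj[of u ?z] ip_cnj[of u w] ip_cnj[of u u]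
    by simp
  have wz: "ip w ?z = cnj c * cnj (ip u w) + cnj d * ip w w"
    using ip_lincomb_left[OF assms assms(2), of c d] ip_cnj[of w ?z] ip_cnj[of w w]
    by simp
  have "of_real (sqn ?z) = c * ip u ?z + d * ip w ?z"
    unfolding ip_self[symmetric] by (rule ip_lincomb_left[OF assms z])
  also have "\<dots> = c * cnj c * of_real (sqn u) + d * cnj d * of_real (sqn w)
       + (c * cnj d * ip u w + cnj (c * cnj d * ip u w))"
    unfolding uz wz ip_self by (simp add: algebra_simps)
  also have "\<dots> = of_real ((cmod c)\<^sup>2 * sqn u + (cmod d)\<^sup>2 * sqn w + 2 * Re (c * cnj d * ip u w))"
    by (simp only: complex_norm_square[symmetric] complex_add_cnj of_real_add of_real_mult of_real_power)
  finally show ?thesis by (simp only: of_real_eq_iff)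
qed

lemma nrm_lincomb_le:
  assumes "gL2 u" "gL2 w"
  shows "nrm (\<lambda>e x. c * u e x + d * w e x) \<le> cmod c * nrm u + cmod d * nrm w"
proof (rule power2_le_imp_le)
  have "Re (c * cnj d * ip u w) \<le> cmod (c * cnj d * ip u w)" by (rule complex_Re_le_cmod)
  also have "\<dots> = cmod c * cmod d * cmod (ip u w)" by (simp add: norm_mult)
  also have "\<dots> \<le> cmod c * cmod d * (nrm u * nrm w)"
    by (intro mult_left_mono ip_norm_le assms) auto
  finally have "2 * Re (c * cnj d * ip u w) \<le> 2 * (cmod c * nrm u) * (cmod d * nrm w)"
    by (simp only: mult_ac mult_le_cancel_left_pos zero_less_numeral)
  then show "(nrm (\<lambda>e x. c * u e x + d * w e x))\<^sup>2 \<le> (cmod c * nrm u + cmod d * nrm w)\<^sup>2"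
    unfolding nrm_sq sqn_lincomb[OF assms] power2_sum power_mult_distrib by linarith
qed (simp add: nrm_nonneg)

lemma nrm_cong_AE:
  assumes "gL2 u" "gL2 w" "\<And>e. e \<in> arcs G \<Longrightarrow> AE x in lebesgue_on {0..l e}. u e x = w e x"
  shows "nrm u = nrm w"
proof -
  have "AE x in lebesgue_on {0..l e}. (cmod (u e x))\<^sup>2 = (cmod (w e x))\<^sup>2" if "e \<in> arcs G" for e
    using assms(3)[OF that] by eventually_elim simp
  then have "sqn u = sqn w"
    unfolding sqn_def by (intro gintegral_cong_AE gintegrable_sq assms(1,2))
  then show ?thesis by (simp add: nrm_eq)
qed

text \<open>The Cauchy-Schwarz inequality against the indicator of a single edge.\<close>
lemma edge_L1_le:
  assumes "gL2 u" "e \<in> arcs G"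
  shows "(LINT x|lebesgue_on {0..l e}. cmod (u e x)) \<le> sqrt (l e) * nrm u"
proof -
  let ?w = "\<lambda>e' x. if e' = e then 1 else 0 :: complex"
  have w: "gL2 ?w" by (intro gL2_continuous) auto
  have "gintegral G l (\<lambda>e' x. cmod (u e' x) * cmod (?w e' x)) =
     (\<Sum>e'\<in>arcs G. if e' = e then (LINT x|lebesgue_on {0..l e}. cmod (u e x)) else 0)"
    unfolding gintegral_def by (intro sum.cong) auto
  also have "\<dots> = (LINT x|lebesgue_on {0..l e}. cmod (u e x))"
    using assms finite_edges by simp
  finally have 1: "gintegral G l (\<lambda>e' x. cmod (u e' x) * cmod (?w e' x)) = \<dots>" .
  have "sqn ?w = (\<Sum>e'\<in>arcs G. if e' = e then (LINT x|lebesgue_on {0..l e}. 1) else 0)"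
    unfolding sqn_def gintegral_def by (intro sum.cong) auto
  also have "\<dots> = l e" using assms finite_edges length_pos[OF assms(2)] by (simp add: measure_restrict_space)
  finally have 2: "nrm ?w = sqrt (l e)" by (simp add: nrm_eq)
  show ?thesis using integral_norm_mult_le[OF assms(1) w] unfolding 1 2 by (simp add: mult.commute)
qed

lemma H1D:
  assumes "u \<in> H1"
  shows "gL2 u" "gL2 (D u)" "\<And>e. e \<in> arcs G \<Longrightarrow> continuous_on {0..l e} (u e)"
    "\<And>e. e \<in> arcs G \<Longrightarrow> H1_interval (l e) (u e)"
  using assms by (auto simp: H1_graph_def gL2_def H1_interval_def gderiv_def continuous_on_graph_def
     intro!: wderiv_works)

lemma H1_lincomb:
  assumes "u \<in> H1" "w \<in> H1"
  shows "(\<lambda>e x. c * u e x + d * w e x) \<in> H1"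
proof -
  obtain U W where "\<forall>e\<in>arcs G. u e 0 = U (tail G e) \<and> u e (l e) = U (head G e)"
    "\<forall>e\<in>arcs G. w e 0 = W (tail G e) \<and> w e (l e) = W (head G e)"
    using assms by (auto simp: H1_graph_def continuous_on_graph_def)
  then have "\<exists>V. \<forall>e\<in>arcs G. c * u e 0 + d * w e 0 = V (tail G e) \<and> c * u e (l e) + d * w e (l e) = V (head G e)"
    by (intro exI[of _ "\<lambda>v. c * U v + d * W v"]) simp
  then show ?thesis
    using assms unfolding H1_graph_def continuous_on_graph_def
    by (auto intro!: continuous_intros H1_interval_lincomb)
qed

lemma H1_diff: "u \<in> H1 \<Longrightarrow> w \<in> H1 \<Longrightarrow> (\<lambda>e x. u e x - w e x) \<in> H1"
  using H1_lincomb[of u w 1 "-1"] by simp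

lemma D_lincomb:
  assumes "u \<in> H1" "w \<in> H1" "e \<in> arcs G"
  shows "AE x in lebesgue_on {0..l e}. D (\<lambda>e x. c * u e x + d * w e x) e x = c * D u e x + d * D w e x"
  unfolding gderiv_def by (intro H1_interval_lincomb H1D(4) assms)

lemma nrm_D_lincomb:
  assumes "u \<in> H1" "w \<in> H1"
  shows "nrm (D (\<lambda>e x. c * u e x + d * w e x)) = nrm (\<lambda>e x. c * D u e x + d * D w e x)"
  by (intro nrm_cong_AE H1D(2) H1_lincomb gL2_lincomb D_lincomb assms)

lemma H1_const: "(\<lambda>e x. c) \<in> H1"
  by (auto simp: H1_graph_def continuous_on_graph_def H1_interval_const)

lemma D_const: "e \<in> arcs G \<Longrightarrow> AE x in lebesgue_on {0..l e}. D (\<lambda>e x. c) e x = 0"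
  unfolding gderiv_def by (rule wderiv_const)

lemma nrm_D_minus_const:
  assumes "u \<in> H1"
  shows "nrm (D (\<lambda>e x. u e x - c)) = nrm (D u)"
proof -
  have ae: "AE x in lebesgue_on {0..l e}. 1 * D u e x + (-1) * D (\<lambda>e x. c) e x = D u e x"
    if "e \<in> arcs G" for e
    using D_const[OF that, of c] by eventually_elim simp
  have "nrm (D (\<lambda>e x. 1 * u e x + (-1) * c)) = nrm (\<lambda>e x. 1 * D u e x + (-1) * D (\<lambda>e x. c) e x)"
    by (rule nrm_D_lincomb[OF assms H1_const])
  also have "\<dots> = nrm (D u)"
    by (intro nrm_cong_AE H1D(2) gL2_lincomb assms H1_const ae)
  finally show ?thesis by simp
qed

lemma h1n_eq: "h1n u = nrm (D u) + nrm u" by (simp add: H1_norm_def)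

lemma h1n_nonneg: "0 \<le> h1n u" by (simp add: h1n_eq nrm_nonneg)

lemma h1n_lincomb_le:
  assumes "u \<in> H1" "w \<in> H1"
  shows "h1n (\<lambda>e x. c * u e x + d * w e x) \<le> cmod c * h1n u + cmod d * h1n w"
  using nrm_lincomb_le[OF H1D(1)[OF assms(1)] H1D(1)[OF assms(2)], of c d]
    nrm_lincomb_le[OF H1D(2)[OF assms(1)] H1D(2)[OF assms(2)], of c d]
  by (simp add: h1n_eq nrm_D_lincomb[OF assms] algebra_simps) 

lemma h1n_diff_triangle:
  assumes "u \<in> H1" "w \<in> H1" "z \<in> H1"
  shows "h1n (\<lambda>e x. u e x - z e x) \<le> h1n (\<lambda>e x. u e x - w e x) + h1n (\<lambda>e x. w e x - z e x)"
  using h1n_lincomb_le[OF H1_diff[OF assms(1,2)] H1_diff[OF assms(2,3)], of 1 1] by simp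

lemma h1n_diff_commute:
  assumes "u \<in> H1" "w \<in> H1"
  shows "h1n (\<lambda>e x. u e x - w e x) = h1n (\<lambda>e x. w e x - u e x)"
  using h1n_lincomb_le[OF H1_diff[OF assms] H1_const[of 0], of "-1" 0]
    h1n_lincomb_le[OF H1_diff[OF assms(2,1)] H1_const[of 0], of "-1" 0] by simp

lemma h1n_le_add_diff:
  assumes "u \<in> H1" "w \<in> H1"
  shows "h1n u \<le> h1n w + h1n (\<lambda>e x. u e x - w e x)"
  using h1n_lincomb_le[OF assms(2) H1_diff[OF assms], of 1 1] by simp

lemma h1n_cong:
  assumes "\<And>e x. e \<in> arcs G \<Longrightarrow> x \<in> {0..l e} \<Longrightarrow> u e x = w e x"
  shows "h1n u = h1n w"
proof -
  have "D u e = D w e" if "e \<in> arcs G" for e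
    unfolding gderiv_def by (intro wderiv_cong assms that)
  then have "sqn (D u) = sqn (D w)" "sqn u = sqn w"
    using assms by (auto simp: sqn_def intro!: gintegral_cong)
  then show ?thesis by (simp add: h1n_eq nrm_eq)
qed

lemma H1_oscillation_le:
  assumes u: "u \<in> H1" and e: "e \<in> arcs G" and xy: "x \<in> {0..l e}" "y \<in> {0..l e}"
  shows "cmod (u e x - u e y) \<le> sqrt (l e) * nrm (D u)"
proof -
  let ?B = "sqrt (l e) * nrm (D u)"
  have i: "integrable (lebesgue_on {0..l e}) (D u e)"
    using gintegrable_gL2[OF H1D(2)[OF u]] e by (simp add: gintegrable_def)
  have cont: "continuous_on {0..l e} (u e)" by (rule H1D(3)[OF u e])
  have lt: "cmod (u e d - u e c) \<le> ?B" if "0 < c" "c < d" "d < l e" for c d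
  proof -
    have "u e d - u e c = (LINT x|lebesgue_on {0..l e}. indicat_real {c<..d} x *\<^sub>R D u e x)"
      unfolding gderiv_def
      using that wderiv_works[OF H1D(4)[OF u e]] i
      by (intro weak_deriv_FTC cont) (auto simp: gderiv_def)
    also have "norm \<dots> \<le> (LINT x|lebesgue_on {0..l e}. cmod (D u e x))"
    proof (rule Bochner_Integration.integral_norm_bound_integral)
      show "integrable (lebesgue_on {0..l e}) (\<lambda>x. indicat_real {c<..d} x *\<^sub>R D u e x)"
        by (rule integrable_indicator_scaleR_lebesgue_on[OF i]) simp
    qed (auto intro!: integrable_norm i simp: indicator_def)
    also have "\<dots> \<le> ?B" by (rule edge_L1_le[OF H1D(2)[OF u] e])
    finally show ?thesis .
  qed
  have open_open: "cmod (u e s - u e t) \<le> ?B" if "s \<in> {0<..<l e}" "t \<in> {0<..<l e}" for s t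
    using lt[of s t] lt[of t s] that nrm_nonneg[of "D u"] length_pos[OF e]
    by (cases s t rule: linorder_cases) (auto simp: norm_minus_commute)
  have cl: "closure {0<..<l e} = {0..l e}" using length_pos[OF e] by simp
  have open_closed: "cmod (u e s - u e t) \<le> ?B" if s: "s \<in> {0..l e}" and t: "t \<in> {0<..<l e}" for s t
  proof (rule continuous_on_closure_norm_le[where f="\<lambda>s. u e s - u e t" and x=s])
    show "continuous_on (closure {0<..<l e}) (\<lambda>s. u e s - u e t)"
      unfolding cl by (intro continuous_on_diff cont continuous_on_const)
  qed (use open_open[OF _ t] s cl in auto)
  show ?thesis
  proof (rule continuous_on_closure_norm_le[where f="\<lambda>t. u e x - u e t" and x=y])
    show "continuous_on (closure {0<..<l e}) (\<lambda>t. u e x - u e t)"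
      unfolding cl by (intro continuous_on_diff cont continuous_on_const)
  qed (use open_closed[OF xy(1)] xy(2) cl in auto)
qed

lemma sobolev_edge:
  assumes u: "u \<in> H1" and e: "e \<in> arcs G" and x: "x \<in> {0..l e}"
  shows "cmod (u e x) \<le> (1 / sqrt (l e) + sqrt (l e)) * h1n u"
proof -
  let ?B = "sqrt (l e) * nrm (D u)"
  have l: "l e > 0" by (rule length_pos[OF e])
  have i: "integrable (lebesgue_on {0..l e}) (\<lambda>y. cmod (u e y))"
    using gintegrable_gL2[OF H1D(1)[OF u]] e by (simp add: gintegrable_def)
  have fm: "finite_measure (lebesgue_on {0..l e})" by (rule finite_measure_lebesgue_on) simp
  have "cmod (u e x) \<le> cmod (u e y) + ?B" if "y \<in> {0..l e}" for y
    using H1_oscillation_le[OF u e x that] norm_triangle_ineq2[of "u e x" "u e y"] by simp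
  then have "(LINT y|lebesgue_on {0..l e}. cmod (u e x)) \<le> (LINT y|lebesgue_on {0..l e}. cmod (u e y) + ?B)"
    by (intro integral_mono finite_measure.integrable_const[OF fm] Bochner_Integration.integrable_add i) auto
  also have "\<dots> = (LINT y|lebesgue_on {0..l e}. cmod (u e y)) + (LINT y|lebesgue_on {0..l e}. ?B)"
    by (intro Bochner_Integration.integral_add finite_measure.integrable_const[OF fm] i)
  also have "\<dots> \<le> sqrt (l e) * nrm u + l e * ?B"
    using edge_L1_le[OF H1D(1)[OF u] e] l by (simp add: measure_restrict_space)
  finally have "l e * cmod (u e x) \<le> sqrt (l e) * nrm u + l e * ?B"
    using l by (simp add: measure_restrict_space)
  then have "cmod (u e x) \<le> (sqrt (l e) * nrm u + l e * ?B) / l e"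
    using l by (simp add: pos_le_divide_eq mult.commute)
  also have "\<dots> = (1 / sqrt (l e)) * nrm u + sqrt (l e) * nrm (D u)"
  proof -
    obtain r where r: "r > 0" "l e = r * r" "sqrt (l e) = r"
      using l real_sqrt_mult_self[of "l e"] by (metis abs_of_pos real_sqrt_gt_zero)
    then have "(r * nrm u + r * r * (r * nrm (D u))) / (r * r) = 1 / r * nrm u + r * nrm (D u)"
      by (simp add: add_divide_distrib)
    then show ?thesis unfolding r(3) by (simp only: r(2))
  qed
  also have "\<dots> \<le> (1 / sqrt (l e)) * h1n u + sqrt (l e) * h1n u"
    using l by (intro add_mono mult_left_mono) (auto simp: h1n_eq nrm_nonneg)
  finally show ?thesis by (simp add: algebra_simps)
qed

text \<open>
  The embedding of \<open>H\<^sup>1\<close> into bounded functions. It holds edge by edge, since the norm contains the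
  \<open>L\<^sup>2\<close> part.
\<close>
lemma sobolev:
  obtains C where "C > 0" "\<And>u e x. u \<in> H1 \<Longrightarrow> e \<in> arcs G \<Longrightarrow> x \<in> {0..l e} \<Longrightarrow> cmod (u e x) \<le> C * h1n u"
proof
  let ?C = "1 + (\<Sum>e\<in>arcs G. 1 / sqrt (l e) + sqrt (l e))"
  have nn: "0 \<le> 1 / sqrt (l e) + sqrt (l e)" if "e \<in> arcs G" for e
    using length_pos[OF that] by simp
  show "?C > 0" using sum_nonneg[of "arcs G" "\<lambda>e. 1 / sqrt (l e) + sqrt (l e)"] nn by simp
  fix u e x assume *: "u \<in> H1" "e \<in> arcs G" "x \<in> {0..l e}"
  have "1 / sqrt (l e) + sqrt (l e) \<le> ?C"
    using member_le_sum[OF *(2) _ finite_edges, of "\<lambda>e. 1 / sqrt (l e) + sqrt (l e)"] nn by simp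
  then show "cmod (u e x) \<le> ?C * h1n u"
    using order_trans[OF sobolev_edge[OF *] mult_right_mono[OF _ h1n_nonneg]] by blast
qed

end

section \<open>The nonlinearity and the energy\<close>

lemma has_vector_derivative_zeroI:
  fixes g :: "real \<Rightarrow> 'a::real_normed_vector"
  assumes "\<And>s. s \<in> S \<Longrightarrow> norm (g s - g t) \<le> \<bar>s - t\<bar> * H s" "(H \<longlongrightarrow> 0) (at t within S)"
  shows "(g has_vector_derivative 0) (at t within S)"
  unfolding has_vector_derivative_def
  by (rule has_derivativeI_sandwich[where H=H and e=1])
    (use assms in \<open>auto simp: divide_le_eq mult.commute\<close>)

lemma has_vector_derivative_right_quotient:
  fixes f :: "real \<Rightarrow> 'a::real_normed_vector"
  assumes "(f has_vector_derivative d) (at t within S)" "{t..c} \<subseteq> S" "t < c"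
  shows "((\<lambda>h. (f (t + h) - f t) /\<^sub>R h) \<longlongrightarrow> d) (at_right 0)"
proof -
  have "(f has_vector_derivative d) (at t within {t..c})"
    by (rule has_vector_derivative_within_subset[OF assms(1,2)])
  then have "(f has_derivative (\<lambda>h. h *\<^sub>R d)) (at_right t)"
    unfolding has_vector_derivative_def at_within_Icc_at_right[OF assms(3)] .
  then have "((\<lambda>y. norm (f y - f t - (y - t) *\<^sub>R d) / norm (y - t)) \<longlongrightarrow> 0) (at_right t)"
    by (simp add: has_derivative_iff_norm)
  then have "((\<lambda>h. norm (f (t + h) - f t - h *\<^sub>R d) / norm h) \<longlongrightarrow> 0) (at_right 0)"
    by (subst (asm) filterlim_at_right_to_0) (simp add: add.commute)
  then have "((\<lambda>h. norm ((f (t + h) - f t) /\<^sub>R h - d)) \<longlongrightarrow> 0) (at_right 0)"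
  proof (rule Lim_transform_eventually)
    have "norm (f (t + h) - f t - h *\<^sub>R d) / norm h = norm ((f (t + h) - f t) /\<^sub>R h - d)" if "h > 0" for h
    proof -
      have "(f (t + h) - f t) /\<^sub>R h - d = (f (t + h) - f t - h *\<^sub>R d) /\<^sub>R h"
        using that by (simp add: scaleR_diff_right)
      then have "norm ((f (t + h) - f t) /\<^sub>R h - d) = norm (f (t + h) - f t - h *\<^sub>R d) * inverse h"
        using that by simp
      then show ?thesis using that by (simp add: divide_inverse mult.commute)
    qed
    then show "\<forall>\<^sub>F h in at_right 0. norm (f (t + h) - f t - h *\<^sub>R d) / norm h = norm ((f (t + h) - f t) /\<^sub>R h - d)"
      by (auto simp: eventually_at_filter)
  qed
  then show ?thesis by (simp add: tendsto_norm_zero_iff LIM_zero_iff)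
qed

lemma vector_derivative_bound_Icc:
  fixes f :: "real \<Rightarrow> 'a::real_normed_vector"
  assumes "\<And>x. x \<in> {a..b} \<Longrightarrow> (f has_vector_derivative f' x) (at x within {a..b})"
    "\<And>x. x \<in> {a..b} \<Longrightarrow> norm (f' x) \<le> B" "x \<in> {a..b}" "y \<in> {a..b}"
  shows "norm (f x - f y) \<le> B * \<bar>x - y\<bar>"
proof -
  have "onorm (\<lambda>h. h *\<^sub>R f' x) \<le> B" if "x \<in> {a..b}" for x
    using assms(2)[OF that] by (intro onorm_le) (simp add: mult_left_mono mult.commute[of B])
  then show ?thesis
    using differentiable_bound[of "{a..b}" f "\<lambda>x h. h *\<^sub>R f' x" B x y] assms
    by (auto simp: has_vector_derivative_def)
qed

text \<open>
  With \<open>A = \<bar>a\<bar>\<^sup>2\<close> and \<open>B = \<bar>b\<bar>\<^sup>2\<close> the quantity on the left is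
  \<open>- (B - A)\<^sup>3 / 6 - (B - A) (B + A) \<bar>b - a\<bar>\<^sup>2 / 2\<close>, so it is of third order in \<open>b - a\<close>. The factor \<open>4\<close> is
  what removes the first and second order terms.
\<close>
lemma quintic_increment_bound:
  fixes a b :: complex
  assumes "cmod a \<le> R" "cmod b \<le> R"
  shows "\<bar>(cmod b) ^ 4 * Re (b * cnj a) - (cmod a) ^ 4 * Re (a * cnj b)
      - 4 * ((cmod b) ^ 6 / 6 - (cmod a) ^ 6 / 6)\<bar> \<le> 4 * R ^ 3 * (cmod (b - a)) ^ 3"
proof -
  define A B w where "A = (cmod a)\<^sup>2" and "B = (cmod b)\<^sup>2" and "w = cmod (b - a)"
  have R: "0 \<le> R" using assms norm_ge_zero order_trans by blast
  have w: "0 \<le> w" by (simp add: w_def)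
  have w2: "w\<^sup>2 = A + B - 2 * Re (b * cnj a)"
    unfolding w_def A_def B_def cmod_power2 by (simp add: power2_eq_square algebra_simps)
  have sym: "Re (a * cnj b) = Re (b * cnj a)" by (simp add: mult.commute)
  have p4: "(cmod a) ^ 4 = A\<^sup>2" "(cmod b) ^ 4 = B\<^sup>2" "(cmod a) ^ 6 = A ^ 3" "(cmod b) ^ 6 = B ^ 3"
    by (simp_all add: A_def B_def flip: power_mult)
  have Re: "Re (b * cnj a) = (A + B - w\<^sup>2) / 2" using w2 by simp
  have eq: "(cmod b) ^ 4 * Re (b * cnj a) - (cmod a) ^ 4 * Re (a * cnj b)
      - 4 * ((cmod b) ^ 6 / 6 - (cmod a) ^ 6 / 6) = - ((B - A) ^ 3 / 6) - (B - A) * (B + A) * w\<^sup>2 / 2"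
    unfolding sym p4 Re by (simp add: field_simps power2_eq_square power3_eq_cube)
  have "\<bar>cmod b - cmod a\<bar> \<le> w" unfolding w_def by (rule norm_triangle_ineq3)
  moreover have "B - A = (cmod b - cmod a) * (cmod b + cmod a)"
    by (simp add: A_def B_def power2_eq_square algebra_simps)
  ultimately have BA: "\<bar>B - A\<bar> \<le> w * (2 * R)"
    using assms by (simp add: abs_mult) (intro mult_mono, auto simp: w)
  have "B \<le> R\<^sup>2" "A \<le> R\<^sup>2" using assms by (auto simp: A_def B_def intro: power_mono)
  then have BA2: "\<bar>B + A\<bar> \<le> 2 * R\<^sup>2" by (simp add: A_def B_def)
  have "\<bar>- ((B - A) ^ 3 / 6) - (B - A) * (B + A) * w\<^sup>2 / 2\<bar> \<le> \<bar>B - A\<bar> ^ 3 / 6 + \<bar>B - A\<bar> * \<bar>B + A\<bar> * w\<^sup>2 / 2"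
    using abs_triangle_ineq4[of "- ((B - A) ^ 3 / 6)" "(B - A) * (B + A) * w\<^sup>2 / 2"]
    by (simp add: abs_mult power_abs)
  also have "\<dots> \<le> (w * (2 * R)) ^ 3 / 6 + (w * (2 * R)) * (2 * R\<^sup>2) * w\<^sup>2 / 2"
    by (intro add_mono divide_right_mono mult_mono power_mono BA BA2) (auto simp: w R)
  also have "\<dots> \<le> 4 * R ^ 3 * w ^ 3"
    using mult_nonneg_nonneg[of "R ^ 3" "w ^ 3"] R w by (simp add: power_mult_distrib power2_eq_square power3_eq_cube algebra_simps)
  finally show ?thesis unfolding eq w_def .
qed

context metric_graph begin

text \<open>The nonlinearity \<open>\<bar>u\<bar>\<^sup>4 u\<close>.\<close>
definition nonlin :: "'e gfun \<Rightarrow> 'e gfun" where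
  "nonlin u = (\<lambda>e x. of_real ((cmod (u e x)) ^ 4) * u e x)"

text \<open>The potential energy \<open>\<parallel>u\<parallel>\<^sub>6\<^sup>6 / 6\<close>.\<close>
definition pot :: "'e gfun \<Rightarrow> real" where
  "pot u = gintegral G l (\<lambda>e x. (cmod (u e x)) ^ 6) / 6"

text \<open>The NLS energy \<open>E(u) = \<parallel>u'\<parallel>\<^sub>2\<^sup>2 / 2 - \<parallel>u\<parallel>\<^sub>6\<^sup>6 / 6\<close>.\<close>
definition energy :: "'e gfun \<Rightarrow> real" where
  "energy u = sqn (D u) / 2 - pot u"

lemma nonlin_continuous: "u \<in> H1 \<Longrightarrow> e \<in> arcs G \<Longrightarrow> continuous_on {0..l e} (nonlin u e)"
  unfolding nonlin_def by (intro continuous_intros H1D(3))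

lemma gL2_nonlin: "u \<in> H1 \<Longrightarrow> gL2 (nonlin u)"
  by (intro gL2_continuous nonlin_continuous)

lemma nrm_le_pointwise:
  assumes "gL2 f" "gL2 u" "0 \<le> K" "\<And>e x. e \<in> arcs G \<Longrightarrow> x \<in> {0..l e} \<Longrightarrow> cmod (f e x) \<le> K * cmod (u e x)"
  shows "nrm f \<le> K * nrm u"
proof (rule power2_le_imp_le)
  have "sqn f \<le> gintegral G l (\<lambda>e x. K\<^sup>2 * (cmod (u e x))\<^sup>2)"
    unfolding sqn_def
    by (intro gintegral_mono gintegrable_sq gintegrable_mult_right assms(1,2))
      (use assms(4) in \<open>simp flip: power_mult_distrib add: power_mono\<close>)
  then show "(nrm f)\<^sup>2 \<le> (K * nrm u)\<^sup>2"
    by (simp only: nrm_sq power_mult_distrib gintegral_mult_right sqn_def[symmetric])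
qed (simp add: assms nrm_nonneg)

lemma ip_nonlin_self: "ip (nonlin u) u = of_real (6 * pot u)"
proof -
  have "ip (nonlin u) u = gintegral G l (\<lambda>e x. complex_of_real ((cmod (u e x)) ^ 6))"
    unfolding ginner_def nonlin_def
  proof (rule gintegral_cong)
    fix e x
    have "u e x * cnj (u e x) = complex_of_real ((cmod (u e x))\<^sup>2)"
      by (simp only: complex_norm_square)
    then show "complex_of_real ((cmod (u e x)) ^ 4) * u e x * cnj (u e x) = complex_of_real ((cmod (u e x)) ^ 6)"
      by (simp add: mult.assoc flip: of_real_mult of_real_power power_add)
  qed
  then show ?thesis unfolding gintegral_of_real by (simp add: pot_def)
qed

lemma nrm_le_h1n: "nrm u \<le> h1n u" "nrm (D u) \<le> h1n u"
  by (simp_all add: h1n_eq nrm_nonneg)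

text \<open>On bounded sets of \<open>H\<^sup>1\<close> the right-hand side of the equation is bounded in the dual of \<open>H\<^sup>1\<close>.\<close>
lemma weak_rhs_bound:
  assumes C: "0 < C" "\<And>u e x. u \<in> H1 \<Longrightarrow> e \<in> arcs G \<Longrightarrow> x \<in> {0..l e} \<Longrightarrow> cmod (u e x) \<le> C * h1n u"
    and u: "u \<in> H1" "h1n u \<le> M" and \<phi>: "\<phi> \<in> H1"
  shows "cmod (ip (D u) (D \<phi>) - ip (nonlin u) \<phi>) \<le> (M + (C * M) ^ 4 * M) * h1n \<phi>"
proof -
  have M: "0 \<le> M" using u(2) h1n_nonneg order_trans by blast
  have "nrm (nonlin u) \<le> (C * M) ^ 4 * nrm u"
  proof (rule nrm_le_pointwise[OF gL2_nonlin[OF u(1)] H1D(1)[OF u(1)]])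
    fix e x assume "e \<in> arcs G" "x \<in> {0..l e}"
    then have "cmod (u e x) \<le> C * M"
      using C(2)[OF u(1)] u(2) C(1) by (meson mult_left_mono order_trans less_imp_le)
    then show "cmod (nonlin u e x) \<le> (C * M) ^ 4 * cmod (u e x)"
      by (simp add: nonlin_def norm_mult norm_power mult_right_mono power_mono)
  qed simp
  also have "\<dots> \<le> (C * M) ^ 4 * M" using nrm_le_h1n(1)[of u] u(2) by (intro mult_left_mono) auto
  finally have 1: "nrm (nonlin u) \<le> (C * M) ^ 4 * M" .
  have "cmod (ip (D u) (D \<phi>) - ip (nonlin u) \<phi>) \<le> cmod (ip (D u) (D \<phi>)) + cmod (ip (nonlin u) \<phi>)"
    by (rule norm_triangle_ineq4)
  also have "\<dots> \<le> nrm (D u) * nrm (D \<phi>) + nrm (nonlin u) * nrm \<phi>"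
    by (intro add_mono ip_norm_le H1D gL2_nonlin u \<phi>)
  also have "\<dots> \<le> M * h1n \<phi> + ((C * M) ^ 4 * M) * h1n \<phi>"
    using nrm_le_h1n(2)[of u] u(2) M by (intro add_mono mult_mono 1 nrm_le_h1n nrm_nonneg) auto
  finally show ?thesis by (simp add: algebra_simps)
qed

text \<open>
  The integrated form of \<open>quintic_increment_bound\<close>: the error is cubic in \<open>w - u\<close>, and one factor is taken out in the
  supremum norm.
\<close>
lemma pot_increment_bound:
  assumes u: "u \<in> H1" and w: "w \<in> H1"
    and R: "\<And>e x. e \<in> arcs G \<Longrightarrow> x \<in> {0..l e} \<Longrightarrow> cmod (u e x) \<le> R"
      "\<And>e x. e \<in> arcs G \<Longrightarrow> x \<in> {0..l e} \<Longrightarrow> cmod (w e x) \<le> R"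
    and r: "\<And>e x. e \<in> arcs G \<Longrightarrow> x \<in> {0..l e} \<Longrightarrow> cmod (w e x - u e x) \<le> r"
  shows "\<bar>Re (ip (nonlin w) u) - Re (ip (nonlin u) w) - 4 * (pot w - pot u)\<bar>
     \<le> 4 * R ^ 3 * r * sqn (\<lambda>e x. w e x - u e x)"
proof -
  let ?f = "\<lambda>e x. (cmod (w e x)) ^ 4 * Re (w e x * cnj (u e x)) - (cmod (u e x)) ^ 4 * Re (u e x * cnj (w e x))
      - 4 * ((cmod (w e x)) ^ 6 / 6 - (cmod (u e x)) ^ 6 / 6)"
  have uc: "\<And>e. e \<in> arcs G \<Longrightarrow> continuous_on {0..l e} (u e)" by (rule H1D(3)[OF u])
  have wc: "\<And>e. e \<in> arcs G \<Longrightarrow> continuous_on {0..l e} (w e)" by (rule H1D(3)[OF w])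
  obtain e0 where "e0 \<in> arcs G" using edges_nonempty by auto
  then have R0: "0 \<le> R" using R(1)[of e0 0] length_pos[of e0] by (auto intro: order_trans[OF norm_ge_zero])
  have i1: "gintegrable (\<lambda>e x. (cmod (w e x)) ^ 4 * Re (w e x * cnj (u e x)))"
     "gintegrable (\<lambda>e x. (cmod (u e x)) ^ 4 * Re (u e x * cnj (w e x)))"
     "gintegrable (\<lambda>e x. (cmod (w e x)) ^ 6 / 6)"  "gintegrable (\<lambda>e x. (cmod (u e x)) ^ 6 / 6)"
    by (intro gintegrable_continuous continuous_intros uc wc; simp)+
  have Re1: "gintegral G l (\<lambda>e x. (cmod (w e x)) ^ 4 * Re (w e x * cnj (u e x))) = Re (ip (nonlin w) u)"
    if "u \<in> H1" "w \<in> H1" for u w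
    unfolding ginner_def
    by (subst gintegral_Re[symmetric, OF gintegrable_ip[OF gL2_nonlin H1D(1)]])
      (auto intro!: gintegral_cong that simp: nonlin_def algebra_simps)
  have p: "gintegral G l (\<lambda>e x. (cmod (u e x)) ^ 6 / 6) = pot u" for u
    using gintegral_mult_right[of "1/6" "\<lambda>e x. (cmod (u e x)) ^ 6"] by (simp add: pot_def)
  have "gintegral G l ?f = Re (ip (nonlin w) u) - Re (ip (nonlin u) w) - 4 * (pot w - pot u)"
    by (simp only: gintegral_diff gintegrable_diff gintegral_mult_right gintegrable_mult_right i1 p Re1 u w)
  then have "\<bar>Re (ip (nonlin w) u) - Re (ip (nonlin u) w) - 4 * (pot w - pot u)\<bar> \<le> gintegral G l (\<lambda>e x. norm (?f e x))"
    using gintegral_norm_le[of ?f] by (simp only: real_norm_def)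
  also have "\<dots> \<le> gintegral G l (\<lambda>e x. (4 * R ^ 3 * r) * (cmod (w e x - u e x))\<^sup>2)"
  proof (intro gintegral_mono)
    show "gintegrable (\<lambda>e x. norm (?f e x))"
      by (intro gintegrable_continuous continuous_intros uc wc) simp_all
    show "gintegrable (\<lambda>e x. (4 * R ^ 3 * r) * (cmod (w e x - u e x))\<^sup>2)"
      by (intro gintegrable_continuous continuous_intros uc wc)
    fix e x assume ex: "e \<in> arcs G" "x \<in> {0..l e}"
    have "norm (?f e x) \<le> 4 * R ^ 3 * (cmod (w e x - u e x)) ^ 3"
      using quintic_increment_bound[OF R(1)[OF ex] R(2)[OF ex]] by simp
    also have "\<dots> = 4 * R ^ 3 * (cmod (w e x - u e x) * (cmod (w e x - u e x))\<^sup>2)"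
      by (simp add: power2_eq_square power3_eq_cube)
    also have "\<dots> \<le> 4 * R ^ 3 * (r * (cmod (w e x - u e x))\<^sup>2)"
      using R0 by (intro mult_left_mono mult_right_mono r ex) auto
    finally show "norm (?f e x) \<le> (4 * R ^ 3 * r) * (cmod (w e x - u e x))\<^sup>2" by (simp add: mult_ac)
  qed
  also have "\<dots> = 4 * R ^ 3 * r * sqn (\<lambda>e x. w e x - u e x)"
    by (simp only: gintegral_mult_right sqn_def)
  finally show ?thesis .
qed

lemma pot_lipschitz:
  assumes u: "u \<in> H1" and w: "w \<in> H1"
    and R: "\<And>e x. e \<in> arcs G \<Longrightarrow> x \<in> {0..l e} \<Longrightarrow> cmod (u e x) \<le> R"
      "\<And>e x. e \<in> arcs G \<Longrightarrow> x \<in> {0..l e} \<Longrightarrow> cmod (w e x) \<le> R"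
    and r: "\<And>e x. e \<in> arcs G \<Longrightarrow> x \<in> {0..l e} \<Longrightarrow> cmod (w e x - u e x) \<le> r"
  shows "\<bar>pot w - pot u\<bar> \<le> R ^ 5 * total_length G l * r"
proof -
  have uc: "\<And>e. e \<in> arcs G \<Longrightarrow> continuous_on {0..l e} (u e)" by (rule H1D(3)[OF u])
  have wc: "\<And>e. e \<in> arcs G \<Longrightarrow> continuous_on {0..l e} (w e)" by (rule H1D(3)[OF w])
  have i: "gintegrable (\<lambda>e x. (cmod (w e x)) ^ 6)" "gintegrable (\<lambda>e x. (cmod (u e x)) ^ 6)"
    by (intro gintegrable_continuous continuous_intros uc wc; simp)+
  let ?f = "\<lambda>e x. (cmod (w e x)) ^ 6 - (cmod (u e x)) ^ 6"
  have "6 * (pot w - pot u) = gintegral G l ?f"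
    by (simp add: pot_def gintegral_diff i)
  also have "\<bar>\<dots>\<bar> \<le> gintegral G l (\<lambda>e x. norm (?f e x))"
    using gintegral_norm_le[of ?f] by (simp only: real_norm_def)
  also have "\<dots> \<le> gintegral G l (\<lambda>e x. 6 * R ^ 5 * r)"
  proof (intro gintegral_mono)
    show "gintegrable (\<lambda>e x. norm (?f e x))" "gintegrable (\<lambda>e x. 6 * R ^ 5 * r)"
      by (intro gintegrable_continuous continuous_intros uc wc; simp)+
    fix e x assume ex: "e \<in> arcs G" "x \<in> {0..l e}"
    have pw: "\<bar>a ^ 6 - b ^ 6\<bar> \<le> 6 * R ^ 5 * \<bar>a - b\<bar>" if "0 \<le> a" "a \<le> R" "0 \<le> b" "b \<le> R" for a b :: real
    proof -
      have "norm (a ^ 6 - b ^ 6) \<le> (6 * R ^ 5) * norm (a - b)"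
        by (rule field_differentiable_bound[of "{0..R}" "\<lambda>x. x ^ 6" "\<lambda>x. 6 * x ^ 5"])
          (use that in \<open>auto intro!: derivative_eq_intros power_mono simp: abs_mult\<close>)
      then show ?thesis by simp
    qed
    have "norm (?f e x) \<le> 6 * R ^ 5 * \<bar>cmod (w e x) - cmod (u e x)\<bar>"
      using pw[of "cmod (w e x)" "cmod (u e x)"] R[OF ex] by simp
    also have "\<dots> \<le> 6 * R ^ 5 * r"
      using order_trans[OF norm_triangle_ineq3 r[OF ex]] order_trans[OF norm_ge_zero R(1)[OF ex]]
      by (intro mult_left_mono) auto
    finally show "norm (?f e x) \<le> 6 * R ^ 5 * r" .
  qed
  finally show ?thesis by (simp add: gintegral_const_real mult_ac abs_mult)
qed

end

section \<open>Conservation of mass and energy\<close>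

text \<open>A strong \<open>H\<^sup>1\<close> solution on \<open>[0, T)\<close>.\<close>
locale nls_curve = metric_graph G l
  for G :: "('v, 'e) pre_digraph" and l :: "'e \<Rightarrow> real" +
  fixes T :: ereal and v0 :: "'e gfun" and v :: "real \<Rightarrow> 'e gfun"
  assumes solution: "nls_solution G l T v0 v" and T_pos: "0 < T"
begin

text \<open>The time interval \<open>[0, T)\<close>.\<close>
abbreviation I :: "real set" where "I \<equiv> time_interval T"

text \<open>The \<open>H\<^sup>1\<close> distance between two times of the solution.\<close>
definition \<delta> :: "real \<Rightarrow> real \<Rightarrow> real" where
  "\<delta> s t = h1n (\<lambda>e x. v s e x - v t e x)"

text \<open>The right-hand side of \<open>v\<^sub>t = - \<i> (- v'' - \<bar>v\<bar>\<^sup>4 v)\<close> at time \<open>t\<close>, paired with the test function \<open>\<phi>\<close>.\<close>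
definition rhs :: "real \<Rightarrow> 'e gfun \<Rightarrow> complex" where
  "rhs t \<phi> = - \<i> * (ip (D (v t)) (D \<phi>) - ip (nonlin (v t)) \<phi>)"

lemma zero_in_I: "0 \<in> I" using T_pos by (simp add: time_interval_def zero_ereal_def)

lemma I_downward: "t \<in> I \<Longrightarrow> 0 \<le> s \<Longrightarrow> s \<le> t \<Longrightarrow> s \<in> I"
  by (auto simp: time_interval_def intro: le_less_trans[of "ereal s" "ereal t"])

lemma Icc_subset_I: "b \<in> I \<Longrightarrow> {0..b} \<subseteq> I" using I_downward by auto

lemma I_larger:
  assumes "b \<in> I"
  obtains b' where "b < b'" "b' \<in> I"
proof -
  have "ereal b < T" "0 \<le> b" using assms by (auto simp: time_interval_def)
  then obtain z where "ereal b < ereal z" "ereal z < T" using ereal_dense2 by blast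
  then show ?thesis using that[of z] \<open>0 \<le> b\<close> by (simp add: time_interval_def)
qed

lemma v_H1: "t \<in> I \<Longrightarrow> v t \<in> H1"
  using solution by (simp add: nls_solution_def)

lemma v_0: "e \<in> arcs G \<Longrightarrow> x \<in> {0..l e} \<Longrightarrow> v 0 e x = v0 e x"
  using solution by (simp add: nls_solution_def)

lemma \<delta>_tendsto: "t \<in> I \<Longrightarrow> ((\<lambda>s. \<delta> s t) \<longlongrightarrow> 0) (at t within I)"
  using solution by (simp add: nls_solution_def \<delta>_def)

lemma weak_derivative:
  assumes "\<phi> \<in> H1" "t \<in> I"
  shows "((\<lambda>s. ip (v s) \<phi>) has_vector_derivative rhs t \<phi>) (at t within I)"
proof -
  obtain d where d: "((\<lambda>s. ip (v s) \<phi>) has_vector_derivative d) (at t within I)"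
    "\<i> * d = ip (D (v t)) (D \<phi>) - ip (nonlin (v t)) \<phi>"
    using solution assms unfolding nls_solution_def nonlin_def by blast
  have "rhs t \<phi> = - \<i> * (\<i> * d)" unfolding rhs_def d(2) ..
  then have "rhs t \<phi> = d" by (simp flip: mult.assoc)
  then show ?thesis using d(1) by simp
qed

lemma \<delta>_nonneg: "0 \<le> \<delta> s t" by (simp add: \<delta>_def h1n_nonneg)
lemma \<delta>_commute: "s \<in> I \<Longrightarrow> t \<in> I \<Longrightarrow> \<delta> s t = \<delta> t s"
  unfolding \<delta>_def by (intro h1n_diff_commute v_H1)
lemma \<delta>_triangle: "s \<in> I \<Longrightarrow> t \<in> I \<Longrightarrow> r \<in> I \<Longrightarrow> \<delta> s r \<le> \<delta> s t + \<delta> t r"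
  unfolding \<delta>_def by (intro h1n_diff_triangle v_H1)
lemma \<delta>_self: "\<delta> t t = 0"
proof -
  have "h1n (\<lambda>e x. v t e x - v t e x) = h1n (\<lambda>e x. 0 * 0 + 0 * 0)"
    by (rule h1n_cong) simp
  also have "\<dots> \<le> cmod 0 * h1n (\<lambda>e x. 0) + cmod 0 * h1n (\<lambda>e x. 0)"
    by (rule h1n_lincomb_le) (rule H1_const)+
  finally show ?thesis using h1n_nonneg[of "\<lambda>e x. v t e x - v t e x"] by (simp add: \<delta>_def)
qed

lemma continuous_on_of_\<delta>_lipschitz:
  assumes S: "S \<subseteq> I" and f: "\<And>s t. s \<in> S \<Longrightarrow> t \<in> S \<Longrightarrow> \<bar>f s - f t\<bar> \<le> K * \<delta> s t"
  shows "continuous_on S (f :: real \<Rightarrow> real)"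
  unfolding continuous_on_def
proof
  fix t assume t: "t \<in> S"
  have "((\<lambda>s. K * \<delta> s t) \<longlongrightarrow> 0) (at t within S)"
    using tendsto_mult_right_zero[OF tendsto_within_subset[OF \<delta>_tendsto S], of t K] t S by auto
  then have "((\<lambda>s. f s - f t) \<longlongrightarrow> 0) (at t within S)"
    by (rule Lim_null_comparison[rotated]) (use f t in \<open>auto simp: eventually_at_filter\<close>)
  then show "(f \<longlongrightarrow> f t) (at t within S)" by (simp add: LIM_zero_iff)
qed

lemma h1n_lipschitz:
  assumes "s \<in> I" "t \<in> I" shows "\<bar>h1n (v s) - h1n (v t)\<bar> \<le> 1 * \<delta> s t"
  using h1n_le_add_diff[OF v_H1[OF assms(1)] v_H1[OF assms(2)]]
    h1n_le_add_diff[OF v_H1[OF assms(2)] v_H1[OF assms(1)]] \<delta>_commute[OF assms]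
  by (simp add: \<delta>_def)

lemma bounded_on_Icc:
  assumes "b \<in> I"
  obtains M where "M > 0" "\<And>t. t \<in> {0..b} \<Longrightarrow> h1n (v t) \<le> M"
proof -
  have "continuous_on {0..b} (\<lambda>t. h1n (v t))"
    using Icc_subset_I[OF assms]
    by (intro continuous_on_of_\<delta>_lipschitz[where K=1] h1n_lipschitz) auto
  then have "bounded ((\<lambda>t. h1n (v t)) ` {0..b})"
    by (intro compact_imp_bounded compact_continuous_image) auto
  then obtain M where "M > 0" "\<forall>y\<in>(\<lambda>t. h1n (v t)) ` {0..b}. norm y \<le> M"
    using bounded_pos by blast
  then show ?thesis using that[of M] by force
qed

text \<open>The solution is Lipschitz in time with values in the dual of \<open>H\<^sup>1\<close>.\<close>
lemma dual_lipschitz: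
  assumes b: "b \<in> I"
  obtains K where "K > 0"
    "\<And>s t \<phi>. s \<in> {0..b} \<Longrightarrow> t \<in> {0..b} \<Longrightarrow> \<phi> \<in> H1 \<Longrightarrow>
       cmod (ip (v s) \<phi> - ip (v t) \<phi>) \<le> K * h1n \<phi> * \<bar>s - t\<bar>"
proof -
  obtain C where C: "C > 0" "\<And>u e x. u \<in> H1 \<Longrightarrow> e \<in> arcs G \<Longrightarrow> x \<in> {0..l e} \<Longrightarrow> cmod (u e x) \<le> C * h1n u"
    using sobolev by blast
  obtain M where M: "M > 0" "\<And>t. t \<in> {0..b} \<Longrightarrow> h1n (v t) \<le> M" using bounded_on_Icc[OF b] by blast
  have sub: "{0..b} \<subseteq> I" by (rule Icc_subset_I[OF b])
  show ?thesis
  proof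
    show "M + (C * M) ^ 4 * M > 0" using M C by (simp add: add_pos_pos)
    fix s t \<phi> assume st: "s \<in> {0..b}" "t \<in> {0..b}" and \<phi>: "\<phi> \<in> H1"
    show "cmod (ip (v s) \<phi> - ip (v t) \<phi>) \<le> (M + (C * M) ^ 4 * M) * h1n \<phi> * \<bar>s - t\<bar>"
    proof (rule vector_derivative_bound_Icc[OF _ _ st])
      fix r assume r: "r \<in> {0..b}"
      then show "((\<lambda>s. ip (v s) \<phi>) has_vector_derivative rhs r \<phi>) (at r within {0..b})"
        using sub by (intro has_vector_derivative_within_subset[OF weak_derivative[OF \<phi>]]) auto
      show "cmod (rhs r \<phi>) \<le> (M + (C * M) ^ 4 * M) * h1n \<phi>"
        using weak_rhs_bound[OF C _ M(2)[OF r] \<phi>] v_H1 r sub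
        by (auto simp: rhs_def norm_mult)
    qed
  qed
qed

text \<open>
  The dual estimate, tested with the increment itself. It makes \<open>\<parallel>v(s) - v(t)\<parallel>\<^sub>2\<^sup>2\<close> an \<open>o(\<bar>s - t\<bar>)\<close>, which
  is what allows quadratic expressions in \<open>v\<close> to be differentiated.
\<close>
lemma sqn_increment_bound:
  assumes b: "b \<in> I"
  obtains K where "K > 0"
    "\<And>s t. s \<in> {0..b} \<Longrightarrow> t \<in> {0..b} \<Longrightarrow> sqn (\<lambda>e x. v s e x - v t e x) \<le> K * \<delta> s t * \<bar>s - t\<bar>"
proof -
  obtain K where K: "K > 0"
    "\<And>s t \<phi>. s \<in> {0..b} \<Longrightarrow> t \<in> {0..b} \<Longrightarrow> \<phi> \<in> H1 \<Longrightarrow>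
       cmod (ip (v s) \<phi> - ip (v t) \<phi>) \<le> K * h1n \<phi> * \<bar>s - t\<bar>"
    using dual_lipschitz[OF b] by blast
  show ?thesis
  proof (rule that[OF K(1)])
    fix s t assume st: "s \<in> {0..b}" "t \<in> {0..b}"
    let ?w = "\<lambda>e x. v s e x - v t e x"
    have H: "v s \<in> H1" "v t \<in> H1" using st Icc_subset_I[OF b] by (auto intro: v_H1)
    have w: "?w \<in> H1" by (intro H1_diff H)
    have "complex_of_real (sqn ?w) = ip (v s) ?w - ip (v t) ?w"
      unfolding ip_self[symmetric] by (intro ip_diff_left H1D(1) H w)
    then have "sqn ?w = cmod (ip (v s) ?w - ip (v t) ?w)"
      by (metis abs_of_nonneg norm_of_real sqn_nonneg)
    also have "\<dots> \<le> K * \<delta> s t * \<bar>s - t\<bar>" unfolding \<delta>_def by (rule K(2)[OF st w])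
    finally show "sqn ?w \<le> K * \<delta> s t * \<bar>s - t\<bar>" .
  qed
qed

text \<open>The derivative of the mass is \<open>2 Re \<langle>v\<^sub>t, v\<rangle>\<close>, and \<open>\<i> \<langle>v\<^sub>t, v\<rangle> = \<parallel>v'\<parallel>\<^sub>2\<^sup>2 - \<parallel>v\<parallel>\<^sub>6\<^sup>6\<close> is real.\<close>
theorem mass_conservation:
  assumes b: "b \<in> I"
  shows "sqn (v b) = sqn (v 0)"
proof -
  have sub: "{0..b} \<subseteq> I" by (rule Icc_subset_I[OF b])
  have b0: "0 \<le> b" using b by (simp add: time_interval_def)
  obtain K where K: "K > 0"
    "\<And>s t. s \<in> {0..b} \<Longrightarrow> t \<in> {0..b} \<Longrightarrow> sqn (\<lambda>e x. v s e x - v t e x) \<le> K * \<delta> s t * \<bar>s - t\<bar>"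
    using sqn_increment_bound[OF b] by blast
  have "((\<lambda>s. sqn (v s)) has_vector_derivative 0) (at t within {0..b})" if t: "t \<in> {0..b}" for t
  proof -
    have tI: "t \<in> I" and Ht: "v t \<in> H1" using t sub v_H1 by auto
    let ?w = "\<lambda>s e x. v s e x - v t e x"
    have eq: "sqn (v s) = 2 * Re (ip (v s) (v t)) + (sqn (?w s) - sqn (v t))" if s: "s \<in> {0..b}" for s
      using sqn_lincomb[OF H1D(1) H1D(1), of "v s" "v t" 1 "-1"] v_H1 s sub Ht by auto
    have 1: "((\<lambda>s. sqn (?w s) - sqn (v t)) has_vector_derivative 0) (at t within {0..b})"
    proof (rule has_vector_derivative_zeroI)
      have "sqn (?w t) = 0" by (simp add: sqn_def gintegral_def)
      then show "norm (sqn (?w s) - sqn (v t) - (sqn (?w t) - sqn (v t))) \<le> \<bar>s - t\<bar> * (K * \<delta> s t)"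
        if "s \<in> {0..b}" for s
        using K(2)[OF that t] sqn_nonneg[of "?w s"] by (simp add: mult.commute)
      show "((\<lambda>s. K * \<delta> s t) \<longlongrightarrow> 0) (at t within {0..b})"
        using tendsto_mult_right_zero[OF tendsto_within_subset[OF \<delta>_tendsto[OF tI] sub], of K] .
    qed
    have "((\<lambda>s. ip (v s) (v t)) has_vector_derivative rhs t (v t)) (at t within {0..b})"
      by (rule has_vector_derivative_within_subset[OF weak_derivative[OF Ht tI] sub])
    then have "((\<lambda>s. Re (ip (v s) (v t))) has_vector_derivative Re (rhs t (v t))) (at t within {0..b})"
      by (rule bounded_linear.has_vector_derivative[OF bounded_linear_Re])
    moreover have "Re (rhs t (v t)) = 0"
      by (simp add: rhs_def ip_self ip_nonlin_self)
    ultimately have "((\<lambda>s. Re (ip (v s) (v t))) has_vector_derivative 0) (at t within {0..b})" by simp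
    from has_vector_derivative_add[OF has_vector_derivative_mult_right[OF this, of 2] 1]
    have "((\<lambda>s. 2 * Re (ip (v s) (v t)) + (sqn (?w s) - sqn (v t))) has_vector_derivative 0) (at t within {0..b})"
      by simp
    then show ?thesis
      by (rule has_vector_derivative_transform[OF t, rotated]) (rule eq)
  qed
  then have "\<exists>c. \<forall>x\<in>{0..b}. sqn (v x) = c"
    using has_vector_derivative_zero_constant[of "{0..b}" "\<lambda>s. sqn (v s)"] by (metis convex_real_interval(5))
  then show ?thesis using b0 by (metis atLeastAtMost_iff order_refl)
qed

text \<open>
  Uniform continuity of the solution on compact time intervals, obtained from that of the real function
  \<open>\<delta>\<close> on a square.
\<close>
lemma \<delta>_uniform:
  assumes b: "b \<in> I" and "\<epsilon> > 0"
  obtains \<eta> where "\<eta> > 0" "\<And>s t. s \<in> {0..b} \<Longrightarrow> t \<in> {0..b} \<Longrightarrow> \<bar>s - t\<bar> < \<eta> \<Longrightarrow> \<delta> s t < \<epsilon>"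
proof -
  have sub: "{0..b} \<subseteq> I" by (rule Icc_subset_I[OF b])
  have "continuous_on ({0..b} \<times> {0..b}) (\<lambda>(s, t). \<delta> s t)"
    unfolding continuous_on_def
  proof safe
    fix s t assume st: "s \<in> {0..b}" "t \<in> {0..b}"
    then have stI: "s \<in> I" "t \<in> I" using sub by auto
    let ?F = "at (s, t) within {0..b} \<times> {0..b}"
    have c1: "((\<lambda>r. \<delta> r t) \<longlongrightarrow> 0) (at t within {0..b})" "((\<lambda>r. \<delta> r s) \<longlongrightarrow> 0) (at s within {0..b})"
      using tendsto_within_subset[OF \<delta>_tendsto sub] stI by auto
    have z: "continuous (at r within {0..b}) (\<lambda>q. \<delta> q r)" if "r \<in> I" for r
      using tendsto_within_subset[OF \<delta>_tendsto[OF that] sub] by (simp add: continuous_within \<delta>_self)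
    have "((\<lambda>p. \<delta> (fst p) s) \<longlongrightarrow> 0) ?F" "((\<lambda>p. \<delta> (snd p) t) \<longlongrightarrow> 0) ?F"
    proof -
      have f: "continuous ?F fst" "continuous ?F snd" by (intro continuous_intros)+
      have "continuous ?F (\<lambda>p. \<delta> (fst p) s)"
        by (rule continuous_within_compose2[where s="{0..b} \<times> {0..b}" and f=fst and g="\<lambda>q. \<delta> q s" and x="(s,t)", OF f(1)])
          (use z[OF stI(1)] st in \<open>auto intro: continuous_within_subset\<close>)
      then show "((\<lambda>p. \<delta> (fst p) s) \<longlongrightarrow> 0) ?F" by (simp add: continuous_within \<delta>_self)
      have "continuous ?F (\<lambda>p. \<delta> (snd p) t)"
        by (rule continuous_within_compose2[where s="{0..b} \<times> {0..b}" and f=snd and g="\<lambda>q. \<delta> q t" and x="(s,t)", OF f(2)])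
          (use z[OF stI(2)] st in \<open>auto intro: continuous_within_subset\<close>)
      then show "((\<lambda>p. \<delta> (snd p) t) \<longlongrightarrow> 0) ?F" by (simp add: continuous_within \<delta>_self)
    qed
    from tendsto_add_zero[OF this]
    have "((\<lambda>p. \<delta> (fst p) (snd p) - \<delta> s t) \<longlongrightarrow> 0) ?F"
    proof (rule Lim_null_comparison[rotated])
      show "\<forall>\<^sub>F p in ?F. norm (\<delta> (fst p) (snd p) - \<delta> s t) \<le> \<delta> (fst p) s + \<delta> (snd p) t"
        unfolding eventually_at_filter
      proof (intro always_eventually allI impI)
        fix p assume "p \<in> {0..b} \<times> {0..b}"
        then have p: "fst p \<in> I" "snd p \<in> I" using sub by auto
        show "norm (\<delta> (fst p) (snd p) - \<delta> s t) \<le> \<delta> (fst p) s + \<delta> (snd p) t"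
          using \<delta>_triangle[OF p(1) stI(1) p(2)] \<delta>_triangle[OF stI p(2)]
            \<delta>_triangle[OF stI(1) p(1) stI(2)] \<delta>_triangle[OF p stI(2)]
            \<delta>_commute[OF p(1) stI(1)] \<delta>_commute[OF p(2) stI(2)] by simp
      qed
    qed
    then show "((\<lambda>(s, t). \<delta> s t) \<longlongrightarrow> \<delta> s t) ?F"
      unfolding case_prod_beta' by (rule LIM_zero_cancel)
  qed
  then have "uniformly_continuous_on ({0..b} \<times> {0..b}) (\<lambda>(s, t). \<delta> s t)"
    by (intro compact_uniformly_continuous compact_Times) auto
  then obtain \<eta> where \<eta>: "\<eta> > 0"
    "\<And>p q. p \<in> {0..b} \<times> {0..b} \<Longrightarrow> q \<in> {0..b} \<times> {0..b} \<Longrightarrow> dist q p < \<eta> \<Longrightarrow>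
       dist (case q of (s, t) \<Rightarrow> \<delta> s t) (case p of (s, t) \<Rightarrow> \<delta> s t) < \<epsilon>"
    using \<open>\<epsilon> > 0\<close> unfolding uniformly_continuous_on_def by metis
  show ?thesis
  proof (rule that[OF \<eta>(1)])
    fix s t assume "s \<in> {0..b}" "t \<in> {0..b}" "\<bar>s - t\<bar> < \<eta>"
    then show "\<delta> s t < \<epsilon>"
      using \<eta>(2)[of "(t, t)" "(s, t)"] \<delta>_nonneg[of s t] by (simp add: \<delta>_self dist_Pair_Pair dist_real_def)
  qed
qed

end

context nls_curve begin

text \<open>The correlation of the solution with its translate in time by \<open>h\<close>.\<close>
definition corr :: "real \<Rightarrow> real \<Rightarrow> complex" where
  "corr h t = ip (v (t + h)) (v t)"

lemma corr_derivative:
  assumes h: "0 \<le> h" and bh: "b + h \<in> I" and t: "t \<in> {0..b}"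
  shows "(corr h has_vector_derivative rhs (t + h) (v t) + cnj (rhs t (v (t + h)))) (at t within {0..b})"
proof -
  have b0: "0 \<le> b" using t by simp
  have sub': "{0..b + h} \<subseteq> I" by (rule Icc_subset_I[OF bh])
  have sub: "{0..b} \<subseteq> I" using sub' h by auto
  have H: "v s \<in> H1" "v (s + h) \<in> H1" if "s \<in> {0..b}" for s
    using that h sub' by (auto intro!: v_H1)
  have tI: "t \<in> I" "t + h \<in> I" using t h sub' by auto
  obtain K where K: "K > 0"
    "\<And>s t. s \<in> {0..b + h} \<Longrightarrow> t \<in> {0..b + h} \<Longrightarrow> sqn (\<lambda>e x. v s e x - v t e x) \<le> K * \<delta> s t * \<bar>s - t\<bar>"
    using sqn_increment_bound[OF bh] by blast
  let ?w = "\<lambda>s e x. v s e x - v t e x" and ?wh = "\<lambda>s e x. v (s + h) e x - v (t + h) e x"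
  have eq: "corr h s = (ip (v (s + h)) (v t) + cnj (ip (v s) (v (t + h)))) + (ip (?wh s) (?w s) - corr h t)"
    if s: "s \<in> {0..b}" for s
  proof -
    have "ip (?wh s) (?w s) = ip (v (s + h)) (v s) - ip (v (s + h)) (v t) - ip (v (t + h)) (v s) + ip (v (t + h)) (v t)"
      using ip_diff_left[OF H1D(1)[OF H(2)[OF s]] H1D(1)[OF H(2)[OF t]] H1D(1)[OF H1_diff[OF H(1)[OF s] H(1)[OF t]]]]
        ip_diff_right[OF H1D(1)[OF H(1)[OF s]] H1D(1)[OF H(1)[OF t]] H1D(1)[OF H(2)[OF s]]]
        ip_diff_right[OF H1D(1)[OF H(1)[OF s]] H1D(1)[OF H(1)[OF t]] H1D(1)[OF H(2)[OF t]]]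
      by simp
    then show ?thesis by (simp add: corr_def ip_cnj[of "v (t + h)" "v s"])
  qed
  have shift: "((\<lambda>s. \<delta> (s + h) (t + h)) \<longlongrightarrow> 0) (at t within {0..b})"
  proof -
    have "filterlim (\<lambda>s. s + h) (at (t + h) within I) (at t within {0..b})"
      unfolding filterlim_at eventually_at_filter
      using sub' h by (intro conjI tendsto_intros always_eventually) auto
    from filterlim_compose[OF \<delta>_tendsto[OF tI(2)] this] show ?thesis .
  qed
  have 1: "((\<lambda>s. ip (?wh s) (?w s) - corr h t) has_vector_derivative 0) (at t within {0..b})"
  proof (rule has_vector_derivative_zeroI)
    have "?w t = (\<lambda>e x. 0)" by simp
    then have z: "ip (?wh t) (?w t) = 0" by (simp add: ginner_def gintegral_def)
    show "norm (ip (?wh s) (?w s) - corr h t - (ip (?wh t) (?w t) - corr h t))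
       \<le> \<bar>s - t\<bar> * (K * (\<delta> (s + h) (t + h) + \<delta> s t) / 2)" if s: "s \<in> {0..b}" for s
    proof -
      have "norm (ip (?wh s) (?w s)) \<le> nrm (?wh s) * nrm (?w s)"
        by (intro ip_norm_le H1D(1) H1_diff H s t)
      also have "\<dots> \<le> (sqn (?wh s) + sqn (?w s)) / 2"
        using sum_squares_bound[of "nrm (?wh s)" "nrm (?w s)"] by (simp add: nrm_sq)
      also have "\<dots> \<le> (K * \<delta> (s + h) (t + h) * \<bar>s - t\<bar> + K * \<delta> s t * \<bar>s - t\<bar>) / 2"
        using K(2)[of "s + h" "t + h"] K(2)[of s t] s t h by simp
      finally show ?thesis using z by (simp add: algebra_simps add_divide_distrib)
    qed
    have "((\<lambda>s. K * (\<delta> (s + h) (t + h) + \<delta> s t)) \<longlongrightarrow> 0) (at t within {0..b})"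
      by (intro tendsto_mult_right_zero tendsto_add_zero shift tendsto_within_subset[OF \<delta>_tendsto[OF tI(1)] sub])
    then show "((\<lambda>s. K * (\<delta> (s + h) (t + h) + \<delta> s t) / 2) \<longlongrightarrow> 0) (at t within {0..b})"
      by (rule tendsto_divide_zero)
  qed
  have 2: "((\<lambda>s. ip (v (s + h)) (v t)) has_vector_derivative rhs (t + h) (v t)) (at t within {0..b})"
  proof -
    have "((\<lambda>s. s + h) has_vector_derivative 1) (at t within {0..b})"
      by (auto intro!: derivative_eq_intros)
    moreover have "((\<lambda>s. ip (v s) (v t)) has_vector_derivative rhs (t + h) (v t))
        (at (t + h) within (\<lambda>s. s + h) ` {0..b})"
      using sub' h by (intro has_vector_derivative_within_subset[OF weak_derivative] H(1) t tI) auto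
    ultimately show ?thesis
      using vector_diff_chain_within[of "\<lambda>s. s + h" 1 t "{0..b}" "\<lambda>s. ip (v s) (v t)"]
      by (simp add: o_def)
  qed
  have 3: "((\<lambda>s. cnj (ip (v s) (v (t + h)))) has_vector_derivative cnj (rhs t (v (t + h)))) (at t within {0..b})"
    by (intro bounded_linear.has_vector_derivative[OF bounded_linear_cnj]
        has_vector_derivative_within_subset[OF weak_derivative[OF H(2)[OF t] tI(1)] sub])
  have "((\<lambda>s. (ip (v (s + h)) (v t) + cnj (ip (v s) (v (t + h)))) + (ip (?wh s) (?w s) - corr h t))
      has_vector_derivative (rhs (t + h) (v t) + cnj (rhs t (v (t + h)))) + 0) (at t within {0..b})"
    by (intro has_vector_derivative_add 1 2 3)
  then show ?thesis
    unfolding add_0_right by (rule has_vector_derivative_transform[OF t, rotated]) (rule eq)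
qed

text \<open>In the derivative of the correlation the terms with \<open>v'\<close> cancel.\<close>
lemma Im_corr_derivative:
  "Im (rhs s (v t) + cnj (rhs t (v s))) = Re (ip (nonlin (v s)) (v t)) - Re (ip (nonlin (v t)) (v s))"
  by (simp add: rhs_def ip_cnj[of "D (v t)" "D (v s)"])

text \<open>
  Let \<open>PP\<close> be an antiderivative of the potential energy. By \<open>pot_increment_bound\<close> the function
  \<open>Q h t = Im (corr h t) - 4 (PP (t + h) - PP t)\<close> varies by \<open>o(h)\<close> over \<open>[0, b]\<close>, whereas \<open>Q h t / h\<close> tends to
  \<open>- 2 E(v(t))\<close> as \<open>h\<close> decreases to \<open>0\<close>.
\<close>
theorem energy_conservation:
  assumes b: "b \<in> I"
  shows "energy (v b) = energy (v 0)"
proof -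
  have b0: "0 \<le> b" using b by (simp add: time_interval_def)
  \<comment> \<open>leave room to the right of \<open>b\<close> for the translation in time\<close>
  obtain b' where b': "b < b'" "b' \<in> I" using I_larger[OF b] .
  have sub: "{0..b'} \<subseteq> I" by (rule Icc_subset_I[OF b'(2)])
  obtain C where C: "C > 0" "\<And>u e x. u \<in> H1 \<Longrightarrow> e \<in> arcs G \<Longrightarrow> x \<in> {0..l e} \<Longrightarrow> cmod (u e x) \<le> C * h1n u"
    using sobolev by blast
  obtain M where M: "M > 0" "\<And>t. t \<in> {0..b'} \<Longrightarrow> h1n (v t) \<le> M" using bounded_on_Icc[OF b'(2)] by blast
  obtain K where K: "K > 0"
    "\<And>s t. s \<in> {0..b'} \<Longrightarrow> t \<in> {0..b'} \<Longrightarrow> sqn (\<lambda>e x. v s e x - v t e x) \<le> K * \<delta> s t * \<bar>s - t\<bar>"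
    using sqn_increment_bound[OF b'(2)] by blast
  define R where "R = C * M"
  have R: "0 < R" using C(1) M(1) by (simp add: R_def)
  have H: "v t \<in> H1" if "t \<in> {0..b'}" for t using that sub by (auto intro: v_H1)
  have vR: "cmod (v t e x) \<le> R" if "t \<in> {0..b'}" "e \<in> arcs G" "x \<in> {0..l e}" for t e x
    using order_trans[OF C(2)[OF H[OF that(1)] that(2,3)]] mult_left_mono[OF M(2)[OF that(1)], of C] C(1)
    by (simp add: R_def)
  have v\<delta>: "cmod (v s e x - v t e x) \<le> C * \<delta> s t" if "s \<in> {0..b'}" "t \<in> {0..b'}" "e \<in> arcs G" "x \<in> {0..l e}" for s t e x
    using C(2)[OF H1_diff[OF H[OF that(1)] H[OF that(2)]] that(3,4)] by (simp add: \<delta>_def)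
  have "continuous_on {0..b'} (\<lambda>t. pot (v t))"
  proof (rule continuous_on_of_\<delta>_lipschitz[OF sub])
    fix s t assume st: "s \<in> {0..b'}" "t \<in> {0..b'}"
    show "\<bar>pot (v s) - pot (v t)\<bar> \<le> (R ^ 5 * total_length G l * C) * \<delta> s t"
      using pot_lipschitz[OF H[OF st(2)] H[OF st(1)] vR[OF st(2)] vR[OF st(1)] v\<delta>[OF st]]
      by (simp add: mult_ac)
  qed
  then obtain PP where PP: "\<And>t. t \<in> {0..b'} \<Longrightarrow> (PP has_vector_derivative pot (v t)) (at t within {0..b'})"
    using antiderivative_continuous by blast
  define Q where "Q h t = Im (corr h t) - 4 * (PP (t + h) - PP t)" for h t
  have bound: "\<bar>Q h b - Q h 0\<bar> \<le> (4 * R ^ 3 * (C * \<epsilon>) * (K * \<epsilon> * h)) * b"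
    if h: "0 < h" "h < b' - b" and \<epsilon>: "0 \<le> \<epsilon>" "\<And>t. t \<in> {0..b} \<Longrightarrow> \<delta> (t + h) t \<le> \<epsilon>" for h \<epsilon>
  proof -
    let ?Q' = "\<lambda>t. Im (rhs (t + h) (v t) + cnj (rhs t (v (t + h)))) - 4 * (pot (v (t + h)) - pot (v t))"
    have bh: "b + h \<in> I" using h b0 sub by auto
    have "norm (Q h b - Q h 0) \<le> (4 * R ^ 3 * (C * \<epsilon>) * (K * \<epsilon> * h)) * \<bar>b - 0\<bar>"
    proof (rule vector_derivative_bound_Icc[where f'="?Q'" and a=0 and b=b])
      fix t assume t: "t \<in> {0..b}"
      then have t': "t \<in> {0..b'}" "t + h \<in> {0..b'}" using h by auto
      have 1: "((\<lambda>t. Im (corr h t)) has_vector_derivative Im (rhs (t + h) (v t) + cnj (rhs t (v (t + h))))) (at t within {0..b})"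
        using h by (intro bounded_linear.has_vector_derivative[OF bounded_linear_Im] corr_derivative bh t) simp
      have 2: "((\<lambda>t. PP (t + h)) has_vector_derivative pot (v (t + h))) (at t within {0..b})"
      proof -
        have "((\<lambda>s. s + h) has_vector_derivative 1) (at t within {0..b})"
          by (auto intro!: derivative_eq_intros)
        moreover have "(PP has_vector_derivative pot (v (t + h))) (at (t + h) within (\<lambda>s. s + h) ` {0..b})"
          using h by (intro has_vector_derivative_within_subset[OF PP[OF t'(2)]]) auto
        ultimately show ?thesis
          using vector_diff_chain_within[of "\<lambda>s. s + h" 1 t "{0..b}" PP] by (simp add: o_def)
      qed
      have 3: "(PP has_vector_derivative pot (v t)) (at t within {0..b})"
        using b' by (intro has_vector_derivative_within_subset[OF PP[OF t'(1)]]) auto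
      show "(Q h has_vector_derivative ?Q' t) (at t within {0..b})"
        unfolding Q_def[abs_def]
        by (intro has_vector_derivative_diff has_vector_derivative_mult_right 1 2 3)
      have "norm (?Q' t) \<le> 4 * R ^ 3 * (C * \<delta> (t + h) t) * sqn (\<lambda>e x. v (t + h) e x - v t e x)"
        using pot_increment_bound[OF H[OF t'(1)] H[OF t'(2)] vR[OF t'(1)] vR[OF t'(2)] v\<delta>[OF t'(2,1)]]
        by (simp only: Im_corr_derivative real_norm_def)
      also have "\<dots> \<le> 4 * R ^ 3 * (C * \<delta> (t + h) t) * (K * \<delta> (t + h) t * h)"
        using K(2)[OF t'(2,1)] h R C(1) \<delta>_nonneg by (intro mult_left_mono) auto
      also have "\<dots> \<le> 4 * R ^ 3 * (C * \<epsilon>) * (K * \<epsilon> * h)"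
        using \<epsilon>(2)[OF t] \<delta>_nonneg[of "t + h" t] h R C(1) K(1) \<epsilon>(1) by (intro mult_mono) auto
      finally show "norm (?Q' t) \<le> 4 * R ^ 3 * (C * \<epsilon>) * (K * \<epsilon> * h)" .
    qed (use b0 in auto)
    then show ?thesis using b0 by simp
  qed
  have lim: "((\<lambda>h. Q h t / h) \<longlongrightarrow> - 2 * energy (v t)) (at_right 0)" if t: "t \<in> {0..b}" for t
  proof -
    have tI: "t \<in> I" and t': "t \<in> {0..b'}" and tb: "t < b'" "{t..b'} \<subseteq> {0..b'}" using t b' sub by auto
    have "((\<lambda>h. (ip (v (t + h)) (v t) - ip (v t) (v t)) /\<^sub>R h) \<longlongrightarrow> rhs t (v t)) (at_right 0)"
      by (rule has_vector_derivative_right_quotient[OF weak_derivative[OF H[OF t'] tI] _ tb(1)])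
        (use sub tb in auto)
    then have "((\<lambda>h. Im ((ip (v (t + h)) (v t) - ip (v t) (v t)) /\<^sub>R h)) \<longlongrightarrow> Im (rhs t (v t))) (at_right 0)"
      by (rule tendsto_Im)
    then have "((\<lambda>h. Im (corr h t) / h) \<longlongrightarrow> Im (rhs t (v t))) (at_right 0)"
      by (simp add: corr_def ip_self divide_inverse mult.commute)
    moreover have "((\<lambda>h. (PP (t + h) - PP t) /\<^sub>R h) \<longlongrightarrow> pot (v t)) (at_right 0)"
      by (rule has_vector_derivative_right_quotient[OF PP[OF t'] tb(2,1)])
    ultimately have "((\<lambda>h. Im (corr h t) / h - 4 * ((PP (t + h) - PP t) /\<^sub>R h)) \<longlongrightarrow> Im (rhs t (v t)) - 4 * pot (v t)) (at_right 0)"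
      by (intro tendsto_intros)
    moreover have "Im (rhs t (v t)) - 4 * pot (v t) = - 2 * energy (v t)"
      by (simp add: rhs_def ip_self ip_nonlin_self energy_def)
    moreover have "Im (corr h t) / h - 4 * ((PP (t + h) - PP t) /\<^sub>R h) = Q h t / h" for h
      by (simp add: Q_def diff_divide_distrib divide_inverse algebra_simps)
    ultimately show ?thesis by simp
  qed
  have "((\<lambda>h. Q h b / h - Q h 0 / h) \<longlongrightarrow> - 2 * energy (v b) - - 2 * energy (v 0)) (at_right 0)"
    using b0 by (intro tendsto_diff lim) auto
  moreover have "((\<lambda>h. Q h b / h - Q h 0 / h) \<longlongrightarrow> 0) (at_right 0)"
    unfolding tendsto_iff
  proof (intro allI impI)
    fix r :: real assume r: "r > 0"
    let ?c = "4 * R ^ 3 * C * K * b"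
    have c0: "?c \<ge> 0" using R C(1) K(1) b0 by simp
    \<comment> \<open>the bound on \<open>\<bar>Q h b - Q h 0\<bar> / h\<close> is \<open>?c * \<epsilon>\<^sup>2\<close>, which has to be less than \<open>r\<close>\<close>
    define \<epsilon> where "\<epsilon> = sqrt (r / (?c + 1))"
    have c1: "?c + 1 > 0" using c0 by linarith
    have rc: "r / (?c + 1) > 0" using r c1 by (rule divide_pos_pos)
    then have "\<epsilon> > 0" unfolding \<epsilon>_def by (rule real_sqrt_gt_zero)
    moreover have "\<epsilon>\<^sup>2 = r / (?c + 1)"
      unfolding \<epsilon>_def by (rule real_sqrt_pow2) (rule less_imp_le[OF rc])
    then have "\<epsilon>\<^sup>2 * (?c + 1) = r" using c1 by (metis less_irrefl nonzero_eq_divide_eq)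
    ultimately have \<epsilon>: "\<epsilon> > 0" "\<epsilon>\<^sup>2 * (?c + 1) = r" by auto
    obtain \<eta> where \<eta>: "\<eta> > 0" "\<And>s t. s \<in> {0..b'} \<Longrightarrow> t \<in> {0..b'} \<Longrightarrow> \<bar>s - t\<bar> < \<eta> \<Longrightarrow> \<delta> s t < \<epsilon>"
      using \<delta>_uniform[OF b'(2) \<epsilon>(1)] by blast
    have "eventually (\<lambda>h. h \<in> {0<..<min \<eta> (b' - b)}) (at_right 0)"
      using \<eta>(1) b'(1) by (intro eventually_at_rightI[of 0 "min \<eta> (b' - b)"]) auto
    then show "\<forall>\<^sub>F h in at_right 0. dist (Q h b / h - Q h 0 / h) 0 < r"
    proof eventually_elim
      case (elim h)
      then have h: "0 < h" "h < b' - b" "h < \<eta>" by auto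
      have "\<delta> (t + h) t \<le> \<epsilon>" if "t \<in> {0..b}" for t
        using \<eta>(2)[of "t + h" t] that h by simp
      from bound[OF h(1,2) _ this] \<epsilon>(1)
      have "\<bar>Q h b - Q h 0\<bar> \<le> (\<epsilon>\<^sup>2 * ?c) * h" by (simp add: power2_eq_square mult_ac)
      then have "\<bar>Q h b - Q h 0\<bar> / h \<le> \<epsilon>\<^sup>2 * ?c" using h(1) by (simp add: divide_le_eq)
      also have "\<dots> < r" using \<epsilon> by (simp add: distrib_left flip: \<epsilon>(2))
      finally show ?case using h(1) by (simp add: dist_real_def flip: diff_divide_distrib)
    qed
  qed
  ultimately have "- 2 * energy (v b) - - 2 * energy (v 0) = 0"
    by (rule tendsto_unique[rotated]) simp
  then show ?thesis by simp
qed

end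

section \<open>The distance to the orbit of a constant\<close>

context metric_graph begin

lemma ip_one: "ip u (\<lambda>e x. 1) = gintegral G l u"
  by (simp add: ginner_def)

lemma sqn_const: "sqn (\<lambda>e x. k) = (cmod k)\<^sup>2 * total_length G l"
  by (simp add: sqn_def gintegral_const_real)

lemma sqn_minus_const:
  assumes "gL2 u"
  shows "sqn (\<lambda>e x. u e x - k) = sqn u + (cmod k)\<^sup>2 * total_length G l - 2 * Re (cnj k * gintegral G l u)"
  using sqn_lincomb[OF assms gL2_const[of 1], of 1 "-k"] by (simp add: ip_one sqn_const)

lemma gintegral_minus_const:
  "gL2 u \<Longrightarrow> gintegral G l (\<lambda>e x. u e x - k) = gintegral G l u - k * total_length G l"
  by (simp add: gintegral_diff gintegrable_gL2 gL2_const gintegral_const)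

text \<open>
  The Poincare inequality, without a sign condition on \<^const>\<open>lambda2\<close>: subtract the mean of \<open>u\<close> and use that an
  infimum of nonnegative quotients is a lower bound. If \<open>u\<close> minus its mean has norm \<open>0\<close> the claim is trivial.
\<close>
lemma poincare:
  assumes u: "u \<in> H1"
  shows "lambda2 G l * (sqn u - (cmod (gintegral G l u))\<^sup>2 / total_length G l) \<le> sqn (D u)"
proof -
  let ?L = "total_length G l"
  let ?S = "{gintegral G l (\<lambda>e x. (cmod (D \<phi> e x))\<^sup>2) / gintegral G l (\<lambda>e x. (cmod (\<phi> e x))\<^sup>2) | \<phi>.
        \<phi> \<in> H1 \<and> (\<exists>e\<in>arcs G. \<exists>x\<in>{0..l e}. \<phi> e x \<noteq> 0) \<and> gintegral G l \<phi> = 0}"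
  define m where "m = gintegral G l u / ?L"
  define \<phi> where "\<phi> = (\<lambda>e x. u e x - m)"
  have L: "?L > 0" by (rule total_length_pos)
  have m: "gintegral G l u = m * ?L" using L by (simp add: m_def)
  have \<phi>: "\<phi> \<in> H1" unfolding \<phi>_def by (intro H1_diff u H1_const)
  have \<phi>0: "gintegral G l \<phi> = 0"
    unfolding \<phi>_def gintegral_minus_const[OF H1D(1)[OF u]] m by simp
  have "Re (cnj m * (m * ?L)) = (cmod m)\<^sup>2 * ?L"
  proof -
    have "cnj m * (m * ?L) = complex_of_real ((cmod m)\<^sup>2 * ?L)"
      unfolding of_real_mult complex_norm_square by (simp add: mult_ac)
    then show ?thesis by (metis Re_complex_of_real)
  qed
  then have "sqn \<phi> = sqn u - (cmod m)\<^sup>2 * ?L"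
    unfolding \<phi>_def sqn_minus_const[OF H1D(1)[OF u]] m by simp
  also have "(cmod m)\<^sup>2 * ?L = (cmod (gintegral G l u))\<^sup>2 / ?L"
    using L by (simp add: m_def norm_divide power_divide power2_eq_square)
  finally have sq: "sqn \<phi> = sqn u - (cmod (gintegral G l u))\<^sup>2 / ?L" .
  have D: "sqn (D \<phi>) = sqn (D u)"
    using nrm_D_minus_const[OF u, of m] by (simp add: \<phi>_def flip: nrm_sq)
  show ?thesis
  proof (cases "sqn \<phi> = 0")
    case True
    then show ?thesis using sq sqn_nonneg[of "D u"] by simp
  next
    case False
    have "\<exists>e\<in>arcs G. \<exists>x\<in>{0..l e}. \<phi> e x \<noteq> 0"
    proof (rule ccontr)
      assume "\<not> ?thesis"
      then have "sqn \<phi> = gintegral G l (\<lambda>e x. 0 :: real)"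
        unfolding sqn_def by (intro gintegral_cong) auto
      then show False using False by (simp add: gintegral_def)
    qed
    then have "sqn (D \<phi>) / sqn \<phi> \<in> ?S" using \<phi> \<phi>0 unfolding sqn_def by blast
    moreover have "bdd_below ?S"
      by (intro bdd_belowI[of _ 0]) (auto intro!: divide_nonneg_nonneg gintegral_nonneg)
    ultimately have "lambda2 G l \<le> sqn (D \<phi>) / sqn \<phi>"
      unfolding lambda2_def by (rule cInf_lower)
    then show ?thesis using False sqn_nonneg[of \<phi>] sq D by (simp add: pos_le_divide_eq)
  qed
qed

text \<open>The constant function with value \<open>c\<close>.\<close>
definition cst :: "real \<Rightarrow> 'e gfun" where "cst c = (\<lambda>e x. of_real c)"

text \<open>The \<open>H\<^sup>1\<close> distance of \<open>u\<close> to the orbit of the constant \<open>c\<close>.\<close>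
abbreviation od :: "real \<Rightarrow> 'e gfun \<Rightarrow> real" where "od c u \<equiv> orbit_dist G l u (cst c)"

lemma od_bdd: "bdd_below (range (\<lambda>\<theta>. h1n (\<lambda>e x. u e x - cis \<theta> * w e x)))"
  by (intro bdd_belowI[of _ 0]) (auto simp: h1n_nonneg)

lemma od_le: "od c u \<le> h1n (\<lambda>e x. u e x - cis \<theta> * of_real c)"
  unfolding orbit_dist_def cst_def by (intro cINF_lower[OF od_bdd]) simp

lemma od_nonneg: "0 \<le> od c u"
  unfolding orbit_dist_def by (intro cINF_greatest) (auto simp: h1n_nonneg)

lemma od_cong:
  assumes "\<And>e x. e \<in> arcs G \<Longrightarrow> x \<in> {0..l e} \<Longrightarrow> u e x = w e x"
  shows "od c u = od c w"
proof -
  have "h1n (\<lambda>e x. u e x - cis \<theta> * cst c e x) = h1n (\<lambda>e x. w e x - cis \<theta> * cst c e x)" for \<theta>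
    by (rule h1n_cong) (simp add: assms)
  then show ?thesis by (simp add: orbit_dist_def)
qed

text \<open>
  The derivative part of the distance does not depend on the phase, so the minimum is attained where the
  \<open>L\<^sup>2\<close> distance is least: when the phase is that of the integral of \<open>u\<close>.
\<close>
lemma od_attained:
  assumes u: "u \<in> H1" and c: "0 < c"
  obtains \<theta> where "od c u = h1n (\<lambda>e x. u e x - cis \<theta> * of_real c)"
    "Im (cnj (cis \<theta> * of_real c) * gintegral G l u) = 0"
proof -
  let ?J = "gintegral G l u"
  define \<theta> where "\<theta> = Arg ?J"
  have J: "?J = of_real (cmod ?J) * cis \<theta>"
    using rcis_cmod_Arg[of ?J] by (simp add: rcis_def \<theta>_def)
  have "cnj (cis \<theta> * of_real c) * ?J = of_real (c * cmod ?J) * (cis (-\<theta>) * cis \<theta>)"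
    by (subst J) (simp add: cis_cnj mult_ac)
  then have al: "cnj (cis \<theta> * of_real c) * ?J = of_real (c * cmod ?J)" by (simp add: cis_mult)
  have h: "h1n (\<lambda>e x. u e x - cis \<theta>' * of_real c) = nrm (D u) +
     sqrt (sqn u + c\<^sup>2 * total_length G l - 2 * Re (cnj (cis \<theta>' * of_real c) * ?J))" for \<theta>'
    unfolding h1n_eq nrm_D_minus_const[OF u] nrm_eq[of "\<lambda>e x. u e x - _"] sqn_minus_const[OF H1D(1)[OF u]]
    by (simp add: norm_mult)
  have "h1n (\<lambda>e x. u e x - cis \<theta> * of_real c) \<le> h1n (\<lambda>e x. u e x - cis \<theta>' * of_real c)" for \<theta>'
  proof -
    have "Re (cnj (cis \<theta>' * of_real c) * ?J) \<le> cmod (cnj (cis \<theta>' * of_real c) * ?J)"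
      by (rule complex_Re_le_cmod)
    also have "\<dots> = c * cmod ?J" using c by (simp add: norm_mult)
    finally show ?thesis unfolding h al by simp
  qed
  then have "h1n (\<lambda>e x. u e x - cis \<theta> * of_real c) \<le> od c u"
    unfolding orbit_dist_def cst_def by (intro cINF_greatest) auto
  then have "od c u = h1n (\<lambda>e x. u e x - cis \<theta> * of_real c)"
    using od_le by (intro antisym)
  moreover have "Im (cnj (cis \<theta> * of_real c) * ?J) = 0" unfolding al by simp
  ultimately show ?thesis by (rule that)
qed

lemma od_lipschitz:
  assumes "u \<in> H1" "w \<in> H1" and c: "0 < c"
  shows "od c u \<le> od c w + h1n (\<lambda>e x. u e x - w e x)"
proof -
  obtain \<theta> where \<theta>: "od c w = h1n (\<lambda>e x. w e x - cis \<theta> * of_real c)"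
    using od_attained[OF assms(2) c] by blast
  show ?thesis
    using od_le[of u c \<theta>] h1n_diff_triangle[OF assms(1,2) H1_const[of "cis \<theta> * of_real c"]]
    by (simp add: \<theta>)
qed

text \<open>The mass of \<open>u\<close> minus that of the constant \<open>c\<close>.\<close>
definition excess_mass :: "real \<Rightarrow> 'e gfun \<Rightarrow> real" where
  "excess_mass c u = sqn u - c\<^sup>2 * total_length G l"

text \<open>
  The energy of \<open>u\<close> minus that of the constant \<open>c\<close>, which is \<open>- c\<^sup>6 L / 6\<close>, plus half the excess mass times the
  Lagrange multiplier \<open>c\<^sup>4\<close>. The last term cancels the first order part.
\<close>
definition excess_energy :: "real \<Rightarrow> 'e gfun \<Rightarrow> real" where
  "excess_energy c u = energy u + c ^ 6 * total_length G l / 6 + c ^ 4 * excess_mass c u / 2"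

text \<open>
  The exact expansion of mass and energy around the constant \<open>k\<close>. Here \<open>Q2\<close> and \<open>Q3\<close> are the integrals of
  \<open>q\<^sup>2\<close> and \<open>q\<^sup>3\<close> for \<open>q = \<bar>u\<bar>\<^sup>2 - c\<^sup>2\<close>, and \<open>\<rho>\<close> bounds \<open>u - k\<close> uniformly.
\<close>
lemma excess_expansion:
  assumes u: "u \<in> H1" and k: "cmod k = c"
    and \<rho>: "\<And>e x. e \<in> arcs G \<Longrightarrow> x \<in> {0..l e} \<Longrightarrow> cmod (u e x - k) \<le> \<rho>"
  defines "z \<equiv> \<lambda>e x. u e x - k"
  obtains Q2 Q3 where
    "excess_mass c u = 2 * Re (cnj k * gintegral G l z) + sqn z"
    "excess_energy c u = sqn (D u) / 2 - c\<^sup>2 / 2 * Q2 - Q3 / 6"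
    "0 \<le> Q2" "Q2 \<le> (4 * c\<^sup>2 + 4 * c * \<rho> + \<rho>\<^sup>2) * sqn z" "\<bar>Q3\<bar> \<le> (2 * c + \<rho>) ^ 3 * \<rho> * sqn z"
proof -
  let ?L = "total_length G l"
  have c0: "0 \<le> c" using k norm_ge_zero by metis
  obtain e0 where "e0 \<in> arcs G" using edges_nonempty by auto
  then have \<rho>0: "0 \<le> \<rho>" using \<rho>[of e0 0] length_pos[of e0] by (auto intro: order_trans[OF norm_ge_zero])
  define q where "q = (\<lambda>e x. (cmod (u e x))\<^sup>2 - c\<^sup>2)"
  have q_eq: "q e x = 2 * Re (cnj k * z e x) + (cmod (z e x))\<^sup>2" for e x
  proof -
    have u_eq: "u e x = k + z e x" by (simp add: z_def)
    show ?thesis unfolding q_def u_eq k[symmetric] cmod_power2 by (simp add: power2_eq_square algebra_simps)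
  qed
  have uc: "\<And>e. e \<in> arcs G \<Longrightarrow> continuous_on {0..l e} (u e)" by (rule H1D(3)[OF u])
  have z2: "gL2 z" and zc: "\<And>e. e \<in> arcs G \<Longrightarrow> continuous_on {0..l e} (z e)"
    unfolding z_def by (intro H1D H1_diff u H1_const; assumption)+
  have qc: "\<And>e. e \<in> arcs G \<Longrightarrow> continuous_on {0..l e} (q e)"
    unfolding q_def by (intro continuous_intros uc)
  have i: "gintegrable q" "gintegrable (\<lambda>e x. (q e x)\<^sup>2)" "gintegrable (\<lambda>e x. (q e x) ^ 3)"
    "gintegrable (\<lambda>e x. \<bar>q e x\<bar> ^ 3)" "gintegrable (\<lambda>e x. c :: real)" for c
    by (intro gintegrable_continuous continuous_intros qc; assumption)+
  define Q2 where "Q2 = gintegral G l (\<lambda>e x. (q e x)\<^sup>2)"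
  define Q3 where "Q3 = gintegral G l (\<lambda>e x. (q e x) ^ 3)"
  have qm: "gintegral G l q = excess_mass c u"
    unfolding q_def excess_mass_def
    by (simp only: gintegral_diff gintegrable_sq[OF H1D(1)[OF u]] i(5) gintegral_const_real sqn_def)
  have "gintegral G l q = gintegral G l (\<lambda>e x. 2 * Re (cnj k * z e x) + (cmod (z e x))\<^sup>2)"
    using q_eq by (intro gintegral_cong)
  also have "\<dots> = 2 * Re (cnj k * gintegral G l z) + sqn z"
    by (simp only: gintegral_add gintegral_mult_right gintegral_Re sqn_def gintegrable_sq[OF z2]
        gintegrable_mult_right gintegrable_continuous[of "\<lambda>e x. Re (cnj k * z e x)"]
        gintegrable_mult_right[OF gintegrable_gL2[OF z2]] continuous_intros zc)
  finally have 1: "excess_mass c u = 2 * Re (cnj k * gintegral G l z) + sqn z" unfolding qm .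
  have "6 * pot u = gintegral G l (\<lambda>e x. c ^ 6 + 3 * c ^ 4 * q e x + 3 * c\<^sup>2 * (q e x)\<^sup>2 + (q e x) ^ 3)"
  proof -
    have "(cmod (u e x)) ^ 6 = c ^ 6 + 3 * c ^ 4 * q e x + 3 * c\<^sup>2 * (q e x)\<^sup>2 + (q e x) ^ 3" for e x
    proof -
      have "(cmod (u e x)) ^ 6 = ((cmod (u e x))\<^sup>2) ^ 3" by (simp flip: power_mult)
      also have "(cmod (u e x))\<^sup>2 = c\<^sup>2 + q e x" by (simp add: q_def)
      also have "(c\<^sup>2 + q e x) ^ 3 = c ^ 6 + 3 * c ^ 4 * q e x + 3 * c\<^sup>2 * (q e x)\<^sup>2 + (q e x) ^ 3"
        by algebra
      finally show ?thesis .
    qed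
    then show ?thesis by (simp add: pot_def)
  qed
  also have "\<dots> = c ^ 6 * ?L + 3 * c ^ 4 * excess_mass c u + 3 * c\<^sup>2 * Q2 + Q3"
    by (simp only: gintegral_add gintegrable_add gintegral_mult_right gintegrable_mult_right i
        gintegral_const_real qm Q2_def Q3_def)
  finally have 2: "excess_energy c u = sqn (D u) / 2 - c\<^sup>2 / 2 * Q2 - Q3 / 6"
    unfolding excess_energy_def energy_def by (simp add: field_simps)
  have Re_le: "\<bar>Re (cnj k * z e x)\<bar> \<le> c * cmod (z e x)" for e x
    using abs_Re_le_cmod[of "cnj k * z e x"] k by (simp add: norm_mult)
  have z\<rho>: "cmod (z e x) \<le> \<rho>" if "e \<in> arcs G" "x \<in> {0..l e}" for e x
    using \<rho>[OF that] by (simp add: z_def)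
  have qabs: "\<bar>q e x\<bar> \<le> 2 * c * cmod (z e x) + (cmod (z e x))\<^sup>2" for e x
    using Re_le[of e x] zero_le_power2[of "cmod (z e x)"] unfolding q_eq by linarith
  have 3: "0 \<le> Q2" unfolding Q2_def by (intro gintegral_nonneg) simp
  have "Q2 \<le> gintegral G l (\<lambda>e x. (4 * c\<^sup>2 + 4 * c * \<rho> + \<rho>\<^sup>2) * (cmod (z e x))\<^sup>2)"
    unfolding Q2_def
  proof (intro gintegral_mono i gintegrable_mult_right gintegrable_sq z2)
    fix e x assume ex: "e \<in> arcs G" "x \<in> {0..l e}"
    let ?y = "cmod (z e x)"
    have "(q e x)\<^sup>2 \<le> (2 * c * ?y + ?y\<^sup>2)\<^sup>2"
      using qabs[of e x] by (metis abs_ge_zero power2_abs power_mono)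
    also have "\<dots> = (2 * c + ?y)\<^sup>2 * ?y\<^sup>2" by (simp add: power2_eq_square algebra_simps)
    also have "\<dots> \<le> (2 * c + \<rho>)\<^sup>2 * ?y\<^sup>2"
      using z\<rho>[OF ex] c0 by (intro mult_right_mono power_mono) auto
    finally show "(q e x)\<^sup>2 \<le> (4 * c\<^sup>2 + 4 * c * \<rho> + \<rho>\<^sup>2) * ?y\<^sup>2"
      by (simp add: power2_sum algebra_simps)
  qed
  then have 4: "Q2 \<le> (4 * c\<^sup>2 + 4 * c * \<rho> + \<rho>\<^sup>2) * sqn z" by (simp only: gintegral_mult_right sqn_def)
  have "\<bar>Q3\<bar> \<le> gintegral G l (\<lambda>e x. \<bar>q e x\<bar> ^ 3)"
    using gintegral_norm_le[of "\<lambda>e x. (q e x) ^ 3"] by (simp add: Q3_def power_abs)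
  also have "\<dots> \<le> gintegral G l (\<lambda>e x. ((2 * c + \<rho>) ^ 3 * \<rho>) * (cmod (z e x))\<^sup>2)"
  proof (intro gintegral_mono i gintegrable_mult_right gintegrable_sq z2)
    fix e x assume ex: "e \<in> arcs G" "x \<in> {0..l e}"
    let ?y = "cmod (z e x)"
    have "\<bar>q e x\<bar> ^ 3 \<le> (2 * c * ?y + ?y\<^sup>2) ^ 3" using qabs[of e x] by (intro power_mono) auto
    also have "\<dots> = (2 * c + ?y) ^ 3 * ?y * ?y\<^sup>2"
      by (simp add: power2_eq_square power3_eq_cube algebra_simps)
    also have "\<dots> \<le> (2 * c + \<rho>) ^ 3 * \<rho> * ?y\<^sup>2"
      using z\<rho>[OF ex] c0 \<rho>0 by (intro mult_right_mono mult_mono power_mono) auto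
    finally show "\<bar>q e x\<bar> ^ 3 \<le> ((2 * c + \<rho>) ^ 3 * \<rho>) * ?y\<^sup>2" .
  qed
  finally have 5: "\<bar>Q3\<bar> \<le> (2 * c + \<rho>) ^ 3 * \<rho> * sqn z" by (simp only: gintegral_mult_right sqn_def)
  show ?thesis by (rule that[OF 1 2 3 4 5])
qed

end

section \<open>Coercivity and orbital stability\<close>

text \<open>
  The elimination behind coercivity. In the application \<open>P\<close> and \<open>s\<close> are the squared \<open>L\<^sup>2\<close> norms of \<open>z'\<close> and \<open>z\<close>,
  \<open>D2\<close> and \<open>D3\<close> are powers of the distance, \<open>ev\<close> is \<open>\<lambda>\<^sub>2\<close>, \<open>c4\<close> is \<open>c\<^sup>4\<close>, and \<open>\<Delta>\<close>, \<open>\<eta>2\<close> are the excess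
  energy and the squared excess mass. The spectral gap \<open>4 * c4 < ev\<close> lets the kinetic term absorb \<open>2 * c4 * s\<close>.
\<close>
lemma coercivity_arithmetic:
  fixes P s \<Delta> \<eta>2 D2 D3 ev c4 K2 K3 :: real
  assumes ev: "0 < ev" and c4: "0 \<le> c4" and \<alpha>: "4 * c4 < ev"
    and i: "P / 2 - 2 * c4 * s - K2 * D3 \<le> \<Delta>"
    and ii: "s \<le> P / ev + K3 * (\<eta>2 + D3)"
    and iii: "D2 \<le> 2 * (P + s)"
  defines "B \<equiv> 4 * (1 + 1 / ev) / (1 - 4 * c4 / ev)"
  shows "D2 \<le> B * (\<Delta> + 2 * c4 * K3 * \<eta>2) + 2 * K3 * \<eta>2 + (B * (2 * c4 * K3 + K2) + 2 * K3) * D3"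
proof -
  define a where "a = 1 - 4 * c4 / ev"
  define Y where "Y = \<Delta> + 2 * c4 * K3 * \<eta>2 + (2 * c4 * K3 + K2) * D3"
  have a: "0 < a" using \<alpha> ev by (simp add: a_def)
  have "2 * c4 * s \<le> 2 * c4 * (P / ev + K3 * (\<eta>2 + D3))"
    using c4 ii by (intro mult_left_mono) auto
  also have "\<dots> = 2 * c4 * (P / ev) + 2 * c4 * K3 * \<eta>2 + 2 * c4 * K3 * D3"
    by (simp add: distrib_left mult.assoc)
  finally have "P / 2 - 2 * c4 * (P / ev) \<le> Y" using i unfolding Y_def distrib_right by linarith
  moreover have "P / 2 - 2 * c4 * (P / ev) = a * P / 2" by (simp add: a_def algebra_simps)
  ultimately have "a * P \<le> 2 * Y" by linarith
  then have "P \<le> 2 * Y / a" using a by (simp add: pos_le_divide_eq mult.commute)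
  then have "2 * (1 + 1 / ev) * P \<le> 2 * (1 + 1 / ev) * (2 * Y / a)"
    using ev by (intro mult_left_mono) auto
  also have "\<dots> = B * Y" by (simp add: B_def a_def)
  also have "2 * (1 + 1 / ev) * P = 2 * P + 2 * (P / ev)"
    by (simp add: distrib_left distrib_right)
  finally have PY: "2 * P + 2 * (P / ev) \<le> B * Y" .
  define Z where "Z = K3 * (\<eta>2 + D3)"
  have "D2 \<le> 2 * P + 2 * (P / ev) + 2 * Z" using ii iii unfolding Z_def[symmetric] by simp
  also have "\<dots> \<le> B * Y + 2 * Z" using PY by simp
  finally show ?thesis by (simp add: Y_def Z_def algebra_simps)
qed

context metric_graph begin

text \<open>
  Near the orbit, the squared distance is comparable with a function of the conserved mass and energy. The
  multiple \<open>A\<close> of the squared excess mass compensates for the mean of \<open>z\<close>, to which the Poincare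
  inequality is blind.
\<close>
lemma excess_coercive:
  assumes c: "0 < c" and gap: "4 * c ^ 4 < lambda2 G l"
  obtains A K r where "0 < r" "0 < K"
    "\<forall>u\<in>H1. od c u \<le> r \<longrightarrow>
       (od c u)\<^sup>2 \<le> K * (excess_energy c u + A * (excess_mass c u)\<^sup>2) \<and>
       excess_energy c u + A * (excess_mass c u)\<^sup>2 \<le> K * (od c u)\<^sup>2"
proof -
  let ?L = "total_length G l" and ?ev = "lambda2 G l"
  have L: "?L > 0" by (rule total_length_pos)
  have c4: "0 < c ^ 4" using c by simp
  then have ev: "?ev > 0" using gap by linarith
  obtain C where C: "C > 0" "\<And>u e x. u \<in> H1 \<Longrightarrow> e \<in> arcs G \<Longrightarrow> x \<in> {0..l e} \<Longrightarrow> cmod (u e x) \<le> C * h1n u"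
    using sobolev by blast
  define B where "B = 4 * (1 + 1 / ?ev) / (1 - 4 * c ^ 4 / ?ev)"
  define K2 where "K2 = c\<^sup>2 / 2 * ((4 * c + C) * C) + (2 * c + C) ^ 3 * C / 6"
  define K3 where "K3 = 1 / (2 * c\<^sup>2 * ?L)"
  define A where "A = 2 * c ^ 4 * K3 + 2 * K3 / B"
  define K6 where "K6 = B * (2 * c ^ 4 * K3 + K2) + 2 * K3"
  \<comment> \<open>\<open>K6\<close> is the coefficient of the cubic term; this radius lets half the squared distance absorb it\<close>
  define r where "r = min 1 (1 / (2 * K6))"
  define K where "K = 2 * B + (1 / 2 + (2 * c + C) ^ 3 * C / 6 + A * (2 * c * sqrt ?L + 1)\<^sup>2)"
  have B: "B > 0" using gap ev by (auto simp: B_def intro!: divide_pos_pos add_pos_pos)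
  have K2: "K2 > 0" using c C(1) by (auto simp: K2_def intro!: add_pos_pos)
  have K3: "K3 > 0" using c L by (simp add: K3_def)
  have A: "A > 0" using c4 K3 B by (auto simp: A_def intro!: add_pos_pos)
  have K6: "K6 > 0" unfolding K6_def using B c4 K3 K2 by (intro add_pos_pos mult_pos_pos) auto
  have r: "r > 0" using K6 by (simp add: r_def)
  have "0 \<le> (2 * c + C) ^ 3 * C / 6" "0 \<le> A * (2 * c * sqrt ?L + 1)\<^sup>2" using c C(1) A by auto
  then have K: "2 * B \<le> K" "1 / 2 + (2 * c + C) ^ 3 * C / 6 + A * (2 * c * sqrt ?L + 1)\<^sup>2 \<le> K" "K > 0"
    using B unfolding K_def by linarith+
  have main: "(od c u)\<^sup>2 \<le> K * (excess_energy c u + A * (excess_mass c u)\<^sup>2) \<and>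
       excess_energy c u + A * (excess_mass c u)\<^sup>2 \<le> K * (od c u)\<^sup>2"
    if u: "u \<in> H1" and dr: "od c u \<le> r" for u
  proof -
    obtain \<theta> where \<theta>: "od c u = h1n (\<lambda>e x. u e x - cis \<theta> * of_real c)"
      "Im (cnj (cis \<theta> * of_real c) * gintegral G l u) = 0"
      using od_attained[OF u c] by blast
    define k where "k = cis \<theta> * complex_of_real c"
    have k: "cmod k = c" using c by (simp add: k_def norm_mult)
    define z where "z = (\<lambda>e x. u e x - k)"
    define d where "d = od c u"
    define s where "s = sqn z"
    define P where "P = sqn (D u)"
    define J where "J = cmod (gintegral G l z)"
    define \<eta> where "\<eta> = excess_mass c u"
    define \<Delta> where "\<Delta> = excess_energy c u"
    have z: "z \<in> H1" unfolding z_def by (intro H1_diff u H1_const)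
    have dz: "d = nrm (D u) + nrm z"
      unfolding d_def \<theta>(1) h1n_eq nrm_D_minus_const[OF u] by (simp add: z_def k_def)
    have dh: "d = h1n z" unfolding d_def \<theta>(1) by (simp add: z_def k_def)
    have d: "0 \<le> d" "d \<le> 1" "2 * K6 * d \<le> 1"
      using od_nonneg[of u c] dr K6 by (auto simp: d_def r_def pos_le_divide_eq mult.commute)
    have s0: "0 \<le> s" "0 \<le> P" by (simp_all add: s_def P_def sqn_nonneg)
    have "nrm z \<le> d" "nrm (D u) \<le> d" using dz nrm_nonneg[of z] nrm_nonneg[of "D u"] by auto
    then have sd: "s \<le> d\<^sup>2" "P \<le> d\<^sup>2"
      using nrm_nonneg[of z] nrm_nonneg[of "D u"] by (auto simp: s_def P_def power_mono simp flip: nrm_sq)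
    have "cmod (u e x - k) \<le> C * d" if "e \<in> arcs G" "x \<in> {0..l e}" for e x
      using C(2)[OF z that] by (simp add: dh z_def)
    note expansion = excess_expansion[OF u k this, folded z_def \<eta>_def \<Delta>_def s_def P_def]
    obtain Q2 Q3 where Q: "\<eta> = 2 * Re (cnj k * gintegral G l z) + s"
      "\<Delta> = P / 2 - c\<^sup>2 / 2 * Q2 - Q3 / 6"
      "0 \<le> Q2" "Q2 \<le> (4 * c\<^sup>2 + 4 * c * (C * d) + (C * d)\<^sup>2) * s" "\<bar>Q3\<bar> \<le> (2 * c + C * d) ^ 3 * (C * d) * s"
      by (rule expansion)
    have Q3: "\<bar>Q3\<bar> \<le> (2 * c + C) ^ 3 * C * d ^ 3"
    proof -
      have "\<bar>Q3\<bar> \<le> (2 * c + C * d) ^ 3 * (C * d) * s" by (rule Q(5))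
      also have "\<dots> \<le> (2 * c + C) ^ 3 * (C * d) * d\<^sup>2"
        using c C(1) d s0 sd by (intro mult_mono power_mono add_mono mult_left_le) auto
      finally show ?thesis by (simp add: power2_eq_square power3_eq_cube mult_ac)
    qed
    have Q2: "Q2 \<le> 4 * c\<^sup>2 * s + (4 * c + C) * C * d ^ 3"
    proof -
      have "4 * c * (C * d) + (C * d)\<^sup>2 = (4 * c + C * d) * (C * d)"
        by (simp add: power2_eq_square algebra_simps)
      then have "Q2 \<le> 4 * c\<^sup>2 * s + (4 * c + C * d) * (C * d) * s"
        using Q(4) by (simp add: distrib_right add.assoc)
      also have "(4 * c + C * d) * (C * d) * s \<le> (4 * c + C) * (C * d) * d\<^sup>2"
        using c C(1) d s0 sd by (intro mult_mono add_mono mult_left_le) auto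
      finally show ?thesis by (simp add: power2_eq_square power3_eq_cube mult_ac)
    qed
    have i: "P / 2 - 2 * c ^ 4 * s - K2 * d ^ 3 \<le> \<Delta>"
    proof -
      have "c\<^sup>2 / 2 * Q2 \<le> c\<^sup>2 / 2 * (4 * c\<^sup>2 * s + (4 * c + C) * C * d ^ 3)"
        using Q2 by (intro mult_left_mono) auto
      also have "\<dots> = 2 * c ^ 4 * s + c\<^sup>2 / 2 * ((4 * c + C) * C) * d ^ 3"
        by (simp add: distrib_left mult.assoc power2_eq_square power4_eq_xxxx)
      finally show ?thesis using Q3 unfolding Q(2) K2_def distrib_right by simp
    qed
    \<comment> \<open>the choice of the phase makes \<open>cnj k * \<integral>z\<close> real, so the excess mass determines it\<close>
    have J: "c\<^sup>2 * J\<^sup>2 = ((\<eta> - s) / 2)\<^sup>2"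
    proof -
      have "cnj k * gintegral G l z = cnj k * gintegral G l u - of_real (c\<^sup>2 * ?L)"
      proof -
        have "cnj k * k = of_real (c\<^sup>2)" using complex_norm_square[of k] k by (simp add: mult.commute)
        then show ?thesis
          unfolding z_def gintegral_minus_const[OF H1D(1)[OF u]] right_diff_distrib of_real_mult
          by (simp flip: mult.assoc)
      qed
      then have "Im (cnj k * gintegral G l z) = 0" using \<theta>(2) by (simp add: k_def)
      then have "cmod (cnj k * gintegral G l z) = \<bar>Re (cnj k * gintegral G l z)\<bar>"
        by (simp only: cmod_eq_Re)
      also have "Re (cnj k * gintegral G l z) = (\<eta> - s) / 2" unfolding Q(1) by simp
      finally have "c * J = \<bar>(\<eta> - s) / 2\<bar>" by (simp add: norm_mult k J_def)
      then show ?thesis by (metis power2_abs power_mult_distrib)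
    qed
    have d43: "d ^ 4 \<le> d ^ 3" using d by (intro power_decreasing) auto
    have s2: "s\<^sup>2 \<le> d ^ 4" using power_mono[OF sd(1) s0(1), of 2] by (simp flip: power_mult)
    have ii: "s \<le> P / ?ev + K3 * (\<eta>\<^sup>2 + d ^ 3)"
    proof -
      have "sqn (D z) = P"
        using nrm_D_minus_const[OF u, of k] by (simp add: z_def P_def flip: nrm_sq)
      then have "?ev * (s - J\<^sup>2 / ?L) \<le> P"
        using poincare[OF z] by (simp add: s_def J_def)
      then have "s - J\<^sup>2 / ?L \<le> P / ?ev" using ev by (simp only: pos_le_divide_eq mult.commute)
      moreover have "c\<^sup>2 * J\<^sup>2 \<le> (\<eta>\<^sup>2 + s\<^sup>2) / 2"
        unfolding J using zero_le_power2[of "\<eta> + s"] by (simp add: power2_eq_square field_simps)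
      then have "c\<^sup>2 * J\<^sup>2 \<le> (\<eta>\<^sup>2 + d ^ 3) / 2" using s2 d43 by simp
      then have "J\<^sup>2 \<le> (\<eta>\<^sup>2 + d ^ 3) / (2 * c\<^sup>2)" using c by (simp add: pos_le_divide_eq mult_ac)
      then have "J\<^sup>2 / ?L \<le> (\<eta>\<^sup>2 + d ^ 3) / (2 * c\<^sup>2) / ?L" using L by (intro divide_right_mono) auto
      then have "J\<^sup>2 / ?L \<le> K3 * (\<eta>\<^sup>2 + d ^ 3)" by (simp add: K3_def)
      ultimately show ?thesis by linarith
    qed
    have iii: "d\<^sup>2 \<le> 2 * (P + s)"
      using sum_squares_bound[of "nrm (D u)" "nrm z"]
      unfolding dz P_def s_def nrm_sq[symmetric] power2_sum by simp
    have "d\<^sup>2 \<le> B * (\<Delta> + 2 * c ^ 4 * K3 * \<eta>\<^sup>2) + 2 * K3 * \<eta>\<^sup>2 + K6 * d ^ 3"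
      using coercivity_arithmetic[OF ev less_imp_le[OF c4] gap i ii iii] by (simp only: B_def K6_def)
    also have "B * (\<Delta> + 2 * c ^ 4 * K3 * \<eta>\<^sup>2) + 2 * K3 * \<eta>\<^sup>2 = B * (\<Delta> + A * \<eta>\<^sup>2)"
      using B by (simp add: A_def algebra_simps)
    also have "K6 * d ^ 3 \<le> d\<^sup>2 / 2"
      using mult_right_mono[OF d(3), of "d\<^sup>2"] by (simp add: power2_eq_square power3_eq_cube mult_ac)
    finally have low: "d\<^sup>2 \<le> 2 * B * (\<Delta> + A * \<eta>\<^sup>2)" by simp
    then have "0 \<le> (2 * B) * (\<Delta> + A * \<eta>\<^sup>2)" using zero_le_power2[of d] by linarith
    then have V0: "0 \<le> \<Delta> + A * \<eta>\<^sup>2" using B by (simp only: zero_le_mult_iff) auto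
    then have low': "d\<^sup>2 \<le> K * (\<Delta> + A * \<eta>\<^sup>2)"
      using low mult_right_mono[OF K(1) V0] by linarith
    have J_le: "J \<le> sqrt ?L * d"
    proof -
      have "J \<le> nrm z * nrm (\<lambda>e x. 1)"
        using ip_norm_le[OF H1D(1)[OF z] gL2_const[of 1]] by (simp add: J_def ip_one)
      also have "nrm (\<lambda>e x. 1) = sqrt ?L" by (simp add: nrm_eq sqn_const)
      also have "nrm z * sqrt ?L \<le> d * sqrt ?L" using \<open>nrm z \<le> d\<close> L by (intro mult_right_mono) auto
      finally show ?thesis by (simp only: mult.commute)
    qed
    have "\<bar>\<eta>\<bar> \<le> (2 * c * sqrt ?L + 1) * d"
    proof -
      have "\<bar>Re (cnj k * gintegral G l z)\<bar> \<le> c * J"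
        using abs_Re_le_cmod[of "cnj k * gintegral G l z"] k by (simp add: norm_mult J_def)
      moreover have "c * J \<le> c * (sqrt ?L * d)" using J_le c by (intro mult_left_mono) auto
      moreover have "s \<le> d" using sd(1) mult_left_le[OF d(2,1)] by (simp add: power2_eq_square)
      ultimately show ?thesis unfolding Q(1) using s0 by (simp add: algebra_simps)
    qed
    from power_mono[OF this, of 2] have "\<eta>\<^sup>2 \<le> (2 * c * sqrt ?L + 1)\<^sup>2 * d\<^sup>2"
      by (simp add: power_mult_distrib)
    then have \<eta>2: "A * \<eta>\<^sup>2 \<le> A * ((2 * c * sqrt ?L + 1)\<^sup>2 * d\<^sup>2)" using A by (intro mult_left_mono) auto
    define E where "E = (2 * c + C) ^ 3 * C"
    define F where "F = A * (2 * c * sqrt ?L + 1)\<^sup>2"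
    have "d ^ 3 \<le> d\<^sup>2" using d by (intro power_decreasing) auto
    then have "E * d ^ 3 \<le> E * d\<^sup>2"
      using c C(1) by (intro mult_left_mono) (auto simp: E_def)
    moreover have "\<bar>Q3\<bar> \<le> E * d ^ 3" using Q3 by (simp only: E_def)
    moreover have "0 \<le> c\<^sup>2 / 2 * Q2" using Q(3) by simp
    ultimately have "\<Delta> \<le> d\<^sup>2 / 2 + E * d\<^sup>2 / 6" using sd(2) unfolding Q(2) by linarith
    moreover have "A * \<eta>\<^sup>2 \<le> F * d\<^sup>2" using \<eta>2 by (simp only: F_def mult.assoc)
    ultimately have "\<Delta> + A * \<eta>\<^sup>2 \<le> (1 / 2 + E / 6 + F) * d\<^sup>2"
      by (simp add: distrib_right)
    also have "\<dots> \<le> K * d\<^sup>2" unfolding E_def F_def by (intro mult_right_mono K(2)) simp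
    finally show ?thesis using low' by (simp add: d_def \<Delta>_def \<eta>_def)
  qed
  show ?thesis by (rule that[OF r K(3)]) (use main in blast)
qed

text \<open>
  As long as the solution stays within the radius of coercivity, its distance to the orbit is at most a
  fixed multiple of the initial one. By continuity in time it cannot reach the smaller radius \<open>\<rho>\<close>.
\<close>
theorem constant_orbitally_stable:
  assumes c: "0 < c" and gap: "4 * c ^ 4 < lambda2 G l"
  shows "orbitally_stable G l (cst c)"
  unfolding orbitally_stable_def
proof (intro allI impI)
  fix \<epsilon> :: real assume \<epsilon>: "\<epsilon> > 0"
  obtain A K r where r: "0 < r" and K: "0 < K" and
    coercive: "\<forall>u\<in>H1. od c u \<le> r \<longrightarrow>
       (od c u)\<^sup>2 \<le> K * (excess_energy c u + A * (excess_mass c u)\<^sup>2) \<and>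
       excess_energy c u + A * (excess_mass c u)\<^sup>2 \<le> K * (od c u)\<^sup>2"
    by (rule excess_coercive[OF c gap])
  note coer = coercive[rule_format]
  define \<rho> where "\<rho> = min (\<epsilon> / 2) r"
  have \<rho>: "\<rho> > 0" "\<rho> \<le> r" "\<rho> \<le> \<epsilon> / 2" using \<epsilon> r by (auto simp: \<rho>_def)
  define \<delta>0 where "\<delta>0 = \<rho> / (K + 1)"
  have \<delta>0: "\<delta>0 > 0" "\<delta>0 \<le> \<rho>" "K * \<delta>0 < \<rho>" using K \<rho> by (auto simp: \<delta>0_def field_simps)
  show "\<exists>\<delta>>0. \<forall>v0\<in>H1. od c v0 < \<delta> \<longrightarrow> (\<forall>T v. 0 < T \<and> nls_solution G l T v0 v \<longrightarrow>
           (SUP t\<in>time_interval T. ereal (od c (v t))) < ereal \<epsilon>)"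
  proof (intro exI[of _ \<delta>0] conjI ballI impI allI \<delta>0(1))
    fix v0 T v assume v0: "od c v0 < \<delta>0" and "0 < T \<and> nls_solution G l T v0 v"
    then interpret nls_curve G l T v0 v by unfold_locales auto
    have start: "od c (v 0) < \<delta>0" using od_cong[of "v 0" v0] v_0 v0 by simp
    have apriori: "od c (v t) \<le> K * od c (v 0)" if t: "t \<in> I" and small: "od c (v t) \<le> r" for t
    proof -
      let ?V = "\<lambda>u. excess_energy c u + A * (excess_mass c u)\<^sup>2"
      have "(od c (v t))\<^sup>2 \<le> K * ?V (v t)" using coer[OF v_H1[OF t] small] by simp
      also have "?V (v t) = ?V (v 0)"
        using mass_conservation[OF t] energy_conservation[OF t]
        by (simp add: excess_energy_def excess_mass_def)
      also have "K * ?V (v 0) \<le> K * (K * (od c (v 0))\<^sup>2)"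
        using coer[OF v_H1[OF zero_in_I]] start \<delta>0 \<rho> K by (intro mult_left_mono) auto
      finally have "(od c (v t))\<^sup>2 \<le> K * (K * (od c (v 0))\<^sup>2)" .
      then have "(od c (v t))\<^sup>2 \<le> (K * od c (v 0))\<^sup>2" by (simp add: power2_eq_square mult_ac)
      then show ?thesis by (rule power2_le_imp_le) (use K od_nonneg in auto)
    qed
    have stay: "od c (v t) < \<rho>" if t: "t \<in> I" for t
    proof (rule ccontr)
      assume "\<not> od c (v t) < \<rho>"
      then have ge: "\<rho> \<le> od c (v t)" by simp
      have t0: "0 \<le> t" using t by (simp add: time_interval_def)
      have "continuous_on {0..t} (\<lambda>s. od c (v s))"
      proof (rule continuous_on_of_\<delta>_lipschitz[OF Icc_subset_I[OF t], where K=1])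
        fix p q assume "p \<in> {0..t}" "q \<in> {0..t}"
        then have pq: "p \<in> I" "q \<in> I" using Icc_subset_I[OF t] by auto
        show "\<bar>od c (v p) - od c (v q)\<bar> \<le> 1 * \<delta> p q"
          using od_lipschitz[OF v_H1[OF pq(1)] v_H1[OF pq(2)] c] od_lipschitz[OF v_H1[OF pq(2)] v_H1[OF pq(1)] c]
            \<delta>_commute[OF pq] by (simp add: \<delta>_def)
      qed
      then obtain s where s: "0 \<le> s" "s \<le> t" "od c (v s) = \<rho>"
        using IVT'[of "\<lambda>s. od c (v s)" 0 \<rho> t] start \<delta>0(2) ge t0 by auto
      have sI: "s \<in> I" using I_downward[OF t s(1,2)] .
      have "\<rho> \<le> K * od c (v 0)" using apriori[OF sI] s(3) \<rho>(2) by simp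
      also have "\<dots> \<le> K * \<delta>0" using start K by (intro mult_left_mono) auto
      also have "\<dots> < \<rho>" by (rule \<delta>0(3))
      finally show False by simp
    qed
    have "(SUP t\<in>I. ereal (od c (v t))) \<le> ereal (\<epsilon> / 2)"
      using stay \<rho>(3) by (intro SUP_least) (fastforce intro: less_imp_le)
    also have "\<dots> < ereal \<epsilon>" using \<epsilon> by simp
    finally show "(SUP t\<in>I. ereal (od c (v t))) < ereal \<epsilon>" .
  qed
qed

lemma cst_H2K: "cst c \<in> H2K_graph G l"
proof -
  have "vector_derivative (\<lambda>x. complex_of_real c) (at y within {0..l e}) = 0"
    if "e \<in> arcs G" "y \<in> {0..l e}" for e y
    using vector_derivative_within_cbox[of 0 "l e" y "\<lambda>_. complex_of_real c" 0] length_pos[OF that(1)] that(2)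
    by (simp add: has_vector_derivative_const)
  then have "kirchhoff G l (cst c)"
    using length_pos by (auto simp: kirchhoff_def cst_def less_imp_le intro!: sum.neutral)
  then show ?thesis
    using H1_const wderiv_wderiv_const(1) by (auto simp: H2K_graph_def cst_def)
qed

lemma cst_stationary: "0 < c \<Longrightarrow> stationary_eq G l (c ^ 4) (cst c)"
  unfolding stationary_eq_def gderiv_def cst_def
  using wderiv_wderiv_const(2) by (auto elim: eventually_mono)

theorem constant_solution_stable:
  assumes \<mu>: "0 < \<mu>" "\<mu> < mu1_6 G l"
  shows "\<exists>u \<in> H2K_graph G l. (\<exists>lam::real. stationary_eq G l lam u) \<and>
           (Lp_norm G l 2 u)\<^sup>2 = \<mu> \<and> orbitally_stable G l u \<and> u = kappa G l \<mu>"
proof -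
  let ?L = "total_length G l"
  define c where "c = sqrt (\<mu> / ?L)"
  have L: "?L > 0" by (rule total_length_pos)
  have c: "c > 0" and c2: "c\<^sup>2 = \<mu> / ?L" using \<mu>(1) L by (simp_all add: c_def)
  have k: "kappa G l \<mu> = cst c" by (simp add: kappa_def cst_def c_def)
  have "sqrt (lambda2 G l / 4) > \<mu> / ?L"
    using \<mu>(2) L by (simp add: mu1_6_def pos_divide_less_eq mult.commute)
  moreover have "\<mu> / ?L > 0" using \<mu>(1) L by simp
  ultimately have "(\<mu> / ?L)\<^sup>2 < lambda2 G l / 4"
    by (metis less_imp_le real_less_rsqrt real_sqrt_less_iff real_sqrt_unique)
  then have "4 * c ^ 4 < lambda2 G l" by (simp flip: c2 power_mult)
  then have "orbitally_stable G l (cst c)" by (intro constant_orbitally_stable c)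
  moreover have "(nrm (cst c))\<^sup>2 = \<mu>"
    using L by (simp add: nrm_sq cst_def sqn_const c2)
  ultimately show ?thesis
    unfolding k using cst_H2K cst_stationary[OF c] by blast
qed

end

theorem corollary2p4:
  fixes G :: "('v, 'e) pre_digraph" and l :: "'e \<Rightarrow> real"
  assumes "compact_metric_graph G l"
  shows "(has_terminal_edge G \<longrightarrow>
            (\<forall>\<mu>. mu_halfline < \<mu> \<and> \<mu> < mu1_6 G l \<longrightarrow>
               (\<exists>u \<in> H2K_graph G l. (\<exists>lam::real. stationary_eq G l lam u) \<and>
                  (Lp_norm G l 2 u)\<^sup>2 = \<mu> \<and> orbitally_stable G l u \<and> u = kappa G l \<mu>)))
       \<and> (has_cycle_covering G \<longrightarrow>
            (\<forall>\<mu>. mu_line < \<mu> \<and> \<mu> < mu1_6 G l \<longrightarrow>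
               (\<exists>u \<in> H2K_graph G l. (\<exists>lam::real. stationary_eq G l lam u) \<and>
                  (Lp_norm G l 2 u)\<^sup>2 = \<mu> \<and> orbitally_stable G l u \<and> u = kappa G l \<mu>)))"
proof -
  interpret metric_graph G l
    using assms by unfold_locales (auto simp: compact_metric_graph_def intro: fin_digraph.finite_arcs)
  have pos: "0 < mu_halfline" "0 < mu_line" by (simp_all add: mu_halfline_def mu_line_def)
  show ?thesis
    using pos constant_solution_stable by (meson less_trans)
qed

end
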